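(* Let $s\ge0$, $\mu>-1$, and $\psi\in H^s_{(\mu)}(\mathrm J)$, and let $p,t,\sigma\in\mathbb R$. Then $x^p\psi\in H^t_{(\sigma)}(\mathrm J)$ provided $$0\le t\le s,\qquad \sigma+2p\ge\mu,\qquad \sigma+2p-t>-1,\qquad \sigma+2p+t\ge\mu+s .$$ Additionally, when these conditions are satisfied, there exists $C>0$ (independent of $\psi$) such that $$\|x^p\psi\|_{H^t_{(\sigma)}(\mathrm J)}\le C\,\|\psi\|_{H^s_{(\mu)}(\mathrm J)} .$$
   Context: $\mathrm J=(0,3/4)$, $\lfloor s\rfloor$ is the integer part of $s$, and $D$ denotes differentiation. Let $\Lambda=\{(x,y):\tfrac23x<y<\tfrac32x,\ 0<x<\tfrac12\}$, $\Lambda_1=\{(x,y):\tfrac32x-\tfrac12<y<\tfrac23x+\tfrac13,\ \tfrac12\le x<\tfrac34\}$ and $\|g\|^2_{L^2_{(\gamma)}(\mathrm J)}=\int_{\mathrm J}x^\gamma g(x)^2dx$. For $s\ge0$ and real $\gamma$, the semi-norm is $$|f|^2_{H^s_{(\gamma)}(\mathrm J)}=\iint_{\Lambda\cup\Lambda_1}x^{\gamma+s}\,\frac{|D^{\lfloor s\rfloor}f(x)-D^{\lfloor s\rfloor}f(y)|^2}{|x-y|^{1+2(s-\lfloor s\rfloor)}}\,dy\,dx ,$$ the norm is given by $\|f\|^2_{H^s_{(\gamma)}(\mathrm J)}=\sum_{j=0}^{s}\|D^jf\|^2_{L^2_{(\gamma+j)}(\mathrm J)}$ if $s\in\{0,1,2,\dots\}$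 and $\|f\|^2_{H^s_{(\gamma)}(\mathrm J)}=\sum_{j=0}^{\lfloor s\rfloor}\|D^jf\|^2_{L^2_{(\gamma+j)}(\mathrm J)}+|f|^2_{H^s_{(\gamma)}(\mathrm J)}$ otherwise, and $H^s_{(\gamma)}(\mathrm J)=\{f\text{ measurable}:\|f\|_{H^s_{(\gamma)}(\mathrm J)}<\infty\}$.
   Formalization: The semi-norm's double integral is taken over the part of Λ∪Λ₁ lying in J×J, because Λ₁ contains points (x,y) with y≥3/4 (when x>5/8), where functions on J are undefined; D is read as the weak derivative on J. *)

theory Defs
  imports "HOL-Analysis.Analysis"
begin

definition J :: "real set" where
  "J = {0<..<3/4}"

definition Lam :: "(real \<times> real) set" where
  "Lam = {(x, y). 2/3 * x < y \<and> y < 3/2 * x \<and> 0 < x \<and> x < 1/2}"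

definition Lam1 :: "(real \<times> real) set" where
  "Lam1 = {(x, y). 3/2 * x - 1/2 < y \<and> y < 2/3 * x + 1/3 \<and> 1/2 \<le> x \<and> x < 3/4}"

text \<open>Distributional derivatives on \<open>J\<close>. A test function is a smooth function on the line
  with compact support contained in the open interval \<open>J\<close>.\<close>

definition test_function :: "(real \<Rightarrow> real) \<Rightarrow> bool" where
  "test_function \<phi> \<longleftrightarrow>
     (\<forall>k. (deriv ^^ k) \<phi> differentiable_on UNIV) \<and>
     compact (closure {x. \<phi> x \<noteq> 0}) \<and> closure {x. \<phi> x \<noteq> 0} \<subseteq> J"

definition locally_integrable_J :: "(real \<Rightarrow> real) \<Rightarrow> bool" where
  "locally_integrable_J f \<longleftrightarrow> (\<forall>K. compact K \<and> K \<subseteq> J \<longrightarrow> f absolutely_integrable_on K)"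

definition has_weak_deriv :: "nat \<Rightarrow> (real \<Rightarrow> real) \<Rightarrow> (real \<Rightarrow> real) \<Rightarrow> bool" where
  "has_weak_deriv j f g \<longleftrightarrow>
     locally_integrable_J f \<and> locally_integrable_J g \<and>
     (\<forall>\<phi>. test_function \<phi> \<longrightarrow>
        (LINT x:J|lebesgue. f x * (deriv ^^ j) \<phi> x) =
        (-1) ^ j * (LINT x:J|lebesgue. g x * \<phi> x))"

text \<open>A representative of the \<open>j\<close>-th weak derivative. It is determined almost everywhere on
  \<open>J\<close> when a weak derivative exists, and is unspecified otherwise.\<close>

definition weak_deriv :: "nat \<Rightarrow> (real \<Rightarrow> real) \<Rightarrow> real \<Rightarrow> real" where
  "weak_deriv j f = (SOME g. has_weak_deriv j f g)"

definition L2_normsq :: "real \<Rightarrow> (real \<Rightarrow> real) \<Rightarrow> ennreal" where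
  "L2_normsq \<gamma> g = (\<integral>\<^sup>+x\<in>J. ennreal (x powr \<gamma> * (g x)\<^sup>2) \<partial>lebesgue)"

text \<open>\<open>Lam1\<close> contains points \<open>(x, y)\<close> with \<open>y \<ge> 3/4\<close>, where functions on \<open>J\<close> have no
  value, so the domain of integration is intersected with \<open>J \<times> J\<close>.\<close>

definition H_seminormsq :: "real \<Rightarrow> real \<Rightarrow> (real \<Rightarrow> real) \<Rightarrow> ennreal" where
  "H_seminormsq s \<gamma> f =
     (\<integral>\<^sup>+z\<in>(Lam \<union> Lam1) \<inter> (J \<times> J).
        (case z of (x, y) \<Rightarrow>
          ennreal (x powr (\<gamma> + s) *
            (\<bar>weak_deriv (nat \<lfloor>s\<rfloor>) f x - weak_deriv (nat \<lfloor>s\<rfloor>) f y\<bar>\<^sup>2 /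
             \<bar>x - y\<bar> powr (1 + 2 * (s - of_int \<lfloor>s\<rfloor>))))) \<partial>lebesgue)"

text \<open>The squared norm is infinite if one of the required weak derivatives does not exist.\<close>

definition H_normsq :: "real \<Rightarrow> real \<Rightarrow> (real \<Rightarrow> real) \<Rightarrow> ennreal" where
  "H_normsq s \<gamma> f =
     (if \<forall>j\<le>nat \<lfloor>s\<rfloor>. \<exists>g. has_weak_deriv j f g
      then (\<Sum>j\<le>nat \<lfloor>s\<rfloor>. L2_normsq (\<gamma> + real j) (weak_deriv j f)) +
           (if s \<in> \<nat> then 0 else H_seminormsq s \<gamma> f)
      else \<infinity>)"

definition H_norm :: "real \<Rightarrow> real \<Rightarrow> (real \<Rightarrow> real) \<Rightarrow> real" where
  "H_norm s \<gamma> f = sqrt (enn2real (H_normsq s \<gamma> f))"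

definition H_space :: "real \<Rightarrow> real \<Rightarrow> (real \<Rightarrow> real) set" where
  "H_space s \<gamma> = {f. f \<in> borel_measurable (lebesgue_on J) \<and> H_normsq s \<gamma> f < \<infinity>}"

end

theory Submission
  imports Defs
begin

text \<open>
  Multiplication by \<open>x\<^sup>p\<close> costs powers of \<open>x\<close> in two ways: through the factor itself, and through the
  derivatives that fall on it. The weights absorb the first loss, and Hardy's inequality pays for the
  second one.

  By Leibniz' rule, \<open>D\<^sup>j(x\<^sup>p \<psi>)\<close> is a combination of the functions \<open>x\<^bsup>p-j+i\<^esup> D\<^sup>i\<psi>\<close> with \<open>i \<le> j\<close>. The
  \<open>L\<^sup>2\<close> part of the norm of \<open>x\<^sup>p \<psi>\<close> therefore consists of integrals of \<open>x\<^bsup>a+2i\<^esup> |D\<^sup>i\<psi>|\<^sup>2\<close> with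
  \<open>a = \<sigma>+2p-j\<close>, and \<open>a > -1\<close> because \<open>\<sigma>+2p-t > -1\<close>. For such \<open>a\<close>, Hardy's inequality
  replaces \<open>x\<^bsup>a+2i\<^esup> |D\<^sup>i\<psi>|\<^sup>2\<close> by \<open>x\<^bsup>a+2(i+1)\<^esup> |D\<^bsup>i+1\<^esup>\<psi>|\<^sup>2\<close>, up to the norm of \<open>\<psi>\<close>, which controls
  \<open>D\<^sup>i\<psi>\<close> away from \<open>0\<close>. Each step gains two powers of \<open>x\<close>, whereas the weights \<open>\<mu>+i\<close> in the norm of
  \<open>\<psi>\<close> increase by one. At order \<open>j\<close> the exponent is \<open>\<sigma>+2p+j \<ge> \<mu>+j\<close>, and since \<open>x < 1\<close> a larger
  exponent is a smaller weight (\<open>dominated_iterated_hardy\<close>, \<open>dominated_chain_normsq\<close>).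

  Let now \<open>t = k+\<theta>\<close> with \<open>0 < \<theta> < 1\<close> and \<open>a = \<sigma>+2p-t\<close>. On the region of integration of the semi-norm,
  \<open>x\<close> and \<open>y\<close> are comparable. Splitting \<open>x\<^sup>r g(x) - y\<^sup>r g(y)\<close> into \<open>x\<^sup>r (g(x) - g(y))\<close> and
  \<open>(x\<^sup>r - y\<^sup>r) g(y)\<close> bounds the semi-norm of \<open>x\<^sup>r g\<close> by a semi-norm of \<open>g\<close> and a weighted
  \<open>L\<^sup>2\<close> norm of \<open>g\<close> (\<open>wsemisq_powr_mult\<close>). If \<open>g\<close> has a derivative, its semi-norm is at most a weighted
  \<open>L\<^sup>2\<close> norm of the derivative (\<open>wsemisq_le_wnormsq_deriv\<close>). So everything reduces to the integrals of
  \<open>x\<^bsup>a+2i\<^esup> |D\<^sup>i\<psi>|\<^sup>2\<close> for \<open>i \<le> k\<close>, and to one more term at the top. If \<open>\<psi>\<close> has \<open>k+1\<close>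
  derivatives in its norm, then Hardy's inequality leads to order \<open>k+1\<close>. Otherwise \<open>s\<close> and \<open>t\<close> have the
  same integer part; the last step is then the fractional Hardy inequality, which bounds the
  \<open>L\<^sup>2\<close> norm of \<open>D\<^sup>k\<psi>\<close> by its semi-norm of order \<open>s-k\<close>.

  The fractional Hardy inequality (\<open>fractional_hardy\<close>) comes from comparing \<open>g(x)\<close> with
  \<open>g(lx)\<close> for \<open>5/4 < l < 3/2\<close>. The integral of \<open>x\<^sup>a g(lx)\<^sup>2\<close> is \<open>l\<^bsup>-(a+1)\<^esup>\<close> times an integral of
  \<open>x\<^sup>a g(x)\<^sup>2\<close>; this factor is bounded away from \<open>1\<close> exactly because \<open>a > -1\<close>, so that the term
  can be absorbed. What remains is \<open>g(x) - g(lx)\<close>, and averaging over \<open>l\<close> turns it into the semi-norm. Hardy's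
  inequality itself is the case of order \<open>1/2\<close>, followed by \<open>wsemisq_le_wnormsq_deriv\<close>.

  These estimates speak about functions that are primitives of each other, whereas the norm is defined by
  weak derivatives that are fixed only up to null sets. The du Bois-Reymond lemma
  (\<open>constant_of_weak_deriv_0\<close>) closes this gap: a function with a locally integrable weak derivative is
  almost everywhere a primitive of it (\<open>weak_D_FTC\<close>).
\<close>

section \<open>Smooth functions and test functions\<close>

text \<open>Smoothness to a finite order, by recursion on the order. The iterated derivatives of a product or a
composition have no simple closed form, but this recursion needs only the first derivative at each
step.\<close>

primrec smooth_upto :: "nat \<Rightarrow> (real \<Rightarrow> real) \<Rightarrow> bool" where
  "smooth_upto 0 f \<longleftrightarrow> f differentiable_on UNIV"
| "smooth_upto (Suc n) f \<longleftrightarrow> f differentiable_on UNIV \<and> smooth_upto n (deriv f)"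

lemma smooth_upto_iff: "smooth_upto n f \<longleftrightarrow> (\<forall>k\<le>n. (deriv ^^ k) f differentiable_on UNIV)"
proof (induction n arbitrary: f)
  case 0 then show ?case by simp
next
  case (Suc n)
  have "(\<forall>k\<le>Suc n. (deriv ^^ k) f differentiable_on UNIV) \<longleftrightarrow>
     f differentiable_on UNIV \<and> (\<forall>k\<le>n. (deriv ^^ Suc k) f differentiable_on UNIV)"
    by (metis (no_types, lifting) Suc_le_mono bot_nat_0.extremum funpow_0 not0_implies_Suc)
  then show ?case using Suc by (simp add: funpow_swap1)
qed

lemma smooth_upto_imp_differentiable: "smooth_upto n f \<Longrightarrow> f differentiable_on UNIV"
  by (cases n) auto

lemma smooth_upto_Suc_D: "smooth_upto (Suc n) f \<Longrightarrow> smooth_upto n f"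
  by (simp add: smooth_upto_iff)

lemma differentiable_on_UNIV_DERIV:
  "f differentiable_on UNIV \<Longrightarrow> (f has_real_derivative deriv f x) (at x)"
  by (simp add: differentiable_on_def DERIV_deriv_iff_real_differentiable)

lemma smooth_upto_SucI:
  assumes "\<And>x. (f has_real_derivative f' x) (at x)" "smooth_upto n f'"
  shows "smooth_upto (Suc n) f"
proof -
  have "deriv f = f'" using assms(1) by (auto intro: DERIV_imp_deriv)
  moreover have "f differentiable_on UNIV"
    using assms(1) by (auto simp: differentiable_on_def real_differentiable_def)
  ultimately show ?thesis using assms(2) by simp
qed

lemma smooth_upto_const: "smooth_upto n (\<lambda>x. c)"
proof (induction n arbitrary: c)
  case (Suc n) show ?case
    by (rule smooth_upto_SucI[where f'="\<lambda>_. 0"]) (auto intro: Suc)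
qed auto

lemma smooth_upto_add:
  "smooth_upto n f \<Longrightarrow> smooth_upto n g \<Longrightarrow> smooth_upto n (\<lambda>x. f x + g x)"
proof (induction n arbitrary: f g)
  case 0 then show ?case by (auto intro: differentiable_on_add)
next
  case (Suc n)
  show ?case
    by (rule smooth_upto_SucI[where f'="\<lambda>x. deriv f x + deriv g x"])
       (use Suc in \<open>auto intro!: DERIV_add differentiable_on_UNIV_DERIV\<close>)
qed

lemma smooth_upto_mult:
  "smooth_upto n f \<Longrightarrow> smooth_upto n g \<Longrightarrow> smooth_upto n (\<lambda>x. f x * g x)"
proof (induction n arbitrary: f g)
  case 0 then show ?case by (auto intro: differentiable_on_mult)
next
  case (Suc n)
  have "smooth_upto n f" "smooth_upto n g" using Suc.prems by (blast intro: smooth_upto_Suc_D)+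
  moreover have "((\<lambda>x. f x * g x) has_real_derivative (deriv f x * g x + deriv g x * f x)) (at x)" for x
    using Suc.prems by (intro DERIV_mult differentiable_on_UNIV_DERIV) auto
  ultimately show ?case using Suc
    by (intro smooth_upto_SucI[where f'="\<lambda>x. deriv f x * g x + deriv g x * f x"] smooth_upto_add) auto
qed

lemma smooth_upto_affine:
  "smooth_upto n f \<Longrightarrow> smooth_upto n (\<lambda>x. f (c * x + d))"
proof (induction n arbitrary: f)
  case 0
  have "((\<lambda>x. f (c * x + d)) has_real_derivative deriv f (c * x + d) * c) (at x)" for x
    using 0 by (intro DERIV_chain2[of f] differentiable_on_UNIV_DERIV) (auto intro!: derivative_eq_intros)
  then show ?case by (auto simp: differentiable_on_def real_differentiable_def)
next
  case (Suc n)
  have "((\<lambda>x. f (c * x + d)) has_real_derivative deriv f (c * x + d) * c) (at x)" for x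
    using Suc by (intro DERIV_chain2[of f] differentiable_on_UNIV_DERIV) (auto intro!: derivative_eq_intros)
  then show ?case using Suc
    by (intro smooth_upto_SucI[where f'="\<lambda>x. deriv f (c * x + d) * c"] smooth_upto_mult smooth_upto_const) auto
qed

text \<open>A compact subset of the open interval \<open>J\<close> lies in a closed interval inside \<open>J\<close>. Support
intervals are easier to combine than closures of supports.\<close>

lemma test_function_iff:
  "test_function \<phi> \<longleftrightarrow>
     (\<forall>n. smooth_upto n \<phi>) \<and> (\<exists>a b. 0 < a \<and> a < b \<and> b < 3/4 \<and> (\<forall>x. x \<notin> {a..b} \<longrightarrow> \<phi> x = 0))"
proof
  assume t: "test_function \<phi>"
  let ?S = "closure {x. \<phi> x \<noteq> 0}"
  have "\<exists>a b. 0 < a \<and> a < b \<and> b < 3/4 \<and> ?S \<subseteq> {a..b}"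
  proof (cases "?S = {}")
    case True then show ?thesis by (intro exI[of _ "1/4"] exI[of _ "1/2"]) auto
  next
    case False
    have c: "compact ?S" and sub: "?S \<subseteq> J" using t by (auto simp: test_function_def)
    obtain l where l: "l \<in> ?S" "\<And>x. x \<in> ?S \<Longrightarrow> l \<le> x" using compact_attains_inf[OF c False] by auto
    obtain u where u: "u \<in> ?S" "\<And>x. x \<in> ?S \<Longrightarrow> x \<le> u" using compact_attains_sup[OF c False] by auto
    have "0 < l" "u < 3/4" "l \<le> u" using l u sub by (auto simp: J_def)
    then show ?thesis using l u by (intro exI[of _ "l"] exI[of _ "(u + 3/4)/2"]) force
  qed
  moreover have "{x. \<phi> x \<noteq> 0} \<subseteq> ?S" by (rule closure_subset)
  ultimately show "(\<forall>n. smooth_upto n \<phi>) \<and> (\<exists>a b. 0 < a \<and> a < b \<and> b < 3/4 \<and> (\<forall>x. x \<notin> {a..b} \<longrightarrow> \<phi> x = 0))"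
    using t unfolding test_function_def smooth_upto_iff by blast
next
  assume a: "(\<forall>n. smooth_upto n \<phi>) \<and> (\<exists>a b. 0 < a \<and> a < b \<and> b < 3/4 \<and> (\<forall>x. x \<notin> {a..b} \<longrightarrow> \<phi> x = 0))"
  then obtain a b where ab: "0 < a" "b < 3/4" "\<And>x. x \<notin> {a..b} \<Longrightarrow> \<phi> x = 0" by blast
  have "closure {x. \<phi> x \<noteq> 0} \<subseteq> {a..b}" using ab(3) by (intro closure_minimal subsetI CollectI closed_atLeastAtMost) blast
  moreover from this have "compact (closure {x. \<phi> x \<noteq> 0})"
    using compact_Icc[of a b] by (metis closed_closure closed_subset compact_Int_closed inf.absorb_iff2)
  ultimately show "test_function \<phi>" using a ab unfolding test_function_def smooth_upto_iff J_def by auto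
qed

lemma test_functionE:
  assumes "test_function \<phi>"
  obtains a b where "0 < a" "a < b" "b < 3/4" "\<And>x. x \<notin> {a..b} \<Longrightarrow> \<phi> x = 0"
  using assms unfolding test_function_iff by blast

lemma test_function_smooth: "test_function \<phi> \<Longrightarrow> smooth_upto n \<phi>"
  by (simp add: test_function_iff)

lemma test_functionI:
  assumes "\<And>n. smooth_upto n \<phi>" "0 < a" "a < b" "b < 3/4" "\<And>x. x \<notin> {a..b} \<Longrightarrow> \<phi> x = 0"
  shows "test_function \<phi>"
  using assms unfolding test_function_iff by blast

lemma test_function_DERIV: "test_function \<phi> \<Longrightarrow> (\<phi> has_real_derivative deriv \<phi> x) (at x)"
  by (rule differentiable_on_UNIV_DERIV[OF smooth_upto_imp_differentiable[OF test_function_smooth[where n=0]]])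

lemma test_function_continuous: "test_function \<phi> \<Longrightarrow> continuous_on UNIV \<phi>"
  using test_function_DERIV by (intro DERIV_continuous_on) (auto intro: DERIV_subset)

text \<open>Test functions vanish on an open set around each point outside their support interval. Identities
for derivatives at such points follow from this, in particular for products with \<open>x powr r\<close> at
\<open>x \<le> 0\<close>, where the usual rule for the derivative of a power fails.\<close>

lemma deriv_eq_0_of_eventually_0:
  assumes "open S" "x \<in> S" "\<And>y. y \<in> S \<Longrightarrow> \<phi> y = 0"
  shows "(\<phi> has_real_derivative 0) (at x)"
  by (rule has_field_derivative_transform_within_open[of "\<lambda>_. 0" _ _ S]) (use assms in auto)

lemma test_function_deriv: 
  assumes "test_function \<phi>" shows "test_function (deriv \<phi>)"
proof -
  obtain a b where ab: "0 < a" "a < b" "b < 3/4" "\<And>x. x \<notin> {a..b} \<Longrightarrow> \<phi> x = 0"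
    using test_functionE[OF assms] by metis
  have "deriv \<phi> x = 0" if "x \<notin> {a..b}" for x
    by (rule DERIV_imp_deriv, rule deriv_eq_0_of_eventually_0[of "- {a..b}"]) (use ab that in auto)
  moreover have "smooth_upto n (deriv \<phi>)" for n
    using test_function_smooth[OF assms, of "Suc n"] by simp
  ultimately show ?thesis using ab by (intro test_functionI[of _ a b]) auto
qed

lemma test_function_higher_deriv: "test_function \<phi> \<Longrightarrow> test_function ((deriv ^^ j) \<phi>)"
  by (induction j) (auto intro: test_function_deriv)

lemma test_function_add:
  assumes "test_function \<phi>" "test_function \<psi>"
  shows "test_function (\<lambda>x. \<phi> x + \<psi> x)"
proof -
  obtain a b where ab: "0 < a" "a < b" "b < 3/4" "\<And>x. x \<notin> {a..b} \<Longrightarrow> \<phi> x = 0"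
    using test_functionE[OF assms(1)] by metis
  obtain c d where cd: "0 < c" "c < d" "d < 3/4" "\<And>x. x \<notin> {c..d} \<Longrightarrow> \<psi> x = 0"
    using test_functionE[OF assms(2)] by metis
  show ?thesis
  proof (rule test_functionI[of _ "min a c" "max b d"])
    show "smooth_upto n (\<lambda>x. \<phi> x + \<psi> x)" for n
      by (intro smooth_upto_add test_function_smooth assms)
    show "\<phi> x + \<psi> x = 0" if "x \<notin> {min a c..max b d}" for x
    proof -
      have "x \<notin> {a..b}" "x \<notin> {c..d}" using that by auto
      then show ?thesis using ab(4) cd(4) by simp
    qed
  qed (use ab cd in auto)
qed

lemma test_function_cmult: 
  assumes "test_function \<phi>" shows "test_function (\<lambda>x. c * \<phi> x)"
proof -
  obtain a b where ab: "0 < a" "a < b" "b < 3/4" "\<And>x. x \<notin> {a..b} \<Longrightarrow> \<phi> x = 0"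
    using test_functionE[OF assms] by metis
  show ?thesis
  proof (rule test_functionI[of _ a b])
    show "smooth_upto n (\<lambda>x. c * \<phi> x)" for n
      by (intro smooth_upto_mult smooth_upto_const test_function_smooth assms)
  qed (use ab in auto)
qed

lemma test_function_powr_mult_DERIV:
  assumes "test_function \<phi>"
  shows "((\<lambda>x. x powr r * \<phi> x) has_real_derivative (r * x powr (r - 1) * \<phi> x + x powr r * deriv \<phi> x)) (at x)"
proof -
  obtain a b where ab: "0 < a" "a < b" "b < 3/4" "\<And>x. x \<notin> {a..b} \<Longrightarrow> \<phi> x = 0"
    using test_functionE[OF assms] by metis
  show ?thesis
  proof (cases "x > 0")
    case True
    then show ?thesis using test_function_DERIV[OF assms]
      by (auto intro!: derivative_eq_intros)
  next
    case False
    have "deriv \<phi> x = 0" 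
      by (rule DERIV_imp_deriv, rule deriv_eq_0_of_eventually_0[of "- {a..b}"]) (use ab False in auto)
    moreover have "\<phi> x = 0" using ab False by auto
    moreover have "((\<lambda>x. x powr r * \<phi> x) has_real_derivative 0) (at x)"
      by (rule deriv_eq_0_of_eventually_0[of "- {a..b}"]) (use ab False in auto)
    ultimately show ?thesis by simp
  qed
qed

text \<open>This makes weak differentiation compatible with multiplication by real powers of \<open>x\<close>: the factor can
be moved to the test function. The induction runs over all exponents at once, since a derivative
lowers the exponent.\<close>

lemma test_function_powr_mult:
  assumes "test_function \<phi>"
  shows "test_function (\<lambda>x. x powr r * \<phi> x)"
proof -
  obtain a b where ab: "0 < a" "a < b" "b < 3/4" "\<And>x. x \<notin> {a..b} \<Longrightarrow> \<phi> x = 0"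
    using test_functionE[OF assms] by metis
  have "smooth_upto n (\<lambda>x. x powr r * \<phi> x)" for n
    using assms
  proof (induction n arbitrary: r \<phi>)
    case 0
    then show ?case using test_function_powr_mult_DERIV
      by (auto simp: differentiable_on_def real_differentiable_def)
  next
    case (Suc n)
    then show ?case
      using smooth_upto_mult[OF smooth_upto_const[of n r] Suc.IH[OF Suc.prems, of "r - 1"]]
      by (intro smooth_upto_SucI[OF test_function_powr_mult_DERIV] smooth_upto_add Suc test_function_deriv)
         (auto simp: mult.assoc)
  qed
  then show ?thesis using ab by (intro test_functionI[of _ a b]) auto
qed

text \<open>The functions \<open>exp (-1/x) / x\<^sup>n\<close>, extended by \<open>0\<close> to \<open>x \<le> 0\<close>. The derivative of
each is a combination of two others, so they are all smooth together.\<close>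

definition flat :: "nat \<Rightarrow> real \<Rightarrow> real" where
  "flat n x = (if x > 0 then exp (- inverse x) * inverse x ^ n else 0)"

lemma flat_DERIV: "(flat n has_real_derivative (- real n * flat (n+1) x + flat (n+2) x)) (at x)"
proof (cases "x = 0")
  case False
  show ?thesis
  proof (cases "x > 0")
    case True
    have "((\<lambda>x. exp (- inverse x) * inverse x ^ n) has_real_derivative
        exp (- inverse x) * (inverse x)\<^sup>2 * inverse x ^ n
        + exp (- inverse x) * (real n * inverse x ^ (n - 1) * - (inverse x)\<^sup>2)) (at x)"
      using True by (auto intro!: derivative_eq_intros simp: power2_eq_square)
    moreover have "exp (- inverse x) * (inverse x)\<^sup>2 * inverse x ^ n
        + exp (- inverse x) * (real n * inverse x ^ (n - 1) * - (inverse x)\<^sup>2)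
        = - real n * flat (n+1) x + flat (n+2) x"
      using True by (cases n) (simp_all add: flat_def algebra_simps power2_eq_square)
    ultimately have "((\<lambda>x. exp (- inverse x) * inverse x ^ n) has_real_derivative
        (- real n * flat (n+1) x + flat (n+2) x)) (at x)"
      by metis
    then show ?thesis
      by (rule has_field_derivative_transform_within_open[of _ _ _ "{0<..}"]) (use True in \<open>auto simp: flat_def\<close>)
  next
    case neg: False
    then show ?thesis using False
      using deriv_eq_0_of_eventually_0[of "{..<0}" x "flat n"] by (auto simp: flat_def)
  qed
next
  case True
  have lim: "((\<lambda>h. flat n h / h) \<longlongrightarrow> 0) (at_right 0)"
  proof -
    have "((\<lambda>y::real. y ^ (n+1) / exp y) \<longlongrightarrow> 0) at_top" by (rule tendsto_power_div_exp_0)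
    then have "((\<lambda>h::real. (inverse h) ^ (n+1) / exp (inverse h)) \<longlongrightarrow> 0) (at_right 0)"
      by (rule filterlim_compose[OF _ filterlim_inverse_at_top_right])
    then show ?thesis
    proof (rule Lim_transform_eventually)
      show "\<forall>\<^sub>F h in at_right 0. inverse h ^ (n + 1) / exp (inverse h) = flat n h / h"
        unfolding eventually_at_right_field
        by (intro exI[of _ 1]) (auto simp: flat_def exp_minus field_simps)
    qed
  qed
  have lim': "((\<lambda>h. flat n h / h) \<longlongrightarrow> 0) (at_left 0)"
    by (rule tendsto_eventually) (auto simp: eventually_at_filter flat_def)
  have "((\<lambda>h. flat n h / h) \<longlongrightarrow> 0) (at 0)"
    using lim lim' by (simp add: filterlim_split_at)
  then show ?thesis using True by (simp add: DERIV_def flat_def)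
qed

lemma smooth_upto_flat: "smooth_upto n (flat m)"
proof (induction n arbitrary: m)
  case 0 then show ?case using flat_DERIV by (auto simp: differentiable_on_def real_differentiable_def)
next
  case (Suc n)
  show ?case
    by (rule smooth_upto_SucI[OF flat_DERIV]) (intro smooth_upto_add smooth_upto_mult smooth_upto_const Suc)
qed

lemma flat_bounds: "0 \<le> flat 0 x" "flat 0 x \<le> 1"
  by (auto simp: flat_def)

lemma flat_tendsto_1: "c > 0 \<Longrightarrow> (\<lambda>k. flat 0 (real k * c)) \<longlonglongrightarrow> 1"
proof -
  assume c: "c > 0"
  have "(\<lambda>k. - (1/c) * inverse (real k)) \<longlonglongrightarrow> - (1/c) * 0"
    by (intro tendsto_mult tendsto_const lim_inverse_n)
  then have "(\<lambda>k. exp (- (1/c) * inverse (real k))) \<longlonglongrightarrow> exp (- (1/c) * 0)"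
    by (intro tendsto_exp) 
  then have "(\<lambda>k. exp (- (1/c) * inverse (real k))) \<longlonglongrightarrow> 1" by simp
  then show ?thesis
    by (rule Lim_transform_eventually)
       (use c in \<open>auto intro!: eventually_mono[OF eventually_gt_at_top[of 0]] simp: flat_def field_simps\<close>)
qed

text \<open>Since \<open>flat 0\<close> takes values in \<open>[0, 1]\<close> and tends to \<open>1\<close> at infinity, these test functions
converge to the indicator function of the interval from \<open>a\<close> to \<open>b\<close> and are dominated by it.\<close>

definition bump :: "real \<Rightarrow> real \<Rightarrow> nat \<Rightarrow> real \<Rightarrow> real" where
  "bump a b k x = flat 0 (real k * (x - a)) * flat 0 (real k * (b - x))"

lemma test_function_bump:
  assumes "0 < a" "a < b" "b < 3/4"
  shows "test_function (bump a b k)"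
proof (rule test_functionI[of _ a b])
  show "smooth_upto n (bump a b k)" for n
  proof -
    have "smooth_upto n (\<lambda>x. flat 0 (real k * x + (- real k * a)) * flat 0 ((- real k) * x + (real k * b)))"
      by (intro smooth_upto_mult smooth_upto_affine smooth_upto_flat)
    then show ?thesis by (simp add: bump_def[abs_def] algebra_simps)
  qed
qed (use assms in \<open>auto simp: bump_def flat_def mult_le_0_iff zero_less_mult_iff\<close>)

lemma bump_bounds: "0 \<le> bump a b k x" "bump a b k x \<le> 1"
  using flat_bounds by (auto simp: bump_def intro!: mult_le_one)

lemma bump_eq_0: "x \<notin> {a<..<b} \<Longrightarrow> bump a b k x = 0"
  by (auto simp: bump_def flat_def zero_less_mult_iff)

lemma bump_tendsto: "(\<lambda>k. bump a b k x) \<longlonglongrightarrow> indicator {a<..<b} x"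
proof (cases "x \<in> {a<..<b}")
  case True
  then have "(\<lambda>k. bump a b k x) \<longlonglongrightarrow> 1 * 1" unfolding bump_def
    by (intro tendsto_mult flat_tendsto_1) auto
  then show ?thesis using True by simp
next
  case False
  then show ?thesis by (simp add: bump_eq_0)
qed

text \<open>The vanishing integral is what makes the primitive vanish to the right of the support.\<close>

lemma test_function_antiderivative:
  assumes t: "test_function \<phi>" and zero: "(LINT x|lborel. \<phi> x) = 0"
  obtains \<Phi> where "test_function \<Phi>" "deriv \<Phi> = \<phi>"
proof -
  obtain a b where ab: "0 < a" "a < b" "b < 3/4" "\<And>x. x \<notin> {a..b} \<Longrightarrow> \<phi> x = 0"
    using test_functionE[OF t] by metis
  define \<Phi> where "\<Phi> x = integral {0..x} \<phi>" for x
  have cont: "continuous_on A \<phi>" for A using test_function_continuous[OF t] continuous_on_subset by blast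
  have D1: "(\<Phi> has_real_derivative \<phi> x) (at x)" if "x > 0" for x
  proof -
    have "(\<Phi> has_real_derivative \<phi> x) (at x within {0..x+1})"
      unfolding \<Phi>_def by (rule integral_has_real_derivative[OF cont]) (use that in auto)
    moreover have "at x within {0..x+1} = at x" using that by (intro at_within_interior) auto
    ultimately show ?thesis by simp
  qed
  have z1: "\<Phi> x = 0" if "x < a" for x
    unfolding \<Phi>_def by (rule integral_unique, rule has_integral_is_0) (use that ab in auto)
  have z2: "\<Phi> x = 0" if "x > b" for x
  proof -
    have int: "set_integrable lborel {0..x} \<phi>" for x
      unfolding set_integrable_def by (rule borel_integrable_compact[OF compact_Icc cont])
    have "\<Phi> x = (LINT x:{0..x}|lborel. \<phi> x)"
      unfolding \<Phi>_def by (rule set_borel_integral_eq_integral(2)[OF int, symmetric])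
    also have "\<dots> = (LINT x|lborel. \<phi> x)"
      unfolding set_lebesgue_integral_def
    proof (rule Bochner_Integration.integral_cong[OF refl])
      fix y show "indicator {0..x} y *\<^sub>R \<phi> y = \<phi> y"
        using ab(1) ab(4)[of y] that by (cases "y \<in> {a..b}") auto
    qed
    finally show ?thesis using zero by simp
  qed
  have D: "(\<Phi> has_real_derivative \<phi> x) (at x)" for x
  proof (cases "x > 0")
    case False
    have "\<phi> x = 0" using ab False by auto
    moreover have "(\<Phi> has_real_derivative 0) (at x)"
      by (rule deriv_eq_0_of_eventually_0[of "{..<a}"]) (use ab False z1 in auto)
    ultimately show ?thesis by simp
  qed (rule D1)
  have "smooth_upto n \<Phi>" for n
    by (rule smooth_upto_Suc_D, rule smooth_upto_SucI[OF D test_function_smooth[OF t]])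
  then have "test_function \<Phi>"
    by (rule test_functionI[of _ a b]) (use ab z1 z2 in \<open>auto simp: not_le\<close>)
  moreover have "deriv \<Phi> = \<phi>" using D by (auto intro: DERIV_imp_deriv)
  ultimately show ?thesis using that by blast
qed

section \<open>Locally integrable functions and the fundamental lemma\<close>

text \<open>Weak derivatives are Lebesgue measurable at best, and choosing them by description gives no control on
null sets. The estimates therefore use Borel representatives, for which Fubini's theorem applies to
products of Borel measures.\<close>

definition locint :: "(real \<Rightarrow> real) \<Rightarrow> bool" where
  "locint g \<longleftrightarrow> g \<in> borel_measurable borel \<and> (\<forall>a b. 0 < a \<longrightarrow> b < 3/4 \<longrightarrow> set_integrable lborel {a..b} g)"

abbreviation eqJ :: "(real \<Rightarrow> real) \<Rightarrow> (real \<Rightarrow> real) \<Rightarrow> bool" where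
  "eqJ f g \<equiv> (AE x in lborel. x \<in> J \<longrightarrow> f x = g x)"

lemma locint_measurable: "locint g \<Longrightarrow> g \<in> borel_measurable borel"
  by (simp add: locint_def)

lemma compact_subset_J:
  assumes "compact K" "K \<subseteq> J" obtains a b where "0 < a" "a < b" "b < 3/4" "K \<subseteq> {a..b}"
proof (cases "K = {}")
  case True then show ?thesis using that[of "1/4" "1/2"] by auto
next
  case False
  obtain l where l: "l \<in> K" "\<And>x. x \<in> K \<Longrightarrow> l \<le> x" using compact_attains_inf[OF assms(1) False] by auto
  obtain u where u: "u \<in> K" "\<And>x. x \<in> K \<Longrightarrow> x \<le> u" using compact_attains_sup[OF assms(1) False] by auto
  have "0 < l" "u < 3/4" "l \<le> u" using l u assms(2) by (auto simp: J_def)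
  moreover have "K \<subseteq> {l..(u + 3/4)/2}"
  proof
    fix x assume "x \<in> K"
    with l(2)[OF this] u(2)[OF this] \<open>u < 3/4\<close> show "x \<in> {l..(u + 3/4)/2}" by simp
  qed
  ultimately show ?thesis by (intro that[of l "(u + 3/4)/2"]) auto
qed

text \<open>An exhaustion by intervals whose closures lie in \<open>J\<close>, on which locally integrable functions are
integrable.\<close>

lemma J_eq_Union: "J = (\<Union>n::nat. {1 / (real n + 4) <..< 3/4 - 1 / (real n + 4)})"
proof (intro equalityI subsetI)
  fix x assume x: "x \<in> J"
  then have "0 < min x (3/4 - x)" by (simp add: J_def)
  then obtain n :: nat where n: "1 / real (Suc n) < min x (3/4 - x)"
    by (rule nat_approx_posE)
  have "1 / (real n + 4) < 1 / real (Suc n)" by (simp add: frac_less2)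
  then have "x \<in> {1 / (real n + 4) <..< 3/4 - 1 / (real n + 4)}" using n by auto
  then show "x \<in> (\<Union>n::nat. {1 / (real n + 4) <..< 3/4 - 1 / (real n + 4)})" by blast
next
  fix x assume "x \<in> (\<Union>n::nat. {1 / (real n + 4) <..< 3/4 - 1 / (real n + 4)})"
  then obtain n :: nat where "1 / (real n + 4) < x" "x < 3/4 - 1 / (real n + 4)" by auto
  moreover have "0 < 1 / (real n + 4)" by simp
  ultimately show "x \<in> J" unfolding J_def by (simp only: greaterThanLessThan_iff) linarith
qed

lemma J_borel[measurable]: "J \<in> sets borel"
  by (simp add: J_def)

lemma AE_J_negligible:
  assumes "AE x in lborel. x \<in> J \<longrightarrow> P x"
  shows "negligible {x \<in> J. \<not> P x}"
proof -
  have "AE x in lebesgue. x \<in> J \<longrightarrow> P x" using assms by (rule AE_completion)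
  then have "{x \<in> space lebesgue. \<not> (x \<in> J \<longrightarrow> P x)} \<in> null_sets lebesgue"
    by (subst (asm) completion.AE_iff_null_sets)
  then show ?thesis by (simp add: negligible_iff_null_sets)
qed

lemma locint_imp_locally_integrable:
  assumes g: "locint g" and eq: "eqJ f g"
  shows "locally_integrable_J f"
  unfolding locally_integrable_J_def
proof (intro allI impI)
  fix K assume K: "compact K \<and> K \<subseteq> J"
  then obtain a b where ab: "0 < a" "a < b" "b < 3/4" "K \<subseteq> {a..b}" using compact_subset_J by metis
  have [measurable]: "g \<in> borel_measurable borel" "K \<in> sets borel" using g K by (auto simp: locint_def intro: borel_compact)
  have "set_integrable lborel {a..b} g" using g ab by (auto simp: locint_def)
  then have "set_integrable lborel K g" by (rule set_integrable_subset) (use ab in auto)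
  then have "g absolutely_integrable_on K"
    unfolding set_integrable_def by (subst integrable_completion) auto
  then show "f absolutely_integrable_on K"
  proof (rule absolutely_integrable_spike[OF _ AE_J_negligible[OF eq]])
    show "f x = g x" if "x \<in> K - {x \<in> J. f x \<noteq> g x}" for x using that K by auto
  qed
qed

lemma borel_representative:
  assumes f: "locally_integrable_J f"
  obtains g where "locint g" "eqJ f g"
proof -
  let ?I = "\<lambda>n::nat. {1 / (real n + 4) .. 3/4 - 1 / (real n + 4)}"
  have sub: "?I n \<subseteq> J" for n
  proof
    fix x assume "x \<in> ?I n"
    moreover have "0 < 1 / (real n + 4)" by simp
    ultimately show "x \<in> J" unfolding J_def by (simp only: greaterThanLessThan_iff atLeastAtMost_iff) linarith
  qed
  have m: "(\<lambda>x. indicator (?I n) x *\<^sub>R f x) \<in> borel_measurable lebesgue" for n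
    using f sub[of n] unfolding locally_integrable_J_def set_integrable_def by blast
  have "(\<lambda>x. indicator J x *\<^sub>R f x) \<in> borel_measurable lebesgue"
  proof (rule borel_measurable_LIMSEQ_real[OF _ m])
    fix x :: real
    show "(\<lambda>n. indicator (?I n) x *\<^sub>R f x) \<longlonglongrightarrow> indicator J x *\<^sub>R f x"
    proof (cases "x \<in> J")
      case False
      then have "x \<notin> ?I n" for n using sub by blast
      then show ?thesis using False by simp
    next
      case True
      then obtain N :: nat where N: "x \<in> {1 / (real N + 4) <..< 3/4 - 1 / (real N + 4)}" using J_eq_Union by blast
      have "x \<in> ?I n" if "n \<ge> N" for n
      proof -
        have "1 / (real n + 4) \<le> 1 / (real N + 4)" using that by (auto simp: field_simps)
        then show ?thesis using N by auto
      qed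
      then have "\<forall>\<^sub>F n in sequentially. indicator (?I n) x *\<^sub>R f x = indicator J x *\<^sub>R f x"
        using True by (intro eventually_sequentiallyI[of N]) (auto simp: indicator_def)
      then show ?thesis by (rule tendsto_eventually)
    qed
  qed
  from completion_ex_borel_measurable_real[OF this]
  obtain g where g: "g \<in> borel_measurable lborel" "AE x in lborel. indicator J x *\<^sub>R f x = g x" by blast
  have eq: "eqJ f g" using g(2) by eventually_elim auto
  have "set_integrable lborel {a..b} g" if "0 < a" "b < 3/4" for a b
  proof -
    have [measurable]: "g \<in> borel_measurable borel" using g by simp
    have "{a..b} \<subseteq> J" using that by (auto simp: J_def)
    then have "f absolutely_integrable_on {a..b}" using f unfolding locally_integrable_J_def by blast
    then have "g absolutely_integrable_on {a..b}"
    proof (rule absolutely_integrable_spike[OF _ AE_J_negligible[OF eq]])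
      show "g x = f x" if "x \<in> {a..b} - {x \<in> J. f x \<noteq> g x}" for x using that \<open>{a..b} \<subseteq> J\<close> by auto
    qed
    then show ?thesis unfolding set_integrable_def by (subst (asm) integrable_completion) auto
  qed
  then show ?thesis using that[of g] g eq by (auto simp: locint_def)
qed

lemma locint_mult_integrable:
  assumes "locint g" and [measurable]: "\<phi> \<in> borel_measurable borel"
    and M: "\<And>x. \<bar>\<phi> x\<bar> \<le> M" and ab: "0 < a" "b < 3/4" and z: "\<And>x. x \<notin> {a..b} \<Longrightarrow> \<phi> x = 0"
  shows "integrable lborel (\<lambda>x. g x * \<phi> x)"
proof (rule Bochner_Integration.integrable_bound)
  have [measurable]: "g \<in> borel_measurable borel" using assms by (simp add: locint_def)
  show "integrable lborel (\<lambda>x. (indicator {a..b} x *\<^sub>R g x) * M)"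
    using assms by (intro integrable_mult_left) (auto simp: locint_def set_integrable_def)
  show "(\<lambda>x. g x * \<phi> x) \<in> borel_measurable lborel" by measurable
  have "\<bar>g x * \<phi> x\<bar> \<le> \<bar>(indicator {a..b} x *\<^sub>R g x) * M\<bar>" for x
  proof (cases "x \<in> {a..b}")
    case True
    have "\<bar>\<phi> x\<bar> \<le> \<bar>M\<bar>" using M[of x] by linarith
    then show ?thesis using True by (auto simp: abs_mult intro: mult_left_mono)
  qed (use z in auto)
  then show "AE x in lborel. norm (g x * \<phi> x) \<le> norm ((indicator {a..b} x *\<^sub>R g x) * M)" by simp
qed

lemma test_function_bounded:
  assumes "test_function \<phi>" obtains M where "\<And>x. \<bar>\<phi> x\<bar> \<le> M"
proof -
  obtain a b where ab: "\<And>x. x \<notin> {a..b} \<Longrightarrow> \<phi> x = 0"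
    using test_functionE[OF assms] by metis
  have "compact (\<phi> ` {a..b})"
    by (intro compact_continuous_image continuous_on_subset[OF test_function_continuous[OF assms]]) auto
  then obtain B where B: "\<And>y. y \<in> \<phi> ` {a..b} \<Longrightarrow> \<bar>y\<bar> \<le> B" using compact_imp_bounded bounded_iff by (metis real_norm_def)
  have "\<bar>\<phi> x\<bar> \<le> \<bar>B\<bar>" for x 
  proof (cases "x \<in> {a..b}")
    case True then show ?thesis using B[of "\<phi> x"] by (meson abs_ge_self imageI order_trans)
  qed (use ab in auto)
  then show ?thesis using that by blast
qed

lemma test_function_measurable: "test_function \<phi> \<Longrightarrow> \<phi> \<in> borel_measurable borel"
  by (intro borel_measurable_continuous_onI test_function_continuous)

lemma locint_mult_test_integrable:
  assumes "locint g" "test_function \<phi>"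
  shows "integrable lborel (\<lambda>x. g x * \<phi> x)"
proof -
  obtain a b where "0 < a" "a < b" "b < 3/4" "\<And>x. x \<notin> {a..b} \<Longrightarrow> \<phi> x = 0"
    using test_functionE[OF assms(2)] by metis
  moreover obtain M where "\<And>x. \<bar>\<phi> x\<bar> \<le> M" using test_function_bounded[OF assms(2)] by metis
  ultimately show ?thesis
    using locint_mult_integrable[OF assms(1) test_function_measurable[OF assms(2)]] by blast
qed

lemma test_pairing_eq:
  assumes g: "locint g" and eq: "eqJ f g" and \<phi>: "test_function \<phi>"
  shows "(LINT x:J|lebesgue. f x * \<phi> x) = (LINT x|lborel. g x * \<phi> x)"
proof -
  have [measurable]: "g \<in> borel_measurable borel" "\<phi> \<in> borel_measurable borel" 
    using g \<phi> by (auto simp: locint_def intro: test_function_measurable)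
  have off: "\<phi> x = 0" if "x \<notin> J" for x
  proof -
    obtain a b where ab: "0 < a" "a < b" "b < 3/4" "\<And>x. x \<notin> {a..b} \<Longrightarrow> \<phi> x = 0"
      using test_functionE[OF \<phi>] by metis
    have "x \<notin> {a..b}" using that ab(1,3) by (auto simp: J_def)
    then show ?thesis by (rule ab(4))
  qed
  have ae: "AE x in lebesgue. indicator J x *\<^sub>R (f x * \<phi> x) = g x * \<phi> x"
    using AE_completion[OF eq] by eventually_elim (use off in \<open>auto simp: indicator_def\<close>)
  have m: "(\<lambda>x. g x * \<phi> x) \<in> borel_measurable lebesgue" by (rule measurable_completion) measurable
  have "(LINT x:J|lebesgue. f x * \<phi> x) = (LINT x|lebesgue. g x * \<phi> x)"
    unfolding set_lebesgue_integral_def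
  proof (rule integral_cong_AE[OF _ m ae])
    show "(\<lambda>x. indicator J x *\<^sub>R (f x * \<phi> x)) \<in> borel_measurable lebesgue"
    proof (rule borel_measurable_AE[OF m])
      show "AE x in lebesgue. g x * \<phi> x = indicator J x *\<^sub>R (f x * \<phi> x)"
        using ae by eventually_elim (rule sym)
    qed
  qed
  also have "\<dots> = (LINT x|lborel. g x * \<phi> x)" by (rule integral_completion) measurable
  finally show ?thesis .
qed

text \<open>Weak derivatives can be tested with Borel representatives and Lebesgue-Borel integrals over the whole
line, because test functions vanish outside \<open>J\<close>.\<close>

lemma has_weak_deriv_iff:
  assumes "locint f0" "eqJ f f0" "locint g0" "eqJ g g0"
  shows "has_weak_deriv j f g \<longleftrightarrow> (\<forall>\<phi>. test_function \<phi> \<longrightarrow>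
     (LINT x|lborel. f0 x * (deriv ^^ j) \<phi> x) = (-1) ^ j * (LINT x|lborel. g0 x * \<phi> x))"
  unfolding has_weak_deriv_def
  using locint_imp_locally_integrable[OF assms(1,2)] locint_imp_locally_integrable[OF assms(3,4)]
    test_pairing_eq[OF assms(1,2) test_function_higher_deriv] test_pairing_eq[OF assms(3,4)]
  by (simp cong: imp_cong)

text \<open>Dominated convergence along the bump functions replaces test functions by indicator functions of
intervals.\<close>

lemma set_integral_eq_0_of_test:
  assumes g: "locint g" and ab: "0 < a" "b < 3/4"
    and z: "\<And>\<phi>. test_function \<phi> \<Longrightarrow> (LINT x|lborel. g x * \<phi> x) = 0"
  shows "(LINT x:{a<..<b}|lborel. g x) = 0"
proof (cases "a < b")
  case True
  have [measurable]: "g \<in> borel_measurable borel" using g by (simp add: locint_def)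
  have [measurable]: "bump a b k \<in> borel_measurable borel" for k
    by (intro test_function_measurable test_function_bump ab True)
  have "(\<lambda>k. LINT x|lborel. g x * bump a b k x) \<longlonglongrightarrow> (LINT x|lborel. g x * indicator {a<..<b} x)"
  proof (rule integral_dominated_convergence[where w="\<lambda>x. \<bar>indicator {a..b} x *\<^sub>R g x\<bar>"])
    show "integrable lborel (\<lambda>x. \<bar>indicator {a..b} x *\<^sub>R g x\<bar>)"
      using g ab by (intro integrable_abs) (auto simp: locint_def set_integrable_def)
    show "AE x in lborel. (\<lambda>k. g x * bump a b k x) \<longlonglongrightarrow> g x * indicator {a<..<b} x"
      by (intro always_eventually allI tendsto_mult tendsto_const bump_tendsto)
    have "\<bar>g x * bump a b k x\<bar> \<le> \<bar>indicator {a..b} x *\<^sub>R g x\<bar>" for x k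
    proof (cases "x \<in> {a<..<b}")
      case True
      then show ?thesis using bump_bounds[of a b k x] by (simp add: abs_mult mult_left_le)
    qed (simp add: bump_eq_0)
    then show "AE x in lborel. norm (g x * bump a b k x) \<le> \<bar>indicator {a..b} x *\<^sub>R g x\<bar>" for k by simp
  qed measurable
  moreover have "(LINT x|lborel. g x * bump a b k x) = 0" for k
    by (intro z test_function_bump ab True)
  ultimately have "(LINT x|lborel. g x * indicator {a<..<b} x) = 0"
    by (simp add: LIMSEQ_const_iff)
  then show ?thesis by (simp add: set_lebesgue_integral_def mult.commute)
next
  case False then show ?thesis by (simp add: set_lebesgue_integral_def)
qed

text \<open>The positive and the negative part of \<open>h\<close> are densities of two finite measures that agree on all half
lines, hence everywhere.\<close>

lemma AE_0_of_halfline_integrals_0: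
  fixes h :: "real \<Rightarrow> real"
  assumes h: "integrable lborel h" and z: "\<And>x. (LINT y:{x<..}|lborel. h y) = 0"
  shows "AE x in lborel. h x = 0"
proof -
  have [measurable]: "h \<in> borel_measurable borel" using borel_measurable_integrable[OF h] by simp
  have em: "emeasure (density lborel (\<lambda>x. ennreal (c * h x))) {x<..} =
       ennreal (LINT y:{x<..}|lborel. max 0 (c * h y))" for x c
  proof -
    have "integrable lborel (\<lambda>y. max 0 (c * h y))" using h by (intro integrable_max) auto
    then have int: "integrable lborel (\<lambda>y. indicator {x<..} y *\<^sub>R max 0 (c * h y))"
      by (intro integrable_mult_indicator) auto
    have "emeasure (density lborel (\<lambda>x. ennreal (c * h x))) {x<..} = (\<integral>\<^sup>+y. ennreal (c * h y) * indicator {x<..} y \<partial>lborel)"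
      by (rule emeasure_density) auto
    also have "\<dots> = (\<integral>\<^sup>+y. ennreal (indicator {x<..} y *\<^sub>R max 0 (c * h y)) \<partial>lborel)"
      by (intro nn_integral_cong) (auto simp: indicator_def max_def ennreal_neg)
    also have "\<dots> = ennreal (LINT y:{x<..}|lborel. max 0 (c * h y))"
      unfolding set_lebesgue_integral_def by (intro nn_integral_eq_integral[OF int]) auto
    finally show ?thesis .
  qed
  have eq: "(LINT y:{x<..}|lborel. max 0 (1 * h y)) = (LINT y:{x<..}|lborel. max 0 (-1 * h y))" for x
  proof -
    have i: "integrable lborel (\<lambda>y. indicator {x<..} y *\<^sub>R max 0 (c * h y))" for c
      using h by (intro integrable_mult_indicator integrable_max) auto
    have "(LINT y:{x<..}|lborel. max 0 (1 * h y)) - (LINT y:{x<..}|lborel. max 0 (-1 * h y)) = (LINT y:{x<..}|lborel. h y)"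
      unfolding set_lebesgue_integral_def
      by (subst Bochner_Integration.integral_diff[symmetric, OF i i])
         (auto intro!: Bochner_Integration.integral_cong simp: indicator_def max_def)
    then show ?thesis using z[of x] by simp
  qed
  have "density lborel (\<lambda>x. ennreal (1 * h x)) = density lborel (\<lambda>x. ennreal (-1 * h x))"
  proof (rule measure_eqI_lessThan)
    fix x show "emeasure (density lborel (\<lambda>x. ennreal (1 * h x))) {x<..} < \<infinity>" by (subst em) simp
    show "emeasure (density lborel (\<lambda>x. ennreal (1 * h x))) {x<..} = emeasure (density lborel (\<lambda>x. ennreal (-1 * h x))) {x<..}"
      by (simp only: em eq)
  qed auto
  then have "AE x in lborel. ennreal (1 * h x) = ennreal (-1 * h x)"
    by (subst (asm) sigma_finite_measure.density_unique_iff[OF sigma_finite_lborel]) auto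
  then show ?thesis
  proof eventually_elim
    case (elim x)
    then show ?case by (cases "h x \<ge> 0") (auto simp: ennreal_neg ennreal_eq_0_iff)
  qed
qed

lemma fundamental_lemma_of_variations:
  assumes g: "locint g" and z: "\<And>\<phi>. test_function \<phi> \<Longrightarrow> (LINT x|lborel. g x * \<phi> x) = 0"
  shows "eqJ g (\<lambda>_. 0)"
proof -
  have [measurable]: "g \<in> borel_measurable borel" using g by (simp add: locint_def)
  have 1: "AE x in lborel. x \<in> {a<..<b} \<longrightarrow> g x = 0" if ab: "0 < a" "b < 3/4" for a b
  proof -
    have "set_integrable lborel {a..b} g" using g ab by (simp add: locint_def)
    then have "set_integrable lborel {a<..<b} g" by (rule set_integrable_subset) auto
    then have i: "integrable lborel (\<lambda>x. indicator {a<..<b} x *\<^sub>R g x)" by (simp add: set_integrable_def)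
    have "AE x in lborel. indicator {a<..<b} x *\<^sub>R g x = 0"
    proof (rule AE_0_of_halfline_integrals_0[OF i])
      fix x
      have "(LINT y:{x<..}|lborel. indicator {a<..<b} y *\<^sub>R g y) = (LINT y:{max x a<..<b}|lborel. g y)"
        unfolding set_lebesgue_integral_def
        by (intro Bochner_Integration.integral_cong) (auto simp: indicator_def)
      also have "\<dots> = 0" by (rule set_integral_eq_0_of_test[OF g _ _ z]) (use ab in auto)
      finally show "(LINT y:{x<..}|lborel. indicator {a<..<b} y *\<^sub>R g y) = 0" .
    qed
    then show ?thesis by eventually_elim auto
  qed
  have "AE x in lborel. \<forall>n::nat. x \<in> {1 / (real n + 4) <..< 3/4 - 1 / (real n + 4)} \<longrightarrow> g x = 0"
    unfolding AE_all_countable by (intro allI 1) auto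
  then show ?thesis by eventually_elim (use J_eq_Union in blast)
qed

lemma locint_diff: "locint f \<Longrightarrow> locint g \<Longrightarrow> locint (\<lambda>x. f x - g x)"
  by (auto simp: locint_def intro: set_integral_diff)

lemma locint_add: "locint f \<Longrightarrow> locint g \<Longrightarrow> locint (\<lambda>x. f x + g x)"
  by (auto simp: locint_def intro: set_integral_add)

lemma locint_cmult: "locint f \<Longrightarrow> locint (\<lambda>x. c * f x)"
  by (auto simp: locint_def)

lemma locint_sum: "(\<And>i. i \<in> I \<Longrightarrow> locint (f i)) \<Longrightarrow> locint (\<lambda>x. \<Sum>i\<in>I. f i x)"
proof (induction I rule: infinite_finite_induct)
  case (insert i I)
  have "locint (\<lambda>x. f i x + (\<Sum>i\<in>I. f i x))" using insert by (intro locint_add) auto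
  then show ?case using insert by simp
qed (auto simp: locint_def set_integrable_def)

lemma locint_const: "locint (\<lambda>x. c)"
  unfolding locint_def set_integrable_def
  by (intro conjI allI impI borel_integrable_compact compact_Icc) auto

lemma locint_powr_mult: assumes "locint f" shows "locint (\<lambda>x. x powr r * f x)"
proof -
  have [measurable]: "f \<in> borel_measurable borel" using assms by (simp add: locint_def)
  have "set_integrable lborel {a..b} (\<lambda>x. x powr r * f x)" if ab: "0 < a" "b < 3/4" for a b
  proof -
    have "compact ((\<lambda>x. x powr r) ` {a..b})"
      using ab by (intro compact_continuous_image) (auto intro!: continuous_intros)
    then obtain B where B: "\<And>y. y \<in> (\<lambda>x. x powr r) ` {a..b} \<Longrightarrow> \<bar>y\<bar> \<le> B" using compact_imp_bounded bounded_iff by (metis real_norm_def)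
    have "\<bar>indicator {a..b} x * x powr r\<bar> \<le> \<bar>B\<bar>" for x
    proof (cases "x \<in> {a..b}")
      case True
      then have "\<bar>x powr r\<bar> \<le> B" by (intro B imageI)
      then show ?thesis using True by simp
    qed simp
    then have "integrable lborel (\<lambda>x. f x * (indicator {a..b} x * x powr r))"
      by (rule locint_mult_integrable[OF assms, of _ "\<bar>B\<bar>" a b, rotated]) (use ab in auto)
    then show ?thesis by (simp add: set_integrable_def mult_ac)
  qed
  then show ?thesis by (simp add: locint_def)
qed

lemma eqJ_of_pairings:
  assumes f: "locint f" and g: "locint g"
    and z: "\<And>\<phi>. test_function \<phi> \<Longrightarrow> (LINT x|lborel. f x * \<phi> x) = (LINT x|lborel. g x * \<phi> x)"
  shows "eqJ f g"
proof -
  have "eqJ (\<lambda>x. f x - g x) (\<lambda>_. 0)"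
  proof (rule fundamental_lemma_of_variations[OF locint_diff[OF f g]])
    fix \<phi> assume t: "test_function \<phi>"
    have "(LINT x|lborel. (f x - g x) * \<phi> x) = (LINT x|lborel. f x * \<phi> x - g x * \<phi> x)"
      by (simp add: algebra_simps)
    also have "\<dots> = 0" using z[OF t]
      by (subst Bochner_Integration.integral_diff) (auto intro: locint_mult_test_integrable f g t)
    finally show "(LINT x|lborel. (f x - g x) * \<phi> x) = 0" .
  qed
  then show ?thesis by eventually_elim auto
qed

lemma has_weak_deriv_unique:
  assumes "has_weak_deriv j f g" "has_weak_deriv j f h" shows "eqJ g h"
proof -
  obtain f0 where f0: "locint f0" "eqJ f f0" using assms(1) borel_representative by (auto simp: has_weak_deriv_def)
  obtain g0 where g0: "locint g0" "eqJ g g0" using assms(1) borel_representative by (auto simp: has_weak_deriv_def)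
  obtain h0 where h0: "locint h0" "eqJ h h0" using assms(2) borel_representative by (auto simp: has_weak_deriv_def)
  have "eqJ g0 h0"
    using assms by (intro eqJ_of_pairings g0 h0) (simp add: has_weak_deriv_iff[OF f0 g0] has_weak_deriv_iff[OF f0 h0])
  with g0(2) h0(2) show ?thesis by eventually_elim auto
qed

lemma unit_mass_test_function:
  obtains \<eta> where "test_function \<eta>" "(LINT x|lborel. \<eta> x) = 1"
proof -
  have t: "test_function (bump (1/4) (1/2) k)" for k by (rule test_function_bump) auto
  have "(LINT x:{1/4<..<1/2::real}|lborel. (1::real)) \<noteq> 0" by (simp add: set_lebesgue_integral_def)
  then obtain \<phi> where \<phi>: "test_function \<phi>" "(LINT x|lborel. 1 * \<phi> x) \<noteq> 0"
    using set_integral_eq_0_of_test[OF locint_const, of "1/4" "1/2" 1] by auto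
  have "(LINT x|lborel. inverse (LINT x|lborel. \<phi> x) * \<phi> x) = 1"
    using \<phi> by simp
  then show ?thesis using that test_function_cmult[OF \<phi>(1)] by blast
qed

text \<open>With a fixed test function \<open>\<eta>\<close> of integral \<open>1\<close>, every test function \<open>\<phi>\<close> differs from
a multiple of \<open>\<eta>\<close> by a derivative of a test function. Thus \<open>g\<close> acts on \<open>\<phi>\<close> as the constant
obtained by testing \<open>g\<close> with \<open>\<eta>\<close>.\<close>

lemma constant_of_weak_deriv_0:
  assumes g: "locint g" and z: "\<And>\<phi>. test_function \<phi> \<Longrightarrow> (LINT x|lborel. g x * deriv \<phi> x) = 0"
  obtains c where "eqJ g (\<lambda>_. c)"
proof -
  obtain \<eta> where \<eta>: "test_function \<eta>" "(LINT x|lborel. \<eta> x) = 1" by (rule unit_mass_test_function)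
  define c where "c = (LINT x|lborel. g x * \<eta> x)"
  have "eqJ g (\<lambda>_. c)"
  proof (rule eqJ_of_pairings[OF g locint_const])
    fix \<phi> assume \<phi>: "test_function \<phi>"
    define m where "m = (LINT x|lborel. \<phi> x)"
    have t: "test_function (\<lambda>x. \<phi> x + (- m) * \<eta> x)" by (intro test_function_add test_function_cmult \<phi> \<eta>)
    have i: "integrable lborel \<phi>" "integrable lborel \<eta>"
      using locint_mult_test_integrable[OF locint_const[of 1]] \<phi> \<eta> by auto
    have "(LINT x|lborel. \<phi> x + (- m) * \<eta> x) = 0"
      using i \<eta> by (subst Bochner_Integration.integral_add) (auto simp: m_def)
    then obtain \<Phi> where \<Phi>: "test_function \<Phi>" "deriv \<Phi> = (\<lambda>x. \<phi> x + (- m) * \<eta> x)"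
      using test_function_antiderivative[OF t] by metis
    have gi: "integrable lborel (\<lambda>x. g x * \<phi> x)" "integrable lborel (\<lambda>x. g x * \<eta> x)"
      by (intro locint_mult_test_integrable g \<phi> \<eta>)+
    have "0 = (LINT x|lborel. g x * (\<phi> x + (- m) * \<eta> x))" using z[OF \<Phi>(1)] \<Phi>(2) by simp
    also have "\<dots> = (LINT x|lborel. g x * \<phi> x - m * (g x * \<eta> x))" by (simp add: algebra_simps)
    also have "\<dots> = (LINT x|lborel. g x * \<phi> x) - m * c"
      using gi by (subst Bochner_Integration.integral_diff) (auto simp: c_def)
    finally show "(LINT x|lborel. g x * \<phi> x) = (LINT x|lborel. c * \<phi> x)" by (simp add: m_def)
  qed
  then show ?thesis by (rule that)
qed

section \<open>First-order weak derivatives and primitives\<close>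

text \<open>Higher weak derivatives are handled as chains of this relation, because only the first derivative
interacts simply with products and primitives.\<close>

definition weak_D :: "(real \<Rightarrow> real) \<Rightarrow> (real \<Rightarrow> real) \<Rightarrow> bool" where
  "weak_D g h \<longleftrightarrow> locint g \<and> locint h \<and>
     (\<forall>\<phi>. test_function \<phi> \<longrightarrow> (LINT x|lborel. g x * deriv \<phi> x) = - (LINT x|lborel. h x * \<phi> x))"

lemma weak_D_cmult: assumes "weak_D g h" shows "weak_D (\<lambda>x. c * g x) (\<lambda>x. c * h x)"
  using assms by (auto simp: weak_D_def mult.assoc intro: locint_cmult)

lemma weak_D_add:
  assumes "weak_D g h" "weak_D g' h'"
  shows "weak_D (\<lambda>x. g x + g' x) (\<lambda>x. h x + h' x)"
  using assms unfolding weak_D_def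
  by (auto simp: distrib_right Bochner_Integration.integral_add locint_mult_test_integrable
      test_function_deriv intro: locint_add)

lemma weak_D_sum: 
  "finite I \<Longrightarrow> (\<And>i. i \<in> I \<Longrightarrow> weak_D (g i) (h i)) \<Longrightarrow> weak_D (\<lambda>x. \<Sum>i\<in>I. g i x) (\<lambda>x. \<Sum>i\<in>I. h i x)"
proof (induction I rule: finite_induct)
  case empty then show ?case by (simp add: weak_D_def locint_const)
next
  case (insert i I)
  have "weak_D (\<lambda>x. g i x + (\<Sum>i\<in>I. g i x)) (\<lambda>x. h i x + (\<Sum>i\<in>I. h i x))"
    using insert by (intro weak_D_add) auto
  then show ?case using insert by simp
qed

text \<open>Test \<open>g\<close> with the derivative of \<open>x powr r * \<phi> x\<close>.\<close>

lemma weak_D_powr_mult: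
  assumes "weak_D g h"
  shows "weak_D (\<lambda>x. x powr r * g x) (\<lambda>x. r * (x powr (r - 1) * g x) + x powr r * h x)"
  unfolding weak_D_def
proof (intro conjI allI impI)
  have g: "locint g" and h: "locint h" using assms by (auto simp: weak_D_def)
  show "locint (\<lambda>x. x powr r * g x)" "locint (\<lambda>x. r * (x powr (r - 1) * g x) + x powr r * h x)"
    by (intro locint_add locint_cmult locint_powr_mult g h)+
  fix \<phi> assume t: "test_function \<phi>"
  let ?\<psi> = "\<lambda>x. x powr r * \<phi> x" and ?\<chi> = "\<lambda>x. x powr (r - 1) * \<phi> x"
  have t1: "test_function ?\<psi>" "test_function ?\<chi>" by (intro test_function_powr_mult t)+
  have d: "deriv ?\<psi> x = r * ?\<chi> x + x powr r * deriv \<phi> x" for x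
    using DERIV_imp_deriv[OF test_function_powr_mult_DERIV[OF t]] by (simp add: mult.assoc)
  have i1: "integrable lborel (\<lambda>x. g x * deriv ?\<psi> x)" "integrable lborel (\<lambda>x. g x * ?\<chi> x)" "integrable lborel (\<lambda>x. h x * ?\<psi> x)"
    by (intro locint_mult_test_integrable g h t1 test_function_deriv)+
  have "(LINT x|lborel. x powr r * g x * deriv \<phi> x) = (LINT x|lborel. g x * deriv ?\<psi> x - r * (g x * ?\<chi> x))"
    unfolding d by (simp add: algebra_simps)
  also have "\<dots> = (LINT x|lborel. g x * deriv ?\<psi> x) - r * (LINT x|lborel. g x * ?\<chi> x)"
    using i1 by (subst Bochner_Integration.integral_diff) auto
  also have "(LINT x|lborel. g x * deriv ?\<psi> x) = - (LINT x|lborel. h x * ?\<psi> x)"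
    using assms t1 by (auto simp: weak_D_def)
  also have "- (LINT x|lborel. h x * ?\<psi> x) - r * (LINT x|lborel. g x * ?\<chi> x)
      = - (LINT x|lborel. h x * ?\<psi> x + r * (g x * ?\<chi> x))"
    using i1 by (subst Bochner_Integration.integral_add) auto
  also have "\<dots> = - (LINT x|lborel. (r * (x powr (r - 1) * g x) + x powr r * h x) * \<phi> x)"
    by (simp add: algebra_simps)
  finally show "(LINT x|lborel. x powr r * g x * deriv \<phi> x) =
    - (LINT x|lborel. (r * (x powr (r - 1) * g x) + x powr r * h x) * \<phi> x)" .
qed

text \<open>The signed indicator function of the interval between the base point \<open>1/4\<close> and \<open>x\<close>. It allows one
formula for primitives on both sides of the base point, which is needed because \<open>h\<close> may fail to be
integrable up to \<open>0\<close>.\<close>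

definition primitive_kernel :: "real \<Rightarrow> real \<Rightarrow> real" where
  "primitive_kernel x u = (if 1/4 \<le> u \<and> u \<le> x then 1 else if x < u \<and> u < 1/4 then -1 else 0)"

definition primitive :: "(real \<Rightarrow> real) \<Rightarrow> real \<Rightarrow> real" where
  "primitive h x = (LINT u|lborel. h u * primitive_kernel x u)"

lemma primitive_kernel_measurable [measurable]:
  "(\<lambda>u. primitive_kernel x u) \<in> borel_measurable borel" "(\<lambda>x. primitive_kernel x u) \<in> borel_measurable borel"
  unfolding primitive_kernel_def by measurable

lemma primitive_kernel_integrable:
  assumes "locint h" "x \<in> J"
  shows "integrable lborel (\<lambda>u. h u * primitive_kernel x u)"
  by (rule locint_mult_integrable[OF assms(1), of _ 1 "min x (1/4)" "max x (1/4)"])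
     (use assms(2) in \<open>auto simp: primitive_kernel_def J_def\<close>)

lemma primitive_diff:
  assumes h: "locint h" and xy: "x \<in> J" "y \<in> J" "x \<le> y"
  shows "primitive h y - primitive h x = (LINT u:{x<..y}|lborel. h u)"
proof -
  have "primitive h y - primitive h x = (LINT u|lborel. h u * primitive_kernel y u - h u * primitive_kernel x u)"
    unfolding primitive_def
    by (rule Bochner_Integration.integral_diff[symmetric]) (intro primitive_kernel_integrable h xy)+
  also have "\<dots> = (LINT u:{x<..y}|lborel. h u)"
    unfolding set_lebesgue_integral_def
    by (rule Bochner_Integration.integral_cong) (use xy in \<open>auto simp: primitive_kernel_def indicator_def\<close>)
  finally show ?thesis .
qed

lemma primitive_locint:
  assumes h: "locint h" shows "locint (primitive h)"
proof -
  have [measurable]: "h \<in> borel_measurable borel" using h by (rule locint_measurable)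
  have m: "primitive h \<in> borel_measurable borel"
  proof -
    have "(\<lambda>x. LINT u|lborel. h u * primitive_kernel x u) \<in> borel_measurable borel"
      by (rule lborel.borel_measurable_lebesgue_integral) (unfold primitive_kernel_def, measurable)
    then show ?thesis by (simp add: primitive_def[abs_def])
  qed
  have "set_integrable lborel {a..b} (primitive h)" if ab: "0 < a" "b < 3/4" for a b
  proof -
    let ?I = "{min a (1/4)..max b (1/4)}"
    let ?B = "LINT u|lborel. \<bar>indicator ?I u *\<^sub>R h u\<bar>"
    have i: "integrable lborel (\<lambda>u. indicator ?I u *\<^sub>R h u)"
      using h ab unfolding locint_def set_integrable_def by auto
    have B: "\<bar>primitive h x\<bar> \<le> ?B" if "x \<in> {a..b}" for x
    proof -
      have x: "x \<in> J" using that ab by (auto simp: J_def)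
      have "\<bar>primitive h x\<bar> \<le> (LINT u|lborel. \<bar>h u * primitive_kernel x u\<bar>)"
        unfolding primitive_def by (rule integral_abs_bound)
      also have "\<dots> \<le> ?B"
        by (rule integral_mono) (use i primitive_kernel_integrable[OF h x] that in
            \<open>auto simp: primitive_kernel_def indicator_def\<close>)
      finally show ?thesis .
    qed
    have "integrable lborel (\<lambda>x. indicator {a..b} x *\<^sub>R primitive h x)"
    proof (rule Bochner_Integration.integrable_bound)
      have "integrable lborel (\<lambda>x. indicator {a..b} x *\<^sub>R ?B)"
        by (rule borel_integrable_compact) auto
      then show "integrable lborel (\<lambda>x. indicator {a..b} x *\<^sub>R ?B)" .
      show "(\<lambda>x. indicator {a..b} x *\<^sub>R primitive h x) \<in> borel_measurable lborel" using m by measurable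
      show "AE x in lborel. norm (indicator {a..b} x *\<^sub>R primitive h x) \<le> norm (indicator {a..b} x *\<^sub>R ?B)"
        using B by (intro AE_I2) (auto simp: indicator_def intro: order_trans[OF _ abs_ge_self])
    qed
    then show ?thesis by (simp add: set_integrable_def)
  qed
  with m show ?thesis by (simp add: locint_def)
qed

text \<open>For \<open>u\<close> to the right of the base point the kernel is the indicator function of \<open>x \<ge> u\<close>. To the
left of it, the kernel is that function minus \<open>1\<close>, which changes nothing since derivatives of test functions
have integral \<open>0\<close>.\<close>

lemma integral_kernel_deriv_test:
  assumes t: "test_function \<phi>"
  shows "(LINT x|lborel. primitive_kernel x u * deriv \<phi> x) = - \<phi> u"
proof -
  obtain a b where ab: "0 < a" "a < b" "b < 3/4" "\<And>x. x \<notin> {a..b} \<Longrightarrow> \<phi> x = 0"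
    using test_functionE[OF t] by metis
  obtain a' b' where ab': "0 < a'" "a' < b'" "b' < 3/4" "\<And>x. x \<notin> {a'..b'} \<Longrightarrow> deriv \<phi> x = 0"
    using test_functionE[OF test_function_deriv[OF t]] by metis
  have ib: "has_bochner_integral lborel (\<lambda>x. deriv \<phi> x * indicator {v..w} x) (\<phi> w - \<phi> v)" if "v \<le> w" for v w
    using that test_function_continuous[OF test_function_deriv[OF t]]
    by (intro has_bochner_integral_FTC_Icc_real test_function_DERIV[OF t]) (auto simp: continuous_on_eq_continuous_at)
  have z: "deriv \<phi> x = 0" if "x \<notin> {0..1}" for x using ab'(1,3) that by (intro ab'(4)) auto
  have 1: "has_bochner_integral lborel (\<lambda>x. deriv \<phi> x * indicator {u..} x) (- \<phi> u)"
  proof -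
    have "\<phi> (max u 1) = 0" using ab(1,3) by (intro ab(4)) auto
    moreover have "(\<lambda>x. deriv \<phi> x * indicator {u..max u 1} x) = (\<lambda>x. deriv \<phi> x * indicator {u..} x)"
    proof
      fix x show "deriv \<phi> x * indicator {u..max u 1} x = deriv \<phi> x * indicator {u..} x"
        using z[of x] by (cases "x \<le> 1") (auto simp: indicator_def)
    qed
    ultimately show ?thesis using ib[of u "max u 1"] by (simp only: max.cobounded1 diff_0)
  qed
  have 2: "has_bochner_integral lborel (deriv \<phi>) 0"
  proof -
    have "\<phi> 0 = 0" "\<phi> 1 = 0" using ab(1,3) by (auto intro!: ab(4))
    moreover have "(\<lambda>x. deriv \<phi> x * indicator {0..1} x) = deriv \<phi>"
    proof
      fix x show "deriv \<phi> x * indicator {0..1} x = deriv \<phi> x"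
        using z[of x] by (cases "x \<in> {0..1}") auto
    qed
    ultimately show ?thesis using ib[of 0 1] by simp
  qed
  show ?thesis
  proof (cases "1/4 \<le> u")
    case True
    have "(\<lambda>x. primitive_kernel x u * deriv \<phi> x) = (\<lambda>x. deriv \<phi> x * indicator {u..} x)"
      using True by (auto simp: primitive_kernel_def indicator_def)
    then show ?thesis using 1 by (simp only: has_bochner_integral_iff)
  next
    case False
    have "(\<lambda>x. primitive_kernel x u * deriv \<phi> x) = (\<lambda>x. deriv \<phi> x * indicator {u..} x - deriv \<phi> x)"
      using False by (auto simp: primitive_kernel_def indicator_def)
    moreover have "has_bochner_integral lborel (\<lambda>x. deriv \<phi> x * indicator {u..} x - deriv \<phi> x) (- \<phi> u - 0)"
      by (intro has_bochner_integral_diff 1 2)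
    ultimately show ?thesis by (simp only: has_bochner_integral_iff diff_0_right)
  qed
qed

text \<open>Integration by parts for a function that is merely locally integrable: exchange the order of
integration in the double integral of \<open>h u * primitive_kernel x u * deriv \<phi> x\<close>.\<close>

lemma weak_D_primitive:
  assumes h: "locint h" shows "weak_D (primitive h) h"
  unfolding weak_D_def
proof (intro conjI allI impI primitive_locint h)
  fix \<phi> assume t: "test_function \<phi>"
  have [measurable]: "h \<in> borel_measurable borel" using h by (rule locint_measurable)
  have [measurable]: "deriv \<phi> \<in> borel_measurable borel" by (intro test_function_measurable test_function_deriv t)
  obtain a b where ab: "0 < a" "a < b" "b < 3/4" "\<And>x. x \<notin> {a..b} \<Longrightarrow> deriv \<phi> x = 0"
    using test_functionE[OF test_function_deriv[OF t]] by metis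
  let ?f = "\<lambda>x u. h u * primitive_kernel x u * deriv \<phi> x"
  let ?I = "{min a (1/4)..max b (1/4)}"
  let ?H = "\<lambda>u. indicator ?I u *\<^sub>R h u"
  have i: "integrable lborel ?H"
    using h ab unfolding locint_def set_integrable_def by auto
  have j: "integrable lborel (deriv \<phi>)"
    using locint_mult_test_integrable[OF locint_const[of 1] test_function_deriv[OF t]] by simp
  have bound: "\<bar>?f x u\<bar> \<le> \<bar>?H u\<bar> * \<bar>deriv \<phi> x\<bar>" for x u
  proof (cases "x \<in> {a..b}")
    case True
    then have "\<bar>h u * primitive_kernel x u\<bar> \<le> \<bar>?H u\<bar>" by (auto simp: primitive_kernel_def indicator_def)
    then show ?thesis unfolding abs_mult[of _ "deriv \<phi> x"] by (rule mult_right_mono) simp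
  qed (use ab in auto)
  have HI: "integrable (lborel \<Otimes>\<^sub>M lborel) (\<lambda>(x, u). \<bar>?H u\<bar> * \<bar>deriv \<phi> x\<bar>)"
  proof (rule lborel_pair.Fubini_integrable)
    show "(\<lambda>(x, u). \<bar>?H u\<bar> * \<bar>deriv \<phi> x\<bar>) \<in> borel_measurable (lborel \<Otimes>\<^sub>M lborel)"
      by measurable
    show "integrable lborel (\<lambda>x. LINT u|lborel. norm (case (x, u) of (x, u) \<Rightarrow> \<bar>?H u\<bar> * \<bar>deriv \<phi> x\<bar>))"
      using j by (simp add: abs_mult)
    show "AE x in lborel. integrable lborel (\<lambda>u. case (x, u) of (x, u) \<Rightarrow> \<bar>?H u\<bar> * \<bar>deriv \<phi> x\<bar>)"
      using i by auto
  qed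
  have fi: "integrable (lborel \<Otimes>\<^sub>M lborel) (\<lambda>(x, u). ?f x u)"
  proof (rule Bochner_Integration.integrable_bound[OF HI])
    show "(\<lambda>(x, u). ?f x u) \<in> borel_measurable (lborel \<Otimes>\<^sub>M lborel)"
      unfolding primitive_kernel_def by measurable
    show "AE z in lborel \<Otimes>\<^sub>M lborel. norm (case z of (x, u) \<Rightarrow> ?f x u)
        \<le> norm (case z of (x, u) \<Rightarrow> \<bar>?H u\<bar> * \<bar>deriv \<phi> x\<bar>)"
      using bound by (intro AE_I2) (auto simp: abs_mult)
  qed
  have "(LINT x|lborel. primitive h x * deriv \<phi> x) = (LINT x|lborel. LINT u|lborel. ?f x u)"
    by (simp add: primitive_def)
  also have "\<dots> = (LINT u|lborel. LINT x|lborel. ?f x u)"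
    using lborel_pair.Fubini_integral[OF fi] by simp
  also have "\<dots> = (LINT u|lborel. h u * (LINT x|lborel. primitive_kernel x u * deriv \<phi> x))"
    by (simp add: mult.assoc)
  also have "\<dots> = (LINT u|lborel. - (h u * \<phi> u))"
    by (simp add: integral_kernel_deriv_test[OF t])
  also have "\<dots> = - (LINT u|lborel. h u * \<phi> u)" by simp
  finally show "(LINT x|lborel. primitive h x * deriv \<phi> x) = - (LINT x|lborel. h x * \<phi> x)" .
qed

text \<open>The difference of \<open>g\<close> and the primitive of \<open>h\<close> has weak derivative \<open>0\<close>, hence is constant.\<close>

lemma weak_D_FTC:
  assumes "weak_D g h"
  obtains G where "eqJ g G"
    "\<And>x y. x \<in> J \<Longrightarrow> y \<in> J \<Longrightarrow> x \<le> y \<Longrightarrow> G y - G x = (LINT u:{x<..y}|lborel. h u)"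
proof -
  have g: "locint g" and h: "locint h" using assms by (auto simp: weak_D_def)
  have "weak_D (\<lambda>x. g x + (- 1) * primitive h x) (\<lambda>x. h x + (- 1) * h x)"
    by (intro weak_D_add weak_D_cmult weak_D_primitive assms h)
  then have "\<And>\<phi>. test_function \<phi> \<Longrightarrow> (LINT x|lborel. (g x - primitive h x) * deriv \<phi> x) = 0"
    by (simp add: weak_D_def)
  then obtain c where "eqJ (\<lambda>x. g x - primitive h x) (\<lambda>_. c)"
    using constant_of_weak_deriv_0[OF locint_diff[OF g primitive_locint[OF h]]] by metis
  then have "eqJ g (\<lambda>x. primitive h x + c)" by eventually_elim auto
  then show ?thesis using that[of "\<lambda>x. primitive h x + c"] primitive_diff[OF h] by simp
qed

text \<open>Weak derivatives of order \<open>j\<close> and \<open>j + 1\<close> are each defined by testing \<open>f\<close> itself. Testing with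
\<open>deriv \<phi>\<close> relates them to each other.\<close>

lemma weak_D_of_has_weak_deriv:
  assumes g: "has_weak_deriv j f g" and h: "has_weak_deriv (Suc j) f h"
    and g0: "locint g0" "eqJ g g0" and h0: "locint h0" "eqJ h h0"
  shows "weak_D g0 h0"
proof -
  obtain f0 where f0: "locint f0" "eqJ f f0" using g borel_representative by (auto simp: has_weak_deriv_def)
  show ?thesis
    unfolding weak_D_def
  proof (intro conjI allI impI g0 h0)
    fix \<phi> assume t: "test_function \<phi>"
    have "(LINT x|lborel. f0 x * (deriv ^^ Suc j) \<phi> x) = (- 1) ^ j * (LINT x|lborel. g0 x * deriv \<phi> x)"
      using g test_function_deriv[OF t] by (simp add: has_weak_deriv_iff[OF f0 g0] funpow_swap1)
    moreover have "(LINT x|lborel. f0 x * (deriv ^^ Suc j) \<phi> x) = (- 1) ^ Suc j * (LINT x|lborel. h0 x * \<phi> x)"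
      using h t has_weak_deriv_iff[OF f0 h0] by blast
    ultimately have "(- 1) ^ j * (LINT x|lborel. g0 x * deriv \<phi> x) = (- 1) ^ j * - (LINT x|lborel. h0 x * \<phi> x)" by simp
    then show "(LINT x|lborel. g0 x * deriv \<phi> x) = - (LINT x|lborel. h0 x * \<phi> x)" by (subst (asm) mult_left_cancel) auto
  qed
qed

lemma has_weak_deriv_of_weak_D:
  assumes f: "eqJ f (g 0)" "locint (g 0)" and D: "\<And>i. i < j \<Longrightarrow> weak_D (g i) (g (Suc i))"
  shows "has_weak_deriv j f (g j)"
proof -
  have loc: "locint (g i)" if "i \<le> j" for i
    using that f(2) D by (cases i) (auto simp: weak_D_def)
  have "\<forall>\<phi>. test_function \<phi> \<longrightarrow> (LINT x|lborel. g 0 x * (deriv ^^ i) \<phi> x) = (-1) ^ i * (LINT x|lborel. g i x * \<phi> x)"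
    if "i \<le> j" for i using that
  proof (induction i)
    case (Suc i)
    show ?case
    proof (intro allI impI)
      fix \<phi> assume t: "test_function \<phi>"
      have "(LINT x|lborel. g 0 x * (deriv ^^ Suc i) \<phi> x) = (-1) ^ i * (LINT x|lborel. g i x * deriv \<phi> x)"
        using Suc test_function_deriv[OF t] by (simp add: funpow_swap1)
      then show "(LINT x|lborel. g 0 x * (deriv ^^ Suc i) \<phi> x) = (-1) ^ Suc i * (LINT x|lborel. g (Suc i) x * \<phi> x)"
        using D[of i] Suc t by (simp add: weak_D_def)
    qed
  qed simp
  then show ?thesis using has_weak_deriv_iff[OF f(2) f(1) loc[OF order_refl], of "g j" j] by simp
qed

section \<open>The Leibniz rule for powers\<close>

text \<open>The coefficient of \<open>x\<^bsup>p-j+i\<^esup> D\<^sup>i g\<close> in \<open>D\<^sup>j(x\<^sup>p g)\<close>, that is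
\<open>j choose i\<close> times the falling factorial of \<open>p\<close> of length \<open>j-i\<close>. The recursion is the one that
differentiation produces. The coefficients do not depend on \<open>g\<close>, so they can enter a constant
that is uniform in \<open>g\<close>.\<close>

primrec leibniz :: "real \<Rightarrow> nat \<Rightarrow> nat \<Rightarrow> real" where
  "leibniz p 0 = (\<lambda>i. if i = 0 then 1 else 0)"
| "leibniz p (Suc j) = (\<lambda>i. (p - real j + real i) * leibniz p j i + (if i = 0 then 0 else leibniz p j (i - 1)))"

lemma leibniz_eq_0: "j < i \<Longrightarrow> leibniz p j i = 0"
  by (induction j arbitrary: i) auto

definition leibniz_sum :: "real \<Rightarrow> (nat \<Rightarrow> real \<Rightarrow> real) \<Rightarrow> nat \<Rightarrow> real \<Rightarrow> real" where
  "leibniz_sum p g j x = (\<Sum>i\<le>j. leibniz p j i * (x powr (p - real j + real i) * g i x))"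

lemma weak_D_leibniz_sum:
  assumes D: "\<And>i. i \<le> j \<Longrightarrow> weak_D (g i) (g (Suc i))"
  shows "weak_D (leibniz_sum p g j) (leibniz_sum p g (Suc j))"
proof -
  let ?e = "\<lambda>i. p - real j + real i"
  have "weak_D (\<lambda>x. \<Sum>i\<in>{..j}. leibniz p j i * (x powr ?e i * g i x))
     (\<lambda>x. \<Sum>i\<in>{..j}. leibniz p j i * (?e i * (x powr (?e i - 1) * g i x) + x powr ?e i * g (Suc i) x))"
    by (intro weak_D_sum weak_D_cmult weak_D_powr_mult D) auto
  moreover have "(\<Sum>i\<le>j. leibniz p j i * (?e i * (x powr (?e i - 1) * g i x) + x powr ?e i * g (Suc i) x))
      = leibniz_sum p g (Suc j) x" for x
  proof -
    let ?t = "\<lambda>i. x powr (p - real (Suc j) + real i) * g i x"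
    have "leibniz_sum p g (Suc j) x = (\<Sum>i\<le>Suc j. ?e i * leibniz p j i * ?t i)
        + (\<Sum>i\<le>Suc j. (if i = 0 then 0 else leibniz p j (i - 1)) * ?t i)"
      by (simp add: leibniz_sum_def distrib_right sum.distrib del: sum.atMost_Suc of_nat_Suc)
    also have "(\<Sum>i\<le>Suc j. ?e i * leibniz p j i * ?t i) = (\<Sum>i\<le>j. ?e i * leibniz p j i * ?t i)"
      by (simp add: leibniz_eq_0)
    also have "(\<Sum>i\<le>Suc j. (if i = 0 then 0 else leibniz p j (i - 1)) * ?t i) = (\<Sum>i\<le>j. leibniz p j i * ?t (Suc i))"
      by (subst sum.atMost_Suc_shift) simp
    also have "(\<Sum>i\<le>j. ?e i * leibniz p j i * ?t i) + (\<Sum>i\<le>j. leibniz p j i * ?t (Suc i))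
       = (\<Sum>i\<le>j. leibniz p j i * (?e i * (x powr (?e i - 1) * g i x) + x powr ?e i * g (Suc i) x))"
      unfolding sum.distrib[symmetric] by (intro sum.cong refl) (simp add: algebra_simps)
    finally show ?thesis by simp
  qed
  ultimately show ?thesis by (simp add: leibniz_sum_def[abs_def])
qed

section \<open>Weighted norms and comparability near the diagonal\<close>

text \<open>The region of integration of the semi-norm.\<close>

definition near_diag :: "(real \<times> real) set" where "near_diag = (Lam \<union> Lam1) \<inter> (J \<times> J)"

definition wnormsq :: "real \<Rightarrow> (real \<Rightarrow> real) \<Rightarrow> ennreal" where
  "wnormsq a g = (\<integral>\<^sup>+x\<in>J. ennreal (x powr a * (g x)\<^sup>2) \<partial>lborel)"

text \<open>An iterated integral over Borel measures. Almost everywhere defined identities can be used in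
each variable separately.\<close>

definition wsemisq :: "real \<Rightarrow> real \<Rightarrow> (real \<Rightarrow> real) \<Rightarrow> ennreal" where
  "wsemisq b \<theta> g = (\<integral>\<^sup>+x. \<integral>\<^sup>+y. ennreal (x powr b * ((g x - g y)\<^sup>2 / \<bar>x - y\<bar> powr (1 + 2 * \<theta>)))
      * indicator near_diag (x, y) \<partial>lborel \<partial>lborel)"

text \<open>Both parts of the region lie in the cone \<open>x/2 < y < 3x/2\<close>. In particular \<open>|x - y|\<close> is at most
\<open>x\<close> and at most \<open>y\<close>, and powers of \<open>x\<close> and of \<open>y\<close> are comparable; this is all that the
upper bounds use. Only the fractional Hardy inequality needs actual points of the region.\<close>

lemma near_diagD:
  assumes "(x, y) \<in> near_diag"
  shows "x \<in> J" "y \<in> J" "0 < x" "0 < y" "x < 3/4" "y < 3/4" "x / 2 < y" "y < 3/2 * x"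
  using assms by (auto simp: near_diag_def Lam_def Lam1_def J_def)

lemma near_diag_measurable [measurable]: "near_diag \<in> sets (borel \<Otimes>\<^sub>M borel)"
proof -
  have "near_diag = {z \<in> space (borel \<Otimes>\<^sub>M borel). ((2/3 * fst z < snd z \<and> snd z < 3/2 * fst z \<and> 0 < fst z \<and> fst z < 1/2)
      \<or> (3/2 * fst z - 1/2 < snd z \<and> snd z < 2/3 * fst z + 1/3 \<and> 1/2 \<le> fst z \<and> fst z < 3/4))
      \<and> 0 < fst z \<and> fst z < 3/4 \<and> 0 < snd z \<and> snd z < 3/4}"
    by (auto simp: near_diag_def Lam_def Lam1_def J_def space_pair_measure)
  also have "\<dots> \<in> sets (borel \<Otimes>\<^sub>M borel)" by measurable
  finally show ?thesis .
qed

lemma powr_comparable: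
  fixes x y c :: real
  assumes "0 < x" "x / 2 \<le> y" "y \<le> 2 * x"
  shows "y powr c \<le> 2 powr \<bar>c\<bar> * x powr c"
proof -
  have y: "0 < y" using assms by linarith
  have "(y / x) powr c \<le> 2 powr \<bar>c\<bar>"
  proof (cases "c \<ge> 0")
    case True
    then have "(y / x) powr c \<le> 2 powr c" using assms y by (intro powr_mono2) (auto simp: field_simps)
    then show ?thesis using True by simp
  next
    case False
    have "(y / x) powr c = (x / y) powr (- c)" using assms y by (simp add: powr_divide powr_minus field_simps)
    also have "\<dots> \<le> 2 powr (- c)" using assms y False by (intro powr_mono2) (auto simp: field_simps)
    finally show ?thesis using False by simp
  qed
  moreover have "(y / x) powr c = y powr c / x powr c" using assms y by (simp add: powr_divide)
  ultimately show ?thesis using assms by (simp add: field_simps)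
qed

lemma nn_integral_abs_shift:
  fixes F :: "real \<Rightarrow> ennreal" and u :: real
  assumes [measurable]: "F \<in> borel_measurable borel"
  shows "(\<integral>\<^sup>+x. F \<bar>x - u\<bar> \<partial>lborel) \<le> 2 * (\<integral>\<^sup>+t\<in>{0..}. F t \<partial>lborel)"
proof -
  let ?G = "\<lambda>t::real. F t * indicator {0..} t :: ennreal"
  have "(\<integral>\<^sup>+x. F \<bar>x - u\<bar> \<partial>lborel) \<le> (\<integral>\<^sup>+x. ?G (- u + 1 * x) + ?G (u + (-1) * x) \<partial>lborel)"
    by (intro nn_integral_mono) (auto simp: indicator_def abs_if)
  also have "\<dots> = (\<integral>\<^sup>+x. ?G (- u + 1 * x) \<partial>lborel) + (\<integral>\<^sup>+x. ?G (u + (-1) * x) \<partial>lborel)"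
    by (rule nn_integral_add) measurable
  also have "(\<integral>\<^sup>+x. ?G (- u + 1 * x) \<partial>lborel) = (\<integral>\<^sup>+x. ?G x \<partial>lborel)"
    using nn_integral_real_affine[of ?G 1 "- u"] by simp
  also have "(\<integral>\<^sup>+x. ?G (u + (-1) * x) \<partial>lborel) = (\<integral>\<^sup>+x. ?G x \<partial>lborel)"
    using nn_integral_real_affine[of ?G "-1" u] by simp
  finally show ?thesis by (simp add: mult_2)
qed

text \<open>Convergence at \<open>u\<close> requires \<open>\<kappa> > -1\<close>. For the exponent \<open>1 - 2\<theta>\<close> this is
\<open>\<theta> < 1\<close>.\<close>

lemma nn_integral_powr_ball:
  fixes u r \<kappa> :: real
  assumes "\<kappa> > -1" "r \<ge> 0"
  shows "(\<integral>\<^sup>+x. ennreal (\<bar>x - u\<bar> powr \<kappa>) * indicator {..r} \<bar>x - u\<bar> \<partial>lborel)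
    \<le> ennreal (2 / (\<kappa> + 1) * r powr (\<kappa> + 1))"
proof -
  have "(\<integral>\<^sup>+x. ennreal (\<bar>x - u\<bar> powr \<kappa>) * indicator {..r} \<bar>x - u\<bar> \<partial>lborel)
    \<le> 2 * (\<integral>\<^sup>+t\<in>{0..}. (ennreal (t powr \<kappa>) * indicator {..r} t) \<partial>lborel)"
    by (rule nn_integral_abs_shift[of "\<lambda>t. ennreal (t powr \<kappa>) * indicator {..r} t"]) measurable
  also have "(\<integral>\<^sup>+t\<in>{0..}. (ennreal (t powr \<kappa>) * indicator {..r} t) \<partial>lborel) = (\<integral>\<^sup>+t. ennreal (t powr \<kappa>) * indicator {0..r} t \<partial>lborel)"
    by (intro nn_integral_cong) (auto simp: indicator_def)
  also have "\<dots> = ennreal (r powr (\<kappa> + 1) / (\<kappa> + 1))"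
    by (rule nn_integral_has_integral_lebesgue'[OF _ has_integral_powr_from_0]) (use assms in auto)
  also have "2 * ennreal (r powr (\<kappa> + 1) / (\<kappa> + 1)) = ennreal (2 / (\<kappa> + 1) * r powr (\<kappa> + 1))"
    using assms by (simp add: ennreal_mult' [symmetric] flip: ennreal_numeral)
  finally show ?thesis .
qed

text \<open>Convergence at infinity requires \<open>\<kappa> > 1\<close>. For \<open>\<kappa> = 2\<theta>\<close> this is \<open>\<theta> > 1/2\<close>.\<close>

lemma nn_integral_powr_tail:
  fixes x d \<kappa> :: real
  assumes "\<kappa> > 1" "d > 0"
  shows "(\<integral>\<^sup>+y. ennreal (\<bar>y - x\<bar> powr (- \<kappa>)) * indicator {d..} \<bar>y - x\<bar> \<partial>lborel)
    \<le> ennreal (2 / (\<kappa> - 1) * d powr (1 - \<kappa>))"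
proof -
  let ?f = "\<lambda>t::real. if t \<ge> d then t powr (- \<kappa>) else 0"
  have "(\<integral>\<^sup>+y. ennreal (\<bar>y - x\<bar> powr (- \<kappa>)) * indicator {d..} \<bar>y - x\<bar> \<partial>lborel)
    \<le> 2 * (\<integral>\<^sup>+t\<in>{0..}. (ennreal (t powr (- \<kappa>)) * indicator {d..} t) \<partial>lborel)"
    by (rule nn_integral_abs_shift[of "\<lambda>t. ennreal (t powr (- \<kappa>)) * indicator {d..} t"]) measurable
  also have "(\<integral>\<^sup>+t\<in>{0..}. (ennreal (t powr (- \<kappa>)) * indicator {d..} t) \<partial>lborel) = (\<integral>\<^sup>+t. ennreal (t powr (- \<kappa>)) * indicator {d..} t \<partial>lborel)"
    using assms by (intro nn_integral_cong) (auto simp: indicator_def)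
  also have "\<dots> = ennreal (0 - (d powr (1 - \<kappa>) / (1 - \<kappa>)))"
  proof (rule nn_integral_FTC_atLeast)
    show "((\<lambda>t. t powr (1 - \<kappa>) / (1 - \<kappa>)) has_real_derivative t powr - \<kappa>) (at t)" if "d \<le> t" for t
      using that assms by (auto intro!: derivative_eq_intros)
    have "((\<lambda>t::real. t powr (1 - \<kappa>)) \<longlongrightarrow> 0) at_top"
      by (rule tendsto_neg_powr) (use assms in \<open>auto intro: filterlim_ident\<close>)
    then show "((\<lambda>t::real. t powr (1 - \<kappa>) / (1 - \<kappa>)) \<longlongrightarrow> 0) at_top"
      using tendsto_divide_zero by blast
  qed auto
  also have "2 * ennreal (0 - (d powr (1 - \<kappa>) / (1 - \<kappa>))) = ennreal (2 * (0 - (d powr (1 - \<kappa>) / (1 - \<kappa>))))"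
    using assms by (subst ennreal_mult') (auto simp: divide_nonneg_neg)
  also have "2 * (0 - (d powr (1 - \<kappa>) / (1 - \<kappa>))) = 2 / (\<kappa> - 1) * d powr (1 - \<kappa>)"
    using assms by (simp add: field_simps)
  finally show ?thesis .
qed

text \<open>Since \<open>|x - y| \<le> x\<close> on the region, powers of \<open>|x - y|\<close> in the denominator can be exchanged for
powers of \<open>x\<close> in the weight.\<close>

lemma wsemisq_order_mono:
  assumes "\<theta> \<le> \<theta>'" "b' = b + 2 * (\<theta>' - \<theta>)"
  shows "wsemisq b \<theta> g \<le> wsemisq b' \<theta>' g"
  unfolding wsemisq_def
proof (intro nn_integral_mono)
  fix x y :: real
  show "ennreal (x powr b * ((g x - g y)\<^sup>2 / \<bar>x - y\<bar> powr (1 + 2 * \<theta>))) * indicator near_diag (x, y)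
    \<le> ennreal (x powr b' * ((g x - g y)\<^sup>2 / \<bar>x - y\<bar> powr (1 + 2 * \<theta>'))) * indicator near_diag (x, y)"
  proof (cases "(x, y) \<in> near_diag \<and> x \<noteq> y")
    case True
    then have xy: "0 < x" "\<bar>x - y\<bar> \<le> x" "0 < \<bar>x - y\<bar>" using near_diagD[of x y] by auto
    define d where "d = \<bar>x - y\<bar>"
    have d: "0 < d" "d \<le> x" using xy by (auto simp: d_def)
    have "x powr b / d powr (1 + 2 * \<theta>) = x powr b * d powr (2 * (\<theta>' - \<theta>)) / d powr (1 + 2 * \<theta>')"
      using d by (simp add: field_simps powr_add[symmetric])
    also have "\<dots> \<le> x powr b * x powr (2 * (\<theta>' - \<theta>)) / d powr (1 + 2 * \<theta>')"
      using d xy assms by (intro divide_right_mono mult_left_mono powr_mono2) auto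
    also have "\<dots> = x powr b' / d powr (1 + 2 * \<theta>')"
      using xy assms by (simp add: powr_add)
    finally have "x powr b / d powr (1 + 2 * \<theta>) * (g x - g y)\<^sup>2 \<le> x powr b' / d powr (1 + 2 * \<theta>') * (g x - g y)\<^sup>2"
      by (rule mult_right_mono) simp
    then show ?thesis
      by (intro mult_right_mono ennreal_leI) (auto simp: d_def mult_ac)
  qed (auto simp: indicator_def)
qed

text \<open>On \<open>J\<close> we have \<open>x < 1\<close>, so a larger exponent is a smaller weight.\<close>

lemma wnormsq_mono: 
  assumes "a' \<le> a" shows "wnormsq a g \<le> wnormsq a' g"
  unfolding wnormsq_def
proof (intro nn_integral_mono)
  fix x :: real
  show "ennreal (x powr a * (g x)\<^sup>2) * indicator J x \<le> ennreal (x powr a' * (g x)\<^sup>2) * indicator J x"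
  proof (cases "x \<in> J")
    case True
    then have "x powr a \<le> x powr a'" using assms by (intro powr_mono') (auto simp: J_def)
    then show ?thesis by (intro mult_right_mono ennreal_leI) auto
  qed auto
qed

lemma wsemisq_mono:
  assumes "b' \<le> b" shows "wsemisq b \<theta> g \<le> wsemisq b' \<theta> g"
  unfolding wsemisq_def
proof (intro nn_integral_mono)
  fix x y :: real
  show "ennreal (x powr b * ((g x - g y)\<^sup>2 / \<bar>x - y\<bar> powr (1 + 2 * \<theta>))) * indicator near_diag (x, y)
    \<le> ennreal (x powr b' * ((g x - g y)\<^sup>2 / \<bar>x - y\<bar> powr (1 + 2 * \<theta>))) * indicator near_diag (x, y)"
  proof (cases "(x, y) \<in> near_diag")
    case True
    then have "x powr b \<le> x powr b'" using assms near_diagD[OF True] by (intro powr_mono') auto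
    then show ?thesis by (intro mult_right_mono ennreal_leI) auto
  qed auto
qed

text \<open>The mean value inequality on \<open>[x/2, 2x]\<close>, where \<open>powr_comparable\<close> bounds the derivative of
\<open>z powr a\<close> by its size at \<open>x\<close>.\<close>

lemma powr_increment_bound:
  fixes x y a :: real
  assumes x: "0 < x" and y: "x / 2 \<le> y" "y \<le> 2 * x"
  shows "(x powr a - y powr a)\<^sup>2 \<le> (a * 2 powr \<bar>a - 1\<bar>)\<^sup>2 * x powr (2 * a - 2) * (x - y)\<^sup>2"
proof -
  have "\<bar>x powr a - y powr a\<bar> \<le> (\<bar>a\<bar> * (2 powr \<bar>a - 1\<bar> * x powr (a - 1))) * \<bar>x - y\<bar>"
  proof -
    have "norm (x powr a - y powr a) \<le> (\<bar>a\<bar> * (2 powr \<bar>a - 1\<bar> * x powr (a - 1))) * norm (x - y)"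
    proof (rule field_differentiable_bound[of "{x/2..2*x}"])
      show "((\<lambda>z. z powr a) has_field_derivative a * z powr (a - 1)) (at z within {x/2..2*x})"
        if "z \<in> {x/2..2*x}" for z
        using that x by (auto intro!: derivative_eq_intros)
      show "norm (a * z powr (a - 1)) \<le> \<bar>a\<bar> * (2 powr \<bar>a - 1\<bar> * x powr (a - 1))" if "z \<in> {x/2..2*x}" for z
        using that x powr_comparable[of x z "a - 1"] by (simp add: abs_mult mult_left_mono)
    qed (use x y in auto)
    then show ?thesis by simp
  qed
  then have "\<bar>x powr a - y powr a\<bar>\<^sup>2 \<le> ((\<bar>a\<bar> * (2 powr \<bar>a - 1\<bar> * x powr (a - 1))) * \<bar>x - y\<bar>)\<^sup>2"
    by (rule power_mono) simp
  also have "\<dots> = (a * 2 powr \<bar>a - 1\<bar>)\<^sup>2 * (x powr (a - 1))\<^sup>2 * (x - y)\<^sup>2"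
    by (simp add: power_mult_distrib)
  also have "(x powr (a - 1))\<^sup>2 = x powr (2 * a - 2)"
    using x by (simp add: power2_eq_square powr_add[symmetric])
  finally show ?thesis by simp
qed

section \<open>Semi-norms of products and of primitives\<close>

text \<open>In the term \<open>(x\<^sup>a - y\<^sup>a) g(y)\<close> the increment of the power provides a factor
\<open>|x - y|\<close>. The kernel that remains, \<open>|x - y|\<^bsup>1-2\<theta>\<^esup>\<close>, is integrable in \<open>x\<close> and has
integral of order \<open>y\<^bsup>2-2\<theta>\<^esup>\<close>.\<close>

lemma wsemisq_powr_mult:
  fixes a b \<theta> :: real
  assumes \<theta>: "0 < \<theta>" "\<theta> < 1"
  obtains C :: real where "0 \<le> C"
    "\<And>g. g \<in> borel_measurable borel \<Longrightarrow>
      wsemisq b \<theta> (\<lambda>x. x powr a * g x) \<le> ennreal C * (wsemisq (b + 2 * a) \<theta> g + wnormsq (b + 2 * a - 2 * \<theta>) g)"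
proof -
  define L where "L = (a * 2 powr \<bar>a - 1\<bar>)\<^sup>2"
  define M where "M = 2 * L * 2 powr \<bar>b + 2 * a - 2\<bar> * (2 / (2 - 2 * \<theta>))"
  have L: "0 \<le> L" by (simp add: L_def)
  have M: "0 \<le> M" using L \<theta> by (simp add: M_def)
  have main: "wsemisq b \<theta> (\<lambda>x. x powr a * g x) \<le> ennreal 2 * wsemisq (b + 2 * a) \<theta> g + ennreal M * wnormsq (b + 2 * a - 2 * \<theta>) g"
    if [measurable]: "g \<in> borel_measurable borel" for g
  proof -
    let ?c = "b + 2 * a - 2"
    let ?F = "\<lambda>x y. ennreal (x powr (b + 2 * a) * ((g x - g y)\<^sup>2 / \<bar>x - y\<bar> powr (1 + 2 * \<theta>))) * indicator near_diag (x, y)"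
    let ?H = "\<lambda>x y. ennreal (2 * L * 2 powr \<bar>?c\<bar> * y powr ?c * (g y)\<^sup>2) * (ennreal (\<bar>x - y\<bar> powr (1 - 2 * \<theta>)) * (if \<bar>x - y\<bar> \<le> y then 1 else 0)) * indicator J y"
    have e: "ennreal (2 * P + K * D) = ennreal 2 * ennreal P + ennreal K * ennreal D"
      if "0 \<le> P" "0 \<le> K" "0 \<le> D" for P K D :: real
    proof -
      have "ennreal (2 * P + K * D) = ennreal (2 * P) + ennreal (K * D)"
        by (rule ennreal_plus) (use that in auto)
      also have "ennreal (2 * P) = ennreal 2 * ennreal P" by (rule ennreal_mult) (use that in auto)
      also have "ennreal (K * D) = ennreal K * ennreal D" by (rule ennreal_mult) (use that in auto)
      finally show ?thesis .
    qed
    have pt: "ennreal (x powr b * ((x powr a * g x - y powr a * g y)\<^sup>2 / \<bar>x - y\<bar> powr (1 + 2 * \<theta>))) * indicator near_diag (x, y)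
        \<le> ennreal 2 * ?F x y + ?H x y" for x y
    proof (cases "(x, y) \<in> near_diag \<and> x \<noteq> y")
      case True
      then have R: "(x, y) \<in> near_diag" and ne: "x \<noteq> y" by auto
      note xy = near_diagD[OF R]
      define d where "d = \<bar>x - y\<bar>"
      have d: "0 < d" "d \<le> y" using xy ne by (auto simp: d_def)
      have sq: "(u + v)\<^sup>2 \<le> 2 * u\<^sup>2 + 2 * v\<^sup>2" for u v :: real
        using zero_le_power2[of "u - v"] by (simp add: power2_eq_square algebra_simps)
      have xsq: "(x powr a)\<^sup>2 = x powr (2 * a)"
        by (simp add: power2_eq_square flip: powr_add)
      have "(x powr a * g x - y powr a * g y)\<^sup>2 = (x powr a * (g x - g y) + (x powr a - y powr a) * g y)\<^sup>2"
        by (simp add: algebra_simps)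
      also have "\<dots> \<le> 2 * (x powr a * (g x - g y))\<^sup>2 + 2 * ((x powr a - y powr a) * g y)\<^sup>2" by (rule sq)
      also have "\<dots> = 2 * x powr (2 * a) * (g x - g y)\<^sup>2 + 2 * (x powr a - y powr a)\<^sup>2 * (g y)\<^sup>2"
        by (simp only: power_mult_distrib xsq mult.assoc)
      also have "\<dots> \<le> 2 * x powr (2 * a) * (g x - g y)\<^sup>2 + 2 * (L * x powr (2 * a - 2) * d\<^sup>2) * (g y)\<^sup>2"
        using powr_increment_bound[of x y a] xy
        by (intro add_left_mono mult_right_mono mult_left_mono) (auto simp: L_def d_def)
      finally have "x powr b * ((x powr a * g x - y powr a * g y)\<^sup>2 / d powr (1 + 2 * \<theta>))
         \<le> x powr b * ((2 * x powr (2 * a) * (g x - g y)\<^sup>2 + 2 * (L * x powr (2 * a - 2) * d\<^sup>2) * (g y)\<^sup>2) / d powr (1 + 2 * \<theta>))"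
        by (intro mult_left_mono divide_right_mono) auto
      also have "\<dots> = 2 * ((x powr b * x powr (2 * a)) * ((g x - g y)\<^sup>2 / d powr (1 + 2 * \<theta>)))
          + 2 * L * (x powr b * x powr (2 * a - 2)) * (d\<^sup>2 / d powr (1 + 2 * \<theta>)) * (g y)\<^sup>2"
        by (simp only: add_divide_distrib distrib_left times_divide_eq_right mult_ac)
      also have "x powr b * x powr (2 * a) = x powr (b + 2 * a)" by (simp add: powr_add)
      also have "x powr b * x powr (2 * a - 2) = x powr ?c"
        by (simp add: add_diff_eq flip: powr_add)
      also have "d\<^sup>2 / d powr (1 + 2 * \<theta>) = d powr (1 - 2 * \<theta>)"
      proof -
        have "d\<^sup>2 = d powr 2" using d by simp
        then have "d\<^sup>2 / d powr (1 + 2 * \<theta>) = d powr (2 - (1 + 2 * \<theta>))" by (simp only: powr_diff)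
        then show ?thesis by (simp add: algebra_simps)
      qed
      also have "2 * L * x powr ?c * d powr (1 - 2 * \<theta>) * (g y)\<^sup>2 \<le> 2 * L * (2 powr \<bar>?c\<bar> * y powr ?c) * d powr (1 - 2 * \<theta>) * (g y)\<^sup>2"
        using powr_comparable[of y x ?c] xy L by (intro mult_right_mono mult_left_mono) auto
      finally have "x powr b * ((x powr a * g x - y powr a * g y)\<^sup>2 / d powr (1 + 2 * \<theta>))
        \<le> 2 * (x powr (b + 2 * a) * ((g x - g y)\<^sup>2 / d powr (1 + 2 * \<theta>)))
          + (2 * L * 2 powr \<bar>?c\<bar> * y powr ?c * (g y)\<^sup>2) * d powr (1 - 2 * \<theta>)"
        by (simp add: mult_ac)
      then have "ennreal (x powr b * ((x powr a * g x - y powr a * g y)\<^sup>2 / d powr (1 + 2 * \<theta>)))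
        \<le> ennreal (2 * (x powr (b + 2 * a) * ((g x - g y)\<^sup>2 / d powr (1 + 2 * \<theta>)))
          + (2 * L * 2 powr \<bar>?c\<bar> * y powr ?c * (g y)\<^sup>2) * d powr (1 - 2 * \<theta>))"
        by (rule ennreal_leI)
      also have "\<dots> = ennreal 2 * ennreal (x powr (b + 2 * a) * ((g x - g y)\<^sup>2 / d powr (1 + 2 * \<theta>)))
          + ennreal (2 * L * 2 powr \<bar>?c\<bar> * y powr ?c * (g y)\<^sup>2) * ennreal (d powr (1 - 2 * \<theta>))"
      proof (rule e)
        show "0 \<le> 2 * L * 2 powr \<bar>?c\<bar> * y powr ?c * (g y)\<^sup>2"
          by (intro mult_nonneg_nonneg L) auto
      qed auto
      finally have "ennreal (x powr b * ((x powr a * g x - y powr a * g y)\<^sup>2 / d powr (1 + 2 * \<theta>)))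
        \<le> ennreal 2 * ennreal (x powr (b + 2 * a) * ((g x - g y)\<^sup>2 / d powr (1 + 2 * \<theta>)))
          + ennreal (2 * L * 2 powr \<bar>?c\<bar> * y powr ?c * (g y)\<^sup>2) * ennreal (d powr (1 - 2 * \<theta>))" .
      then show ?thesis using True d xy by (simp add: d_def)
    qed (auto simp: indicator_def)
    have "wsemisq b \<theta> (\<lambda>x. x powr a * g x) \<le> (\<integral>\<^sup>+x. \<integral>\<^sup>+y. ennreal 2 * ?F x y + ?H x y \<partial>lborel \<partial>lborel)"
      unfolding wsemisq_def by (intro nn_integral_mono pt)
    also have "\<dots> = (\<integral>\<^sup>+x. ennreal 2 * (\<integral>\<^sup>+y. ?F x y \<partial>lborel) + (\<integral>\<^sup>+y. ?H x y \<partial>lborel) \<partial>lborel)"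
      by (intro nn_integral_cong) (subst nn_integral_add, auto simp: nn_integral_cmult)
    also have "\<dots> = ennreal 2 * wsemisq (b + 2 * a) \<theta> g + (\<integral>\<^sup>+x. \<integral>\<^sup>+y. ?H x y \<partial>lborel \<partial>lborel)"
      unfolding wsemisq_def by (subst nn_integral_add, auto simp: nn_integral_cmult)
    (* The second term contains g only at y, so x is integrated first. *)
    also have "(\<integral>\<^sup>+x. \<integral>\<^sup>+y. ?H x y \<partial>lborel \<partial>lborel) = (\<integral>\<^sup>+y. \<integral>\<^sup>+x. ?H x y \<partial>lborel \<partial>lborel)"
      by (rule lborel_pair.Fubini') measurable
    also have "\<dots> \<le> (\<integral>\<^sup>+y. ennreal M * (ennreal (y powr (b + 2 * a - 2 * \<theta>) * (g y)\<^sup>2) * indicator J y) \<partial>lborel)"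
    proof (intro nn_integral_mono)
      fix y :: real
      show "(\<integral>\<^sup>+x. ?H x y \<partial>lborel) \<le> ennreal M * (ennreal (y powr (b + 2 * a - 2 * \<theta>) * (g y)\<^sup>2) * indicator J y)"
      proof (cases "y \<in> J")
        case True
        then have y: "0 < y" by (auto simp: J_def)
        let ?K = "2 * L * 2 powr \<bar>?c\<bar> * y powr ?c * (g y)\<^sup>2"
        have "(\<integral>\<^sup>+x. ?H x y \<partial>lborel) = ennreal ?K * (\<integral>\<^sup>+x. ennreal (\<bar>x - y\<bar> powr (1 - 2 * \<theta>)) * indicator {..y} \<bar>x - y\<bar> \<partial>lborel)"
          using True by (subst nn_integral_cmult[symmetric]) (auto intro!: nn_integral_cong simp: indicator_def)
        also have "\<dots> \<le> ennreal ?K * ennreal (2 / (1 - 2 * \<theta> + 1) * y powr (1 - 2 * \<theta> + 1))"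
          by (intro mult_left_mono nn_integral_powr_ball) (use \<theta> y in auto)
        also have "\<dots> = ennreal (?K * (2 / (1 - 2 * \<theta> + 1) * y powr (1 - 2 * \<theta> + 1)))"
          using L by (subst ennreal_mult') (use \<theta> in auto)
        also have "?K * (2 / (1 - 2 * \<theta> + 1) * y powr (1 - 2 * \<theta> + 1)) = M * ((y powr ?c * y powr (1 - 2 * \<theta> + 1)) * (g y)\<^sup>2)"
          by (simp add: M_def)
        also have "y powr ?c * y powr (1 - 2 * \<theta> + 1) = y powr (b + 2 * a - 2 * \<theta>)"
          by (simp add: add_diff_eq flip: powr_add)
        finally show ?thesis using True M by (simp add: ennreal_mult')
      qed simp
    qed
    also have "\<dots> = ennreal M * wnormsq (b + 2 * a - 2 * \<theta>) g"
      unfolding wnormsq_def by (rule nn_integral_cmult) measurable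
    finally show ?thesis by (simp add: add_left_mono)
  qed
  show ?thesis
  proof (rule that[of "2 + M"])
    fix g :: "real \<Rightarrow> real" assume g: "g \<in> borel_measurable borel"
    have "ennreal 2 * wsemisq (b + 2 * a) \<theta> g + ennreal M * wnormsq (b + 2 * a - 2 * \<theta>) g
      \<le> ennreal (2 + M) * wsemisq (b + 2 * a) \<theta> g + ennreal (2 + M) * wnormsq (b + 2 * a - 2 * \<theta>) g"
      using M by (intro add_mono mult_right_mono ennreal_leI) auto
    from order_trans[OF main[OF g] this] show "wsemisq b \<theta> (\<lambda>x. x powr a * g x) \<le> ennreal (2 + M) * (wsemisq (b + 2 * a) \<theta> g + wnormsq (b + 2 * a - 2 * \<theta>) g)"
      by (simp only: distrib_left)
  qed (use M in simp)
qed

definition J_primitive :: "(real \<Rightarrow> real) \<Rightarrow> (real \<Rightarrow> real) \<Rightarrow> bool" where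
  "J_primitive G h \<longleftrightarrow> (\<forall>x\<in>J. \<forall>y\<in>J. x \<le> y \<longrightarrow> G y - G x = (LINT u:{x<..y}|lborel. h u))"

text \<open>Cauchy-Schwarz on the interval between \<open>x\<close> and \<open>y\<close>. If \<open>h\<close> is not integrable there, then the
Bochner integral is \<open>0\<close> by convention and the bound holds as well.\<close>

lemma increment_sq_bound:
  assumes P: "J_primitive G h" and [measurable]: "h \<in> borel_measurable borel" and "x \<in> J" "y \<in> J"
  shows "ennreal ((G x - G y)\<^sup>2) \<le> ennreal \<bar>x - y\<bar> * (\<integral>\<^sup>+u. ennreal ((h u)\<^sup>2) * indicator {min x y<..max x y} u \<partial>lborel)"
  using assms(3,4)
proof (induction x y rule: linorder_wlog)
  case (le x y)
  let ?I = "{x<..y}"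
  have "ennreal \<bar>G y - G x\<bar> \<le> (\<integral>\<^sup>+u. ennreal (indicator ?I u * \<bar>h u\<bar>) * indicator ?I u \<partial>lborel)"
  proof (cases "integrable lborel (\<lambda>u. indicator ?I u *\<^sub>R h u)")
    case True
    have "ennreal (norm (LINT u:?I|lborel. h u)) \<le> (\<integral>\<^sup>+u. ennreal (norm (indicator ?I u *\<^sub>R h u)) \<partial>lborel)"
      unfolding set_lebesgue_integral_def by (rule integral_norm_bound_ennreal[OF True])
    also have "\<dots> = (\<integral>\<^sup>+u. ennreal (indicator ?I u * \<bar>h u\<bar>) * indicator ?I u \<partial>lborel)"
      by (intro nn_integral_cong) (auto simp: indicator_def)
    finally show ?thesis using P le by (simp add: J_primitive_def)
  next
    case False
    then have "(LINT u:?I|lborel. h u) = 0" unfolding set_lebesgue_integral_def by (rule not_integrable_integral_eq)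
    then show ?thesis using P le by (simp add: J_primitive_def)
  qed
  then have "(ennreal \<bar>G y - G x\<bar>)\<^sup>2 \<le> (\<integral>\<^sup>+u. ennreal (indicator ?I u * \<bar>h u\<bar>) * indicator ?I u \<partial>lborel)\<^sup>2"
    by (rule power_mono) simp
  also have "\<dots> \<le> (\<integral>\<^sup>+u. (ennreal (indicator ?I u * \<bar>h u\<bar>))\<^sup>2 \<partial>lborel) * (\<integral>\<^sup>+u. (indicator ?I u)\<^sup>2 \<partial>lborel)"
    by (rule Cauchy_Schwarz_nn_integral) measurable
  also have "(\<integral>\<^sup>+u. (indicator ?I u)\<^sup>2 \<partial>lborel) = (\<integral>\<^sup>+u. indicator ?I u \<partial>lborel)"
    by (intro nn_integral_cong) (auto simp: indicator_def)
  also have "\<dots> = ennreal \<bar>x - y\<bar>" using le by simp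
  also have "(\<integral>\<^sup>+u. (ennreal (indicator ?I u * \<bar>h u\<bar>))\<^sup>2 \<partial>lborel) = (\<integral>\<^sup>+u. ennreal ((h u)\<^sup>2) * indicator {min x y<..max x y} u \<partial>lborel)"
    using le by (intro nn_integral_cong) (auto simp: indicator_def ennreal_power)
  finally have "ennreal ((G y - G x)\<^sup>2) \<le> (\<integral>\<^sup>+u. ennreal ((h u)\<^sup>2) * indicator {min x y<..max x y} u \<partial>lborel) * ennreal \<bar>x - y\<bar>"
    by (simp add: ennreal_power)
  then show ?case by (simp add: mult.commute power2_commute)
next
  case (sym x y)
  then show ?case by (simp add: power2_commute min.commute max.commute abs_minus_commute)
qed

text \<open>By Cauchy-Schwarz the semi-norm is at most the triple integral of
\<open>x\<^sup>b |x - y|\<^bsup>-2\<theta>\<^esup> h(u)\<^sup>2\<close> over \<open>u\<close> between \<open>x\<close> and \<open>y\<close>. With \<open>u\<close> fixed,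
the integral over \<open>y\<close> with \<open>|x - y| \<ge> |x - u|\<close> is of order \<open>|x - u|\<^bsup>1-2\<theta>\<^esup>\<close>, which uses
\<open>\<theta> > 1/2\<close>. The integral of this over \<open>|x - u| \<le> u\<close> is of order \<open>u\<^bsup>2-2\<theta>\<^esup>\<close>, which uses
\<open>\<theta> < 1\<close>.\<close>

lemma wsemisq_le_wnormsq_deriv_order_gt_half:
  fixes b \<theta> :: real
  assumes \<theta>: "1/2 < \<theta>" "\<theta> < 1"
  obtains C :: real where "0 \<le> C"
    "\<And>g G h. eqJ g G \<Longrightarrow> J_primitive G h \<Longrightarrow> h \<in> borel_measurable borel \<Longrightarrow>
      wsemisq b \<theta> g \<le> ennreal C * wnormsq (b + 2 - 2 * \<theta>) h"
proof -
  define C1 where "C1 = 2 / (2 * \<theta> - 1)"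
  define C where "C = 2 powr \<bar>b\<bar> * C1 * (2 / (2 - 2 * \<theta>))"
  have C1: "0 \<le> C1" using \<theta> by (simp add: C1_def)
  have C: "0 \<le> C" using \<theta> C1 by (simp add: C_def)
  have "wsemisq b \<theta> g \<le> ennreal C * wnormsq (b + 2 - 2 * \<theta>) h"
    if eq: "eqJ g G" and P: "J_primitive G h" and [measurable]: "h \<in> borel_measurable borel" for g G h
  proof -
    (* What remains of the region after y has been forgotten: a neighbourhood of u of size comparable to u. *)
    define near where "near x u \<longleftrightarrow> 0 < u \<and> u < 3/4 \<and> u / 2 \<le> x \<and> x \<le> 2 * u \<and> \<bar>x - u\<bar> \<le> u" for x u :: real
    let ?Q = "\<lambda>x u. if near x u then ennreal (x powr b) * ennreal ((h u)\<^sup>2) else 0"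
    let ?R = "\<lambda>x y u. ennreal (\<bar>y - x\<bar> powr (- (2 * \<theta>))) * (if \<bar>x - u\<bar> \<le> \<bar>y - x\<bar> then 1 else 0)"
    have R_eq: "?R x y u = ennreal (\<bar>y - x\<bar> powr (- (2 * \<theta>))) * indicator {\<bar>x - u\<bar>..} \<bar>y - x\<bar>" for x y u
      by simp
    have [measurable]: "Measurable.pred (borel \<Otimes>\<^sub>M borel) (\<lambda>z. near (fst z) (snd z))"
      unfolding near_def by measurable
    have pt: "ennreal (x powr b * ((g x - g y)\<^sup>2 / \<bar>x - y\<bar> powr (1 + 2 * \<theta>))) * indicator near_diag (x, y)
        \<le> (\<integral>\<^sup>+u. ?Q x u * ?R x y u \<partial>lborel)"
      if gx: "x \<in> J \<longrightarrow> g x = G x" and gy: "y \<in> J \<longrightarrow> g y = G y" for x y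
    proof (cases "(x, y) \<in> near_diag \<and> x \<noteq> y")
      case True
      then have R: "(x, y) \<in> near_diag" and ne: "x \<noteq> y" by auto
      note xy = near_diagD[OF R]
      define d where "d = \<bar>x - y\<bar>"
      have d: "0 < d" using ne by (simp add: d_def)
      have dd: "d / d powr (1 + 2 * \<theta>) = d powr (- (2 * \<theta>))"
        using d by (simp add: powr_add powr_minus field_simps)
      have "ennreal (x powr b * ((g x - g y)\<^sup>2 / d powr (1 + 2 * \<theta>)))
         = ennreal (x powr b / d powr (1 + 2 * \<theta>)) * ennreal ((G x - G y)\<^sup>2)"
        using gx gy xy by (simp add: ennreal_mult' [symmetric])
      also have "\<dots> \<le> ennreal (x powr b / d powr (1 + 2 * \<theta>)) * (ennreal d * (\<integral>\<^sup>+u. ennreal ((h u)\<^sup>2) * indicator {min x y<..max x y} u \<partial>lborel))"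
        unfolding d_def by (intro mult_left_mono increment_sq_bound[OF P]) (use xy in auto)
      also have "\<dots> = ennreal (x powr b * d powr (- (2 * \<theta>))) * (\<integral>\<^sup>+u. ennreal ((h u)\<^sup>2) * indicator {min x y<..max x y} u \<partial>lborel)"
        using d by (simp add: mult.assoc[symmetric] ennreal_mult'' [symmetric] flip: dd)
      also have "\<dots> = (\<integral>\<^sup>+u. ennreal (x powr b * d powr (- (2 * \<theta>))) * (ennreal ((h u)\<^sup>2) * indicator {min x y<..max x y} u) \<partial>lborel)"
        by (rule nn_integral_cmult[symmetric]) measurable
      also have "\<dots> \<le> (\<integral>\<^sup>+u. ?Q x u * ?R x y u \<partial>lborel)"
      proof (intro nn_integral_mono)
        fix u :: real
        show "ennreal (x powr b * d powr (- (2 * \<theta>))) * (ennreal ((h u)\<^sup>2) * indicator {min x y<..max x y} u) \<le> ?Q x u * ?R x y u"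
        proof (cases "u \<in> {min x y<..max x y}")
          case True
          have "near x u" "\<bar>x - u\<bar> \<le> \<bar>y - x\<bar>"
            using True xy unfolding near_def by (auto simp: min_def max_def abs_if split: if_splits)
          then show ?thesis using True
            by (simp add: ennreal_mult' d_def abs_minus_commute mult_ac)
        qed simp
      qed
      finally show ?thesis using R by (simp add: d_def)
    qed (auto simp: indicator_def)
    have "wsemisq b \<theta> g \<le> (\<integral>\<^sup>+x. \<integral>\<^sup>+y. \<integral>\<^sup>+u. ?Q x u * ?R x y u \<partial>lborel \<partial>lborel \<partial>lborel)"
      unfolding wsemisq_def
    proof (rule nn_integral_mono_AE, rule eventually_mono[OF eq])
      fix x assume "x \<in> J \<longrightarrow> g x = G x"
      then show "(\<integral>\<^sup>+y. ennreal (x powr b * ((g x - g y)\<^sup>2 / \<bar>x - y\<bar> powr (1 + 2 * \<theta>))) * indicator near_diag (x, y) \<partial>lborel)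
          \<le> (\<integral>\<^sup>+y. \<integral>\<^sup>+u. ?Q x u * ?R x y u \<partial>lborel \<partial>lborel)"
        by (intro nn_integral_mono_AE eventually_mono[OF eq] pt)
    qed
    also have "\<dots> = (\<integral>\<^sup>+x. \<integral>\<^sup>+u. \<integral>\<^sup>+y. ?Q x u * ?R x y u \<partial>lborel \<partial>lborel \<partial>lborel)"
    proof (rule nn_integral_cong, rule lborel_pair.Fubini')
      fix x :: real
      have [measurable]: "Measurable.pred borel (near x)" unfolding near_def by measurable
      show "(\<lambda>(u, y). ?Q x u * ?R x y u) \<in> borel_measurable (lborel \<Otimes>\<^sub>M lborel)"
        by measurable
    qed
    also have "\<dots> = (\<integral>\<^sup>+x. \<integral>\<^sup>+u. ?Q x u * (\<integral>\<^sup>+y. ?R x y u \<partial>lborel) \<partial>lborel \<partial>lborel)"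
      by (intro nn_integral_cong nn_integral_cmult) measurable
    also have "\<dots> = (\<integral>\<^sup>+u. \<integral>\<^sup>+x. ?Q x u * (\<integral>\<^sup>+y. ?R x y u \<partial>lborel) \<partial>lborel \<partial>lborel)"
      by (rule lborel_pair.Fubini') (unfold near_def, measurable)
    also have "\<dots> \<le> (\<integral>\<^sup>+u. ennreal C * (ennreal (u powr (b + 2 - 2 * \<theta>) * (h u)\<^sup>2) * indicator J u) \<partial>lborel)"
    proof (intro nn_integral_mono)
      fix u :: real
      show "(\<integral>\<^sup>+x. ?Q x u * (\<integral>\<^sup>+y. ?R x y u \<partial>lborel) \<partial>lborel) \<le> ennreal C * (ennreal (u powr (b + 2 - 2 * \<theta>) * (h u)\<^sup>2) * indicator J u)"
      proof (cases "u \<in> J")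
        case False
        then have "\<not> near x u" for x by (auto simp: near_def J_def)
        then show ?thesis by simp
      next
        case True
        then have u: "0 < u" by (simp add: J_def)
        let ?K = "2 powr \<bar>b\<bar> * u powr b * (h u)\<^sup>2 * C1"
        have K: "0 \<le> ?K" using C1 by simp
        have "(\<integral>\<^sup>+x. ?Q x u * (\<integral>\<^sup>+y. ?R x y u \<partial>lborel) \<partial>lborel)
           \<le> (\<integral>\<^sup>+x. ennreal ?K * (ennreal (\<bar>x - u\<bar> powr (1 - 2 * \<theta>)) * indicator {..u} \<bar>x - u\<bar>) \<partial>lborel)"
        (* For x = u the integral over y diverges, but this is a null set of x. *)
        proof (rule nn_integral_mono_AE, rule eventually_mono[OF AE_lborel_singleton[of u]])
          fix x assume elim: "x \<noteq> u"
          show "?Q x u * (\<integral>\<^sup>+y. ?R x y u \<partial>lborel)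
            \<le> ennreal ?K * (ennreal (\<bar>x - u\<bar> powr (1 - 2 * \<theta>)) * indicator {..u} \<bar>x - u\<bar>)"
          proof (cases "near x u")
            case True
            have "(\<integral>\<^sup>+y. ?R x y u \<partial>lborel) \<le> ennreal (C1 * \<bar>x - u\<bar> powr (1 - 2 * \<theta>))"
              unfolding C1_def R_eq by (rule nn_integral_powr_tail) (use \<theta> elim in auto)
            then have "?Q x u * (\<integral>\<^sup>+y. ?R x y u \<partial>lborel) \<le> (ennreal (x powr b) * ennreal ((h u)\<^sup>2)) * ennreal (C1 * \<bar>x - u\<bar> powr (1 - 2 * \<theta>))"
              using True by (simp add: mult_left_mono)
            also have "\<dots> \<le> (ennreal (2 powr \<bar>b\<bar> * u powr b) * ennreal ((h u)\<^sup>2)) * ennreal (C1 * \<bar>x - u\<bar> powr (1 - 2 * \<theta>))"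
              using True u powr_comparable[of u x b] by (intro mult_right_mono ennreal_leI) (auto simp: near_def)
            also have "\<dots> = ennreal ?K * ennreal (\<bar>x - u\<bar> powr (1 - 2 * \<theta>))"
              using C1 by (simp add: ennreal_mult' mult_ac)
            finally show ?thesis using True by (simp add: near_def)
          qed simp
        qed
        also have "\<dots> = ennreal ?K * (\<integral>\<^sup>+x. ennreal (\<bar>x - u\<bar> powr (1 - 2 * \<theta>)) * indicator {..u} \<bar>x - u\<bar> \<partial>lborel)"
          by (rule nn_integral_cmult) measurable
        also have "\<dots> \<le> ennreal ?K * ennreal (2 / (1 - 2 * \<theta> + 1) * u powr (1 - 2 * \<theta> + 1))"
          by (intro mult_left_mono nn_integral_powr_ball) (use \<theta> u in auto)
        also have "\<dots> = ennreal (?K * (2 / (1 - 2 * \<theta> + 1) * u powr (1 - 2 * \<theta> + 1)))"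
          by (rule ennreal_mult'[OF K, symmetric])
        also have "?K * (2 / (1 - 2 * \<theta> + 1) * u powr (1 - 2 * \<theta> + 1)) = C * ((u powr b * u powr (1 - 2 * \<theta> + 1)) * (h u)\<^sup>2)"
          by (simp add: C_def)
        also have "u powr b * u powr (1 - 2 * \<theta> + 1) = u powr (b + 2 - 2 * \<theta>)"
          by (simp add: powr_add[symmetric] algebra_simps)
        finally show ?thesis using True C by (simp add: ennreal_mult')
      qed
    qed
    also have "\<dots> = ennreal C * wnormsq (b + 2 - 2 * \<theta>) h"
      unfolding wnormsq_def by (rule nn_integral_cmult) measurable
    finally show ?thesis .
  qed
  then show ?thesis by (rule that[OF C])
qed

text \<open>For small \<open>\<theta>\<close> the order is first raised to \<open>3/4\<close>; the weight of the derivative on the right-hand side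
is not affected.\<close>

lemma wsemisq_le_wnormsq_deriv:
  fixes b \<theta> :: real
  assumes \<theta>: "\<theta> < 1"
  obtains C :: real where "0 \<le> C"
    "\<And>g G h. eqJ g G \<Longrightarrow> J_primitive G h \<Longrightarrow> h \<in> borel_measurable borel \<Longrightarrow>
      wsemisq b \<theta> g \<le> ennreal C * wnormsq (b + 2 - 2 * \<theta>) h"
proof -
  define \<theta>' where "\<theta>' = max \<theta> (3/4)"
  have \<theta>': "1/2 < \<theta>'" "\<theta>' < 1" using \<theta> by (auto simp: \<theta>'_def)
  define b' where "b' = b + 2 * (\<theta>' - \<theta>)"
  obtain C where "0 \<le> C" and C: "\<And>g G h. eqJ g G \<Longrightarrow> J_primitive G h \<Longrightarrow> h \<in> borel_measurable borel \<Longrightarrow>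
      wsemisq b' \<theta>' g \<le> ennreal C * wnormsq (b' + 2 - 2 * \<theta>') h"
    using wsemisq_le_wnormsq_deriv_order_gt_half[OF \<theta>', of b'] by metis
  have "b' + 2 - 2 * \<theta>' = b + 2 - 2 * \<theta>" by (simp add: b'_def algebra_simps)
  moreover have "wsemisq b \<theta> g \<le> wsemisq b' \<theta>' g" for g
    by (rule wsemisq_order_mono) (auto simp: b'_def \<theta>'_def)
  ultimately have "wsemisq b \<theta> g \<le> ennreal C * wnormsq (b + 2 - 2 * \<theta>) h"
    if "eqJ g G" "J_primitive G h" "h \<in> borel_measurable borel" for g G h
    using order_trans C[OF that] by metis
  then show ?thesis using \<open>0 \<le> C\<close> by (intro that[of C]) blast+
qed

section \<open>The fractional Hardy inequality\<close>

text \<open>Finiteness of \<open>I\<close> is essential: it allows \<open>ennreal q * I\<close> to be subtracted from both sides.\<close>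

lemma ennreal_absorb:
  fixes I W :: ennreal and q :: real
  assumes "I < top" "I \<le> W + ennreal q * I" "0 \<le> q" "q < 1"
  shows "I \<le> ennreal (1 / (1 - q)) * W"
proof (cases "W = top")
  case True
  then show ?thesis using assms by (simp add: ennreal_mult_top)
next
  case False
  obtain i where i: "0 \<le> i" "I = ennreal i" using assms(1) by (cases I) auto
  obtain w where w: "0 \<le> w" "W = ennreal w" using False by (cases W) auto
  have "ennreal (w + q * i) = ennreal w + ennreal q * ennreal i"
    using assms(3) i w by (simp add: ennreal_mult')
  then have "ennreal i \<le> ennreal (w + q * i)" using assms(2) i w by simp
  moreover have "0 \<le> w + q * i" using i w assms by simp
  ultimately have "i \<le> w + q * i" using ennreal_le_iff by blast
  then have "i \<le> 1 / (1 - q) * w" using assms by (simp add: field_simps)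
  then have "ennreal i \<le> ennreal (1 / (1 - q) * w)" by (rule ennreal_leI)
  also have "\<dots> = ennreal (1 / (1 - q)) * ennreal w" by (rule ennreal_mult') (use assms in simp)
  finally show ?thesis using i w by simp
qed

text \<open>Substituting \<open>y = l x\<close> produces the factor \<open>l\<^bsup>-(a+1)\<^esup>\<close>. The interval from \<open>e\<close> to \<open>1/2\<close> is
mapped into the interval from \<open>e\<close> to \<open>3/4\<close> because \<open>1 < l < 3/2\<close>.\<close>

lemma dilation_bound:
  fixes g :: "real \<Rightarrow> real" and a e l :: real
  assumes [measurable]: "g \<in> borel_measurable borel" and l: "1 < l" "l < 3/2" and e: "0 < e"
  shows "(\<integral>\<^sup>+x\<in>{e<..<1/2}. ennreal (x powr a * (g (l * x))\<^sup>2) \<partial>lborel)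
    \<le> ennreal (l powr (- (a + 1))) * (\<integral>\<^sup>+x\<in>{e<..<3/4}. ennreal (x powr a * (g x)\<^sup>2) \<partial>lborel)"
    (is "?L \<le> _ * ?R")
proof -
  let ?f = "\<lambda>y. ennreal ((y / l) powr a * (g y)\<^sup>2) * indicator {e<..<1/2} (y / l)"
  have "(\<integral>\<^sup>+y. ?f y \<partial>lborel) = \<bar>l\<bar> * (\<integral>\<^sup>+x. ?f (0 + l * x) \<partial>lborel)"
  proof (rule nn_integral_real_affine)
    show "l \<noteq> 0" using l by simp
  qed measurable
  also have "(\<integral>\<^sup>+x. ?f (0 + l * x) \<partial>lborel) = ?L"
    using l by (intro nn_integral_cong) simp
  finally have 1: "ennreal l * ?L = (\<integral>\<^sup>+y. ?f y \<partial>lborel)" using l by simp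
  have "(\<integral>\<^sup>+y. ?f y \<partial>lborel) \<le> (\<integral>\<^sup>+y. ennreal (l powr (- a)) * (ennreal (y powr a * (g y)\<^sup>2) * indicator {e<..<3/4} y) \<partial>lborel)"
  proof (intro nn_integral_mono)
    fix y :: real
    show "?f y \<le> ennreal (l powr (- a)) * (ennreal (y powr a * (g y)\<^sup>2) * indicator {e<..<3/4} y)"
    proof (cases "y / l \<in> {e<..<1/2}")
      case True
      have "e < y / l" "y / l < 1/2" using True by auto
      then have "e * l < y" "y < l / 2" using l by (auto simp: field_simps)
      moreover have "e * 1 < e * l" using e l by (intro mult_strict_left_mono) auto
      ultimately have "e < y" "y < 3/4" using l by linarith+
      then have y: "0 < y" "y \<in> {e<..<3/4}" using e by auto
      have "(y / l) powr a = l powr (- a) * y powr a"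
        using y l by (simp add: powr_divide powr_minus field_simps)
      then have "ennreal ((y / l) powr a * (g y)\<^sup>2) = ennreal (l powr (- a)) * ennreal (y powr a * (g y)\<^sup>2)"
        by (simp add: ennreal_mult' mult.assoc)
      then show ?thesis using True y by simp
    qed simp
  qed
  also have "\<dots> = ennreal (l powr (- a)) * ?R" by (rule nn_integral_cmult) measurable
  finally have 2: "ennreal l * ?L \<le> ennreal (l powr (- a)) * ?R" using 1 by simp
  have "?L = ennreal (1 / l) * (ennreal l * ?L)"
    using l by (simp add: mult.assoc[symmetric] ennreal_mult' [symmetric])
  also have "\<dots> \<le> ennreal (1 / l) * (ennreal (l powr (- a)) * ?R)" by (rule mult_left_mono[OF 2]) simp
  also have "\<dots> = ennreal (1 / l * l powr (- a)) * ?R"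
    using l by (subst ennreal_mult') (auto simp: mult.assoc)
  also have "1 / l * l powr (- a) = l powr (- (a + 1))"
  proof -
    have 1: "1 / l = l powr (- 1)" using l by (simp add: powr_minus field_simps)
    have 2: "l powr (- 1) * l powr (- a) = l powr (- (a + 1))"
      using powr_add[of l "- 1" "- a"] by (simp only: minus_add_distrib add.commute)
    show ?thesis by (simp only: 1 2)
  qed
  finally show ?thesis .
qed

text \<open>For fixed \<open>x\<close> the substitution \<open>y = l x\<close> turns the average over \<open>l\<close> into an integral over part of
the region, with a factor \<open>1/x\<close>. There \<open>|x - y| \<le> x\<close>, hence
\<open>x\<^bsup>a-1\<^esup> \<le> x\<^bsup>a+2\<theta>\<^esup> / |x - y|\<^bsup>1+2\<theta>\<^esup>\<close>. Dilation factors above \<open>5/4\<close> keep a distance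
from the trivial dilation \<open>l = 1\<close>; those below \<open>3/2\<close> stay in the region.\<close>

lemma averaged_dilation_difference:
  fixes g :: "real \<Rightarrow> real" and a \<theta> :: real
  assumes [measurable]: "g \<in> borel_measurable borel" and \<theta>: "0 < \<theta>"
  shows "(\<integral>\<^sup>+l\<in>{5/4<..<3/2}. (\<integral>\<^sup>+x\<in>{0<..<1/2}. ennreal (x powr a * (g x - g (l * x))\<^sup>2) \<partial>lborel) \<partial>lborel)
     \<le> wsemisq (a + 2 * \<theta>) \<theta> g"
proof -
  let ?F = "\<lambda>l x. ennreal (x powr a * (g x - g (l * x))\<^sup>2) * indicator {0<..<1/2} x * indicator {5/4<..<3/2} l"
  have "(\<integral>\<^sup>+l\<in>{5/4<..<3/2}. (\<integral>\<^sup>+x\<in>{0<..<1/2}. ennreal (x powr a * (g x - g (l * x))\<^sup>2) \<partial>lborel) \<partial>lborel)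
    = (\<integral>\<^sup>+l. \<integral>\<^sup>+x. ?F l x \<partial>lborel \<partial>lborel)"
    by (intro nn_integral_cong nn_integral_multc[symmetric]) measurable
  also have "\<dots> = (\<integral>\<^sup>+x. \<integral>\<^sup>+l. ?F l x \<partial>lborel \<partial>lborel)"
    by (rule lborel_pair.Fubini') measurable
  also have "\<dots> \<le> wsemisq (a + 2 * \<theta>) \<theta> g"
    unfolding wsemisq_def
  proof (rule nn_integral_mono)
    fix x :: real
    let ?W = "\<lambda>y. ennreal (x powr (a + 2 * \<theta>) * ((g x - g y)\<^sup>2 / \<bar>x - y\<bar> powr (1 + 2 * \<theta>))) * indicator near_diag (x, y)"
    show "(\<integral>\<^sup>+l. ?F l x \<partial>lborel) \<le> (\<integral>\<^sup>+y. ?W y \<partial>lborel)"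
    proof (cases "x \<in> {0<..<1/2}")
      case True
      then have x: "0 < x" "x < 1/2" by auto
      have [measurable]: "Measurable.pred borel (\<lambda>y. (x, y) \<in> near_diag)" by measurable
      have "?F l x \<le> ennreal x * ?W (0 + x * l)" for l
      proof (cases "l \<in> {5/4<..<3/2}")
        case l: True
        have lx: "x < l * x" "l * x < 3/2 * x" using l x by auto
        have "2/3 * x < l * x" "0 < l * x" "l * x < 3/4" using lx x by linarith+
        moreover have "(x, y) \<in> near_diag" if "2/3 * x < y" "y < 3/2 * x" "0 < y" "y < 3/4" for y
          using that x by (auto simp: near_diag_def Lam_def J_def)
        ultimately have "(x, l * x) \<in> near_diag" using lx(2) by blast
        then have R: "(x, 0 + x * l) \<in> near_diag" by (simp only: mult.commute[of x l] add_0)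
        define d where "d = \<bar>x - l * x\<bar>"
        have d: "0 < d" "d \<le> x" using lx by (auto simp: d_def)
        have "x powr a * d powr (1 + 2 * \<theta>) \<le> x powr a * x powr (1 + 2 * \<theta>)"
          using d \<theta> by (intro mult_left_mono powr_mono2) auto
        also have "\<dots> = x * x powr (a + 2 * \<theta>)"
          using x by (simp add: powr_add)
        finally have "x powr a \<le> x * x powr (a + 2 * \<theta>) / d powr (1 + 2 * \<theta>)"
          using d by (simp add: field_simps)
        then have "x powr a * (g x - g (l * x))\<^sup>2 \<le> x * x powr (a + 2 * \<theta>) / d powr (1 + 2 * \<theta>) * (g x - g (l * x))\<^sup>2"
          by (rule mult_right_mono) simp
        also have "\<dots> = x * (x powr (a + 2 * \<theta>) * ((g x - g (l * x))\<^sup>2 / d powr (1 + 2 * \<theta>)))" by simp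
        finally have "ennreal (x powr a * (g x - g (l * x))\<^sup>2)
          \<le> ennreal (x * (x powr (a + 2 * \<theta>) * ((g x - g (l * x))\<^sup>2 / d powr (1 + 2 * \<theta>))))" by (rule ennreal_leI)
        also have "\<dots> = ennreal x * ennreal (x powr (a + 2 * \<theta>) * ((g x - g (l * x))\<^sup>2 / d powr (1 + 2 * \<theta>)))"
          by (rule ennreal_mult') (use x in simp)
        finally show ?thesis using l True R by (simp add: d_def mult.commute[of x l])
      qed simp
      then have "(\<integral>\<^sup>+l. ?F l x \<partial>lborel) \<le> (\<integral>\<^sup>+l. ennreal x * ?W (0 + x * l) \<partial>lborel)"
        by (intro nn_integral_mono)
      also have "\<dots> = ennreal x * (\<integral>\<^sup>+l. ?W (0 + x * l) \<partial>lborel)"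
        by (rule nn_integral_cmult) measurable
      also have "\<dots> = (\<integral>\<^sup>+y. ?W y \<partial>lborel)"
        using x by (subst nn_integral_real_affine[of ?W x 0]) auto
      finally show ?thesis .
    qed simp
  qed
  finally show ?thesis .
qed

text \<open>Away from \<open>0\<close> all the weights are equivalent.\<close>

lemma truncated_wnormsq_le:
  assumes "0 < e" and [measurable]: "g \<in> borel_measurable borel"
  shows "(\<integral>\<^sup>+x\<in>{e<..<3/4}. ennreal (x powr a * (g x)\<^sup>2) \<partial>lborel) \<le> ennreal (1 + e powr (a - c)) * wnormsq c g"
proof -
  have "(\<integral>\<^sup>+x\<in>{e<..<3/4}. ennreal (x powr a * (g x)\<^sup>2) \<partial>lborel)
     \<le> (\<integral>\<^sup>+x. ennreal (1 + e powr (a - c)) * (ennreal (x powr c * (g x)\<^sup>2) * indicator J x) \<partial>lborel)"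
  proof (intro nn_integral_mono)
    fix x :: real
    show "ennreal (x powr a * (g x)\<^sup>2) * indicator {e<..<3/4} x
      \<le> ennreal (1 + e powr (a - c)) * (ennreal (x powr c * (g x)\<^sup>2) * indicator J x)"
    proof (cases "x \<in> {e<..<3/4}")
      case True
      then have x: "0 < x" "e < x" "x < 3/4" "x \<in> J" using assms by (auto simp: J_def)
      have "x powr (a - c) \<le> 1 + e powr (a - c)"
      proof (cases "a - c \<ge> 0")
        case True
        then have "x powr (a - c) \<le> 1" using x by (intro powr_le1) auto
        then show ?thesis using powr_ge_zero[of e "a - c"] by linarith
      next
        case False
        then have "x powr (a - c) \<le> e powr (a - c)" using x assms by (intro powr_mono2') auto
        then show ?thesis by linarith
      qed
      then have "x powr (a - c) * (x powr c * (g x)\<^sup>2) \<le> (1 + e powr (a - c)) * (x powr c * (g x)\<^sup>2)"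
        by (rule mult_right_mono) simp
      also have "x powr (a - c) * (x powr c * (g x)\<^sup>2) = x powr a * (g x)\<^sup>2"
        by (simp add: mult.assoc[symmetric] flip: powr_add)
      finally have "ennreal (x powr a * (g x)\<^sup>2) \<le> ennreal ((1 + e powr (a - c)) * (x powr c * (g x)\<^sup>2))" by (rule ennreal_leI)
      also have "\<dots> = ennreal (1 + e powr (a - c)) * ennreal (x powr c * (g x)\<^sup>2)"
        by (rule ennreal_mult') simp
      finally show ?thesis using x True by simp
    qed simp
  qed
  also have "\<dots> = ennreal (1 + e powr (a - c)) * wnormsq c g"
    unfolding wnormsq_def by (rule nn_integral_cmult) measurable
  finally show ?thesis .
qed

text \<open>Young's inequality gives \<open>g(x)\<^sup>2 \<le> (1+\<delta>) g(lx)\<^sup>2 + (1+1/\<delta>) (g(x) - g(lx))\<^sup>2\<close>. The first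
term is absorbed and the second one, averaged over \<open>l\<close>, is the semi-norm. The norm with weight
\<open>c\<close> controls the part of \<open>J\<close> that the dilations do not reach, and it makes the integral over
\<open>x > e\<close> finite, as the absorption requires. The bound does not depend on \<open>e\<close>, so \<open>e\<close> can tend to
\<open>0\<close>.\<close>

lemma fractional_hardy:
  fixes a c \<theta> :: real
  assumes a: "a > -1" and \<theta>: "0 < \<theta>"
  obtains C :: real where "0 \<le> C"
    "\<And>g. g \<in> borel_measurable borel \<Longrightarrow> wnormsq a g \<le> ennreal C * (wsemisq (a + 2 * \<theta>) \<theta> g + wnormsq c g)"
proof -
  define r :: real where "r = (5/4) powr (- (a + 1))"
  have r: "0 < r" "r < 1"
  proof -
    have "(5/4) powr (- (a + 1)) < (5/4::real) powr 0" using a by (intro powr_less_mono) auto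
    then show "r < 1" by (simp add: r_def)
  qed (simp add: r_def)
  (* Chosen so that the absorbed factor q is the mean of r and 1. *)
  define \<delta> where "\<delta> = (1 - r) / (2 * r)"
  have \<delta>: "0 < \<delta>" using r by (simp add: \<delta>_def)
  define q where "q = (1 + \<delta>) * r"
  have "q = (1 + r) / 2" using r by (simp add: q_def \<delta>_def field_simps)
  then have q: "0 \<le> q" "q < 1" using r by auto
  define D where "D = 1 + 1 / \<delta>"
  have D: "0 \<le> D" using \<delta> by (simp add: D_def)
  define k where "k = 1 + (1/4) powr (a - c)"
  have k: "0 < k" unfolding k_def using powr_ge_zero[of "1/4" "a - c"] by linarith
  define C where "C = 1 / (1 - q) * (k + 4 * D)"
  have C: "0 < C" using q k D by (simp add: C_def add_pos_nonneg)
  have young: "u\<^sup>2 \<le> (1 + \<delta>) * v\<^sup>2 + D * (u - v)\<^sup>2" for u v :: real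
  proof -
    define w where "w = u - v"
    have "0 \<le> (\<delta> * v - w)\<^sup>2 / \<delta>" using \<delta> by simp
    also have "(\<delta> * v - w)\<^sup>2 / \<delta> = \<delta> * v\<^sup>2 - 2 * v * w + w\<^sup>2 / \<delta>"
      using \<delta> by (simp add: power2_eq_square field_simps)
    finally have "(v + w)\<^sup>2 \<le> (1 + \<delta>) * v\<^sup>2 + (1 + 1 / \<delta>) * w\<^sup>2"
      by (simp add: power2_eq_square algebra_simps)
    then show ?thesis by (simp add: w_def D_def)
  qed
  have main: "wnormsq a g \<le> ennreal C * (wsemisq (a + 2 * \<theta>) \<theta> g + wnormsq c g)"
    if [measurable]: "g \<in> borel_measurable borel" for g
  proof (cases "wnormsq c g = top")
    case True then show ?thesis using C by (simp add: ennreal_mult_top)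
  next
    case False
    let ?S = "wsemisq (a + 2 * \<theta>) \<theta> g"
    let ?I = "\<lambda>e. \<integral>\<^sup>+x\<in>{e<..<3/4}. ennreal (x powr a * (g x)\<^sup>2) \<partial>lborel"
    let ?E = "\<lambda>l. \<integral>\<^sup>+x\<in>{0<..<1/2}. ennreal (x powr a * (g x - g (l * x))\<^sup>2) \<partial>lborel"
    have step: "?I e \<le> ennreal C * (?S + wnormsq c g)" if e: "0 < e" for e
    proof -
      have fin: "?I e < top"
        using truncated_wnormsq_le[OF e, of g a c] False
        by (simp add: ennreal_mult_less_top less_top order_le_less_trans)
      (* The dilation acts on x < 1/2; the part x >= 1/2 goes into the integral over x > 1/4. *)
      have each: "?I e \<le> ?I (1/4) + ennreal q * ?I e + ennreal D * ?E l" if l: "l \<in> {5/4<..<3/2}" for l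
      proof -
        have "?I e \<le> (\<integral>\<^sup>+x. ennreal (x powr a * (g x)\<^sup>2) * indicator {1/4<..<3/4} x
            + (ennreal (1 + \<delta>) * (ennreal (x powr a * (g (l * x))\<^sup>2) * indicator {e<..<1/2} x)
            + ennreal D * (ennreal (x powr a * (g x - g (l * x))\<^sup>2) * indicator {0<..<1/2} x)) \<partial>lborel)"
        proof (intro nn_integral_mono)
          fix x :: real
          have "x powr a * (g x)\<^sup>2 \<le> x powr a * ((1 + \<delta>) * (g (l * x))\<^sup>2 + D * (g x - g (l * x))\<^sup>2)"
            by (intro mult_left_mono young) simp
          then have "ennreal (x powr a * (g x)\<^sup>2) \<le> ennreal ((1 + \<delta>) * (x powr a * (g (l * x))\<^sup>2) + D * (x powr a * (g x - g (l * x))\<^sup>2))"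
            by (intro ennreal_leI) (simp add: algebra_simps)
          also have "\<dots> = ennreal ((1 + \<delta>) * (x powr a * (g (l * x))\<^sup>2)) + ennreal (D * (x powr a * (g x - g (l * x))\<^sup>2))"
            by (rule ennreal_plus) (use \<delta> D in auto)
          also have "\<dots> = ennreal (1 + \<delta>) * ennreal (x powr a * (g (l * x))\<^sup>2) + ennreal D * ennreal (x powr a * (g x - g (l * x))\<^sup>2)"
            using \<delta> D by (subst (1 2) ennreal_mult') auto
          finally show "ennreal (x powr a * (g x)\<^sup>2) * indicator {e<..<3/4} x
            \<le> ennreal (x powr a * (g x)\<^sup>2) * indicator {1/4<..<3/4} x
            + (ennreal (1 + \<delta>) * (ennreal (x powr a * (g (l * x))\<^sup>2) * indicator {e<..<1/2} x)
            + ennreal D * (ennreal (x powr a * (g x - g (l * x))\<^sup>2) * indicator {0<..<1/2} x))"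
            using e by (auto simp: indicator_def)
        qed
        also have "\<dots> = ?I (1/4) + (ennreal (1 + \<delta>) * (\<integral>\<^sup>+x\<in>{e<..<1/2}. ennreal (x powr a * (g (l * x))\<^sup>2) \<partial>lborel) + ennreal D * ?E l)"
          by (simp add: nn_integral_add nn_integral_cmult)
        also have "\<dots> \<le> ?I (1/4) + (ennreal (1 + \<delta>) * (ennreal r * ?I e) + ennreal D * ?E l)"
        proof (intro add_left_mono add_right_mono mult_left_mono)
          have "(\<integral>\<^sup>+x\<in>{e<..<1/2}. ennreal (x powr a * (g (l * x))\<^sup>2) \<partial>lborel) \<le> ennreal (l powr (- (a + 1))) * ?I e"
            by (rule dilation_bound) (use l e in auto)
          also have "\<dots> \<le> ennreal r * ?I e"
            unfolding r_def using l a by (intro mult_right_mono ennreal_leI powr_mono2') auto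
          finally show "(\<integral>\<^sup>+x\<in>{e<..<1/2}. ennreal (x powr a * (g (l * x))\<^sup>2) \<partial>lborel) \<le> ennreal r * ?I e" .
        qed auto
        also have "ennreal (1 + \<delta>) * (ennreal r * ?I e) = ennreal q * ?I e"
          using \<delta> by (simp only: mult.assoc[symmetric] q_def) (subst ennreal_mult', auto)
        finally show ?thesis by (simp only: add.assoc)
      qed
      let ?L = "{5/4<..<3/2::real}"
      (* The interval of dilation factors has length 1/4. *)
      have avg: "ennreal 4 * (\<integral>\<^sup>+l\<in>?L. X \<partial>lborel) = X" for X :: ennreal
      proof -
        have "(\<integral>\<^sup>+l\<in>?L. X \<partial>lborel) = X * ennreal (1/4)" by (subst nn_integral_cmult) auto
        then have "ennreal 4 * (\<integral>\<^sup>+l\<in>?L. X \<partial>lborel) = X * (ennreal 4 * ennreal (1/4))"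
          by (simp only: mult_ac)
        also have "ennreal 4 * ennreal (1/4) = ennreal (4 * (1/4))" by (rule ennreal_mult'[symmetric]) simp
        finally show ?thesis by simp
      qed
      have "(\<integral>\<^sup>+l\<in>?L. ?I e \<partial>lborel) \<le> (\<integral>\<^sup>+l. (?I (1/4) + ennreal q * ?I e) * indicator ?L l + ennreal D * (?E l * indicator ?L l) \<partial>lborel)"
      proof (intro nn_integral_mono)
        fix l :: real
        show "?I e * indicator ?L l \<le> (?I (1/4) + ennreal q * ?I e) * indicator ?L l + ennreal D * (?E l * indicator ?L l)"
          using each[of l] by (cases "l \<in> ?L") simp_all
      qed
      also have "\<dots> = (\<integral>\<^sup>+l\<in>?L. (?I (1/4) + ennreal q * ?I e) \<partial>lborel) + ennreal D * (\<integral>\<^sup>+l\<in>?L. ?E l \<partial>lborel)"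
        by (subst nn_integral_add, measurable, subst nn_integral_cmult, measurable)
      also have "\<dots> \<le> (\<integral>\<^sup>+l\<in>?L. (?I (1/4) + ennreal q * ?I e) \<partial>lborel) + ennreal D * ?S"
        by (intro add_left_mono mult_left_mono averaged_dilation_difference \<theta>) auto
      finally have "ennreal 4 * (\<integral>\<^sup>+l\<in>?L. ?I e \<partial>lborel)
         \<le> ennreal 4 * ((\<integral>\<^sup>+l\<in>?L. (?I (1/4) + ennreal q * ?I e) \<partial>lborel) + ennreal D * ?S)"
        by (rule mult_left_mono) simp
      then have "?I e \<le> (?I (1/4) + ennreal q * ?I e) + ennreal 4 * (ennreal D * ?S)"
        by (simp only: distrib_left avg)
      then have "?I e \<le> (?I (1/4) + ennreal 4 * (ennreal D * ?S)) + ennreal q * ?I e"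
        by (simp only: add_ac)
      from ennreal_absorb[OF fin this q]
      have "?I e \<le> ennreal (1 / (1 - q)) * (?I (1/4) + ennreal 4 * (ennreal D * ?S))" .
      also have "\<dots> \<le> ennreal (1 / (1 - q)) * (ennreal k * wnormsq c g + ennreal 4 * (ennreal D * ?S))"
        unfolding k_def by (intro mult_left_mono add_right_mono truncated_wnormsq_le) auto
      also have "\<dots> \<le> ennreal (1 / (1 - q)) * (ennreal (k + 4 * D) * wnormsq c g + ennreal (k + 4 * D) * ?S)"
      proof (intro mult_left_mono add_mono)
        show "ennreal k * wnormsq c g \<le> ennreal (k + 4 * D) * wnormsq c g"
          using D by (intro mult_right_mono ennreal_leI) auto
        have "ennreal 4 * (ennreal D * ?S) = ennreal (4 * D) * ?S" by (simp add: ennreal_mult' mult.assoc)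
        also have "\<dots> \<le> ennreal (k + 4 * D) * ?S" using k by (intro mult_right_mono ennreal_leI) auto
        finally show "ennreal 4 * (ennreal D * ?S) \<le> ennreal (k + 4 * D) * ?S" .
      qed auto
      also have "\<dots> = ennreal (1 / (1 - q)) * ennreal (k + 4 * D) * (?S + wnormsq c g)"
        by (simp only: distrib_left mult.assoc add.commute)
      also have "ennreal (1 / (1 - q)) * ennreal (k + 4 * D) = ennreal C"
        unfolding C_def using q by (intro ennreal_mult'[symmetric]) auto
      finally show ?thesis .
    qed
    let ?f = "\<lambda>(n::nat) x. ennreal (x powr a * (g x)\<^sup>2) * indicator {1 / real (Suc n)<..<3/4} x"
    have "wnormsq a g \<le> (\<integral>\<^sup>+x. (SUP n. ?f n x) \<partial>lborel)"
      unfolding wnormsq_def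
    proof (intro nn_integral_mono)
      fix x :: real
      show "ennreal (x powr a * (g x)\<^sup>2) * indicator J x \<le> (SUP n. ?f n x)"
      proof (cases "x \<in> J")
        case True
        then have x: "0 < x" "x < 3/4" by (auto simp: J_def)
        obtain n :: nat where "1 / real (Suc n) < x" using nat_approx_posE[OF x(1)] by metis
        then have "ennreal (x powr a * (g x)\<^sup>2) * indicator J x = ?f n x" using x True by simp
        also have "\<dots> \<le> (SUP n. ?f n x)" by (rule SUP_upper) simp
        finally show ?thesis .
      qed simp
    qed
    also have "\<dots> = (SUP n. \<integral>\<^sup>+x. ?f n x \<partial>lborel)"
    proof (rule nn_integral_monotone_convergence_SUP)
      show "incseq ?f"
      proof (rule incseq_SucI, rule le_funI)
        fix n and x :: real
        have "1 / real (Suc (Suc n)) \<le> 1 / real (Suc n)" by (simp add: frac_le)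
        then show "?f n x \<le> ?f (Suc n) x" by (intro mult_left_mono) (auto simp: indicator_def)
      qed
    qed measurable
    also have "\<dots> \<le> ennreal C * (?S + wnormsq c g)"
      by (intro SUP_least step) simp
    finally show ?thesis .
  qed
  show ?thesis by (rule that[OF less_imp_le[OF C] main])
qed

section \<open>Bounds that are uniform over a family of functions\<close>

text \<open>The constant \<open>C\<close> of the theorem must be independent of \<open>\<psi>\<close>. Carrying it through each step
is avoided by composing this relation, in which the constant is chosen before the element of \<open>A\<close>.\<close>

definition dominated :: "'a set \<Rightarrow> ('a \<Rightarrow> ennreal) \<Rightarrow> ('a \<Rightarrow> ennreal) \<Rightarrow> bool" where
  "dominated A F G \<longleftrightarrow> (\<exists>C::real. 0 \<le> C \<and> (\<forall>x\<in>A. F x \<le> ennreal C * G x))"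

lemma dominatedI: "0 \<le> C \<Longrightarrow> (\<And>x. x \<in> A \<Longrightarrow> F x \<le> ennreal C * G x) \<Longrightarrow> dominated A F G"
  unfolding dominated_def by blast

lemma dominated_mono: "(\<And>x. x \<in> A \<Longrightarrow> F x \<le> G x) \<Longrightarrow> dominated A F G"
  by (rule dominatedI[of 1]) auto

lemma dominated_trans:
  assumes "dominated A F G" "dominated A G H" shows "dominated A F H"
proof -
  obtain C where C: "0 \<le> C" "\<And>x. x \<in> A \<Longrightarrow> F x \<le> ennreal C * G x" using assms(1) unfolding dominated_def by blast
  obtain D where D: "0 \<le> D" "\<And>x. x \<in> A \<Longrightarrow> G x \<le> ennreal D * H x" using assms(2) unfolding dominated_def by blast
  show ?thesis
  proof (rule dominatedI[of "C * D"])
    fix x assume x: "x \<in> A"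
    have "F x \<le> ennreal C * (ennreal D * H x)"
      using C(2)[OF x] mult_left_mono[OF D(2)[OF x], of "ennreal C"] by (rule order_trans) simp
    then show "F x \<le> ennreal (C * D) * H x" using C by (simp add: ennreal_mult' mult.assoc)
  qed (use C D in simp)
qed

lemma dominated_add:
  assumes "dominated A F H" "dominated A G H" shows "dominated A (\<lambda>x. F x + G x) H"
proof -
  obtain C where C: "0 \<le> C" "\<And>x. x \<in> A \<Longrightarrow> F x \<le> ennreal C * H x" using assms(1) unfolding dominated_def by blast
  obtain D where D: "0 \<le> D" "\<And>x. x \<in> A \<Longrightarrow> G x \<le> ennreal D * H x" using assms(2) unfolding dominated_def by blast
  show ?thesis
  proof (rule dominatedI[of "C + D"])
    fix x assume x: "x \<in> A"
    show "F x + G x \<le> ennreal (C + D) * H x"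
      using add_mono[OF C(2)[OF x] D(2)[OF x]] C D by (simp add: distrib_right)
  qed (use C D in simp)
qed

lemma dominated_cmult:
  assumes "dominated A F H" "0 \<le> c" shows "dominated A (\<lambda>x. ennreal c * F x) H"
  by (rule dominated_trans[OF _ assms(1)], rule dominatedI[OF assms(2)]) simp

lemma dominated_zero: "dominated A (\<lambda>x. 0) H"
  by (rule dominatedI[of 0]) auto

lemma dominated_sum:
  assumes "finite I" "\<And>i. i \<in> I \<Longrightarrow> dominated A (F i) H" shows "dominated A (\<lambda>x. \<Sum>i\<in>I. F i x) H"
  using assms
proof (induction I rule: finite_induct)
  case (insert i I)
  have "dominated A (\<lambda>x. F i x + (\<Sum>i\<in>I. F i x)) H" using insert by (intro dominated_add) auto
  then show ?case using insert by simp
qed (simp add: dominated_zero)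

text \<open>A finite sum of squares costs the factor \<open>card I\<close>, by Cauchy-Schwarz.\<close>

lemma wnormsq_lincomb:
  assumes I: "finite I" and [measurable]: "\<And>i. i \<in> I \<Longrightarrow> f i \<in> borel_measurable borel"
  shows "wnormsq a (\<lambda>x. \<Sum>i\<in>I. c i * f i x) \<le> (\<Sum>i\<in>I. ennreal (real (card I) * (c i)\<^sup>2) * wnormsq a (f i))"
proof -
  have "wnormsq a (\<lambda>x. \<Sum>i\<in>I. c i * f i x)
    \<le> (\<integral>\<^sup>+x. (\<Sum>i\<in>I. ennreal (real (card I) * (c i)\<^sup>2) * (ennreal (x powr a * (f i x)\<^sup>2) * indicator J x)) \<partial>lborel)"
    unfolding wnormsq_def
  proof (intro nn_integral_mono)
    fix x :: real
    have "x powr a * (\<Sum>i\<in>I. c i * f i x)\<^sup>2 \<le> x powr a * ((\<Sum>i\<in>I. (c i * f i x)\<^sup>2) * real (card I))"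
      by (intro mult_left_mono sum_squared_le_sum_of_squares I) auto
    also have "\<dots> = (\<Sum>i\<in>I. real (card I) * (c i)\<^sup>2 * (x powr a * (f i x)\<^sup>2))"
      by (simp add: sum_distrib_left sum_distrib_right power_mult_distrib mult_ac)
    finally have "ennreal (x powr a * (\<Sum>i\<in>I. c i * f i x)\<^sup>2) \<le> ennreal (\<Sum>i\<in>I. real (card I) * (c i)\<^sup>2 * (x powr a * (f i x)\<^sup>2))"
      by (rule ennreal_leI)
    also have "\<dots> = (\<Sum>i\<in>I. ennreal (real (card I) * (c i)\<^sup>2 * (x powr a * (f i x)\<^sup>2)))"
      by (rule sum_ennreal[symmetric]) simp
    also have "\<dots> = (\<Sum>i\<in>I. ennreal (real (card I) * (c i)\<^sup>2) * ennreal (x powr a * (f i x)\<^sup>2))"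
      by (intro sum.cong refl ennreal_mult') simp
    finally show "ennreal (x powr a * (\<Sum>i\<in>I. c i * f i x)\<^sup>2) * indicator J x
      \<le> (\<Sum>i\<in>I. ennreal (real (card I) * (c i)\<^sup>2) * (ennreal (x powr a * (f i x)\<^sup>2) * indicator J x))"
      by (cases "x \<in> J") simp_all
  qed
  also have "\<dots> = (\<Sum>i\<in>I. ennreal (real (card I) * (c i)\<^sup>2) * wnormsq a (f i))"
    unfolding wnormsq_def by (subst nn_integral_sum) (auto intro!: sum.cong nn_integral_cmult)
  finally show ?thesis .
qed

lemma wsemisq_lincomb:
  assumes I: "finite I" and [measurable]: "\<And>i. i \<in> I \<Longrightarrow> f i \<in> borel_measurable borel"
  shows "wsemisq b \<theta> (\<lambda>x. \<Sum>i\<in>I. c i * f i x) \<le> (\<Sum>i\<in>I. ennreal (real (card I) * (c i)\<^sup>2) * wsemisq b \<theta> (f i))"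
proof -
  let ?k = "\<lambda>x y. x powr b / \<bar>x - y\<bar> powr (1 + 2 * \<theta>)"
  let ?t = "\<lambda>i x y. ennreal (x powr b * ((f i x - f i y)\<^sup>2 / \<bar>x - y\<bar> powr (1 + 2 * \<theta>))) * indicator near_diag (x, y)"
  let ?c = "\<lambda>i. ennreal (real (card I) * (c i)\<^sup>2)"
  have "wsemisq b \<theta> (\<lambda>x. \<Sum>i\<in>I. c i * f i x) \<le> (\<integral>\<^sup>+x. \<integral>\<^sup>+y. (\<Sum>i\<in>I. ?c i * ?t i x y) \<partial>lborel \<partial>lborel)"
    unfolding wsemisq_def
  proof (intro nn_integral_mono)
    fix x y :: real
    have "(\<Sum>i\<in>I. c i * f i x) - (\<Sum>i\<in>I. c i * f i y) = (\<Sum>i\<in>I. c i * (f i x - f i y))"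
      by (simp add: sum_subtractf right_diff_distrib)
    then have "?k x y * ((\<Sum>i\<in>I. c i * f i x) - (\<Sum>i\<in>I. c i * f i y))\<^sup>2
       \<le> ?k x y * ((\<Sum>i\<in>I. (c i * (f i x - f i y))\<^sup>2) * real (card I))"
      by (simp only:) (intro mult_left_mono sum_squared_le_sum_of_squares I, simp)
    also have "\<dots> = (\<Sum>i\<in>I. real (card I) * (c i)\<^sup>2 * (?k x y * (f i x - f i y)\<^sup>2))"
      by (simp add: sum_distrib_left sum_distrib_right power_mult_distrib mult_ac)
    finally have "ennreal (?k x y * ((\<Sum>i\<in>I. c i * f i x) - (\<Sum>i\<in>I. c i * f i y))\<^sup>2)
      \<le> ennreal (\<Sum>i\<in>I. real (card I) * (c i)\<^sup>2 * (?k x y * (f i x - f i y)\<^sup>2))"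
      by (rule ennreal_leI)
    also have "\<dots> = (\<Sum>i\<in>I. ennreal (real (card I) * (c i)\<^sup>2 * (?k x y * (f i x - f i y)\<^sup>2)))"
      by (rule sum_ennreal[symmetric]) simp
    also have "\<dots> = (\<Sum>i\<in>I. ?c i * ennreal (?k x y * (f i x - f i y)\<^sup>2))"
      by (intro sum.cong refl ennreal_mult') simp
    finally show "ennreal (x powr b * (((\<Sum>i\<in>I. c i * f i x) - (\<Sum>i\<in>I. c i * f i y))\<^sup>2 / \<bar>x - y\<bar> powr (1 + 2 * \<theta>))) * indicator near_diag (x, y)
      \<le> (\<Sum>i\<in>I. ?c i * ?t i x y)"
      by (cases "(x, y) \<in> near_diag") simp_all
  qed
  also have "\<dots> = (\<integral>\<^sup>+x. (\<Sum>i\<in>I. ?c i * (\<integral>\<^sup>+y. ?t i x y \<partial>lborel)) \<partial>lborel)"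
    by (intro nn_integral_cong, subst nn_integral_sum) (auto intro!: sum.cong nn_integral_cmult)
  also have "\<dots> = (\<Sum>i\<in>I. ?c i * wsemisq b \<theta> (f i))"
    unfolding wsemisq_def by (subst nn_integral_sum) (auto intro!: sum.cong nn_integral_cmult)
  finally show ?thesis .
qed

lemma wnormsq_powr_mult: "wnormsq a (\<lambda>x. x powr r * g x) = wnormsq (a + 2 * r) g"
  unfolding wnormsq_def
proof (intro nn_integral_cong)
  fix x :: real
  have "x powr a * (x powr r * g x)\<^sup>2 = x powr (a + 2 * r) * (g x)\<^sup>2"
  proof -
    have "(x powr r)\<^sup>2 = x powr (2 * r)" by (simp add: power2_eq_square flip: powr_add)
    then show ?thesis by (simp add: power_mult_distrib powr_add mult.assoc)
  qed
  then show "ennreal (x powr a * (x powr r * g x)\<^sup>2) * indicator J x = ennreal (x powr (a + 2 * r) * (g x)\<^sup>2) * indicator J x"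
    by simp
qed

section \<open>Estimates along a chain of derivatives\<close>

definition deriv_chain :: "nat \<Rightarrow> (nat \<Rightarrow> real \<Rightarrow> real) \<Rightarrow> bool" where
  "deriv_chain K g \<longleftrightarrow> (\<forall>i\<le>K. locint (g i)) \<and> (\<forall>i<K. weak_D (g i) (g (Suc i)))"

lemma deriv_chain_measurable: "deriv_chain K g \<Longrightarrow> i \<le> K \<Longrightarrow> g i \<in> borel_measurable borel"
  by (auto simp: deriv_chain_def intro: locint_measurable)

lemma dominated_fractional_hardy:
  assumes "a > -1" "0 < \<theta>" "i \<le> K"
    and "dominated {g. deriv_chain K g} (\<lambda>g. wsemisq (a + 2 * \<theta>) \<theta> (g i)) H"
    and "dominated {g. deriv_chain K g} (\<lambda>g. wnormsq c (g i)) H"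
  shows "dominated {g. deriv_chain K g} (\<lambda>g. wnormsq a (g i)) H"
proof -
  obtain C where "0 \<le> C" and C: "\<And>g. g \<in> borel_measurable borel \<Longrightarrow> wnormsq a g \<le> ennreal C * (wsemisq (a + 2 * \<theta>) \<theta> g + wnormsq c g)"
    using fractional_hardy[OF assms(1,2)] by metis
  have "dominated {g. deriv_chain K g} (\<lambda>g. wnormsq a (g i)) (\<lambda>g. wsemisq (a + 2 * \<theta>) \<theta> (g i) + wnormsq c (g i))"
    by (rule dominatedI[OF \<open>0 \<le> C\<close>]) (use assms(3) in \<open>auto intro!: C deriv_chain_measurable\<close>)
  then show ?thesis by (rule dominated_trans[OF _ dominated_add[OF assms(4,5)]])
qed

lemma dominated_wsemisq_by_deriv:
  assumes "\<theta> < 1" "i < K"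
    and "dominated {g. deriv_chain K g} (\<lambda>g. wnormsq (b + 2 - 2 * \<theta>) (g (Suc i))) H"
  shows "dominated {g. deriv_chain K g} (\<lambda>g. wsemisq b \<theta> (g i)) H"
proof -
  obtain C where "0 \<le> C" and C: "\<And>g G h. eqJ g G \<Longrightarrow> J_primitive G h \<Longrightarrow> h \<in> borel_measurable borel \<Longrightarrow>
      wsemisq b \<theta> g \<le> ennreal C * wnormsq (b + 2 - 2 * \<theta>) h"
    using wsemisq_le_wnormsq_deriv[OF assms(1)] by metis
  have "dominated {g. deriv_chain K g} (\<lambda>g. wsemisq b \<theta> (g i)) (\<lambda>g. wnormsq (b + 2 - 2 * \<theta>) (g (Suc i)))"
  proof (rule dominatedI[OF \<open>0 \<le> C\<close>])
    fix g assume "g \<in> {g. deriv_chain K g}"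
    then have g: "deriv_chain K g" by simp
    then have "weak_D (g i) (g (Suc i))" using assms(2) by (simp add: deriv_chain_def)
    then obtain G where "eqJ (g i) G" "J_primitive G (g (Suc i))"
      by (rule weak_D_FTC) (auto simp: J_primitive_def)
    then show "wsemisq b \<theta> (g i) \<le> ennreal C * wnormsq (b + 2 - 2 * \<theta>) (g (Suc i))"
      using assms(2) by (intro C deriv_chain_measurable[OF g]) auto
  qed
  then show ?thesis by (rule dominated_trans[OF _ assms(3)])
qed

text \<open>One step of Hardy's inequality raises the order of the derivative by one and the exponent by two. It is
the fractional inequality of order \<open>1/2\<close>, followed by the bound of that semi-norm by the
derivative. The norms with weights \<open>c\<close> provide the control away from \<open>0\<close>.\<close>

lemma dominated_iterated_hardy:
  assumes a: "a > -1" and im: "i \<le> m" and mK: "m \<le> K"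
    and base: "dominated {g. deriv_chain K g} (\<lambda>g. wnormsq (a + 2 * real m) (g m)) H"
    and ctrl: "\<And>j. j \<le> K \<Longrightarrow> dominated {g. deriv_chain K g} (\<lambda>g. wnormsq (c j) (g j)) H"
  shows "dominated {g. deriv_chain K g} (\<lambda>g. wnormsq (a + 2 * real i) (g i)) H"
  using im
proof (induction i rule: inc_induct)
  case base then show ?case by (rule assms(4))
next
  case (step n)
  show ?case
  proof (rule dominated_fractional_hardy[where \<theta>="1/2" and c="c n"])
    show "dominated {g. deriv_chain K g} (\<lambda>g. wsemisq (a + 2 * real n + 2 * (1/2)) (1/2) (g n)) H"
    proof (rule dominated_wsemisq_by_deriv)
      have "a + 2 * real n + 2 * (1/2) + 2 - 2 * (1/2) = a + 2 * real (Suc n)" by simp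
      then show "dominated {g. deriv_chain K g} (\<lambda>g. wnormsq (a + 2 * real n + 2 * (1/2) + 2 - 2 * (1/2)) (g (Suc n))) H"
        using step.IH by (simp only:)
    qed (use step mK in auto)
    show "dominated {g. deriv_chain K g} (\<lambda>g. wnormsq (c n) (g n)) H"
      by (rule ctrl) (use step mK in auto)
  qed (use step mK a in auto)
qed

lemma dominated_wsemisq_powr_mult:
  assumes "0 < \<theta>" "\<theta> < 1" "i \<le> K"
    and "dominated {g. deriv_chain K g} (\<lambda>g. wsemisq (b + 2 * a) \<theta> (g i)) H"
    and "dominated {g. deriv_chain K g} (\<lambda>g. wnormsq (b + 2 * a - 2 * \<theta>) (g i)) H"
  shows "dominated {g. deriv_chain K g} (\<lambda>g. wsemisq b \<theta> (\<lambda>x. x powr a * g i x)) H"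
proof -
  obtain C where "0 \<le> C" and C: "\<And>g. g \<in> borel_measurable borel \<Longrightarrow>
      wsemisq b \<theta> (\<lambda>x. x powr a * g x) \<le> ennreal C * (wsemisq (b + 2 * a) \<theta> g + wnormsq (b + 2 * a - 2 * \<theta>) g)"
    using wsemisq_powr_mult[OF assms(1,2)] by metis
  have "dominated {g. deriv_chain K g} (\<lambda>g. wsemisq b \<theta> (\<lambda>x. x powr a * g i x))
    (\<lambda>g. wsemisq (b + 2 * a) \<theta> (g i) + wnormsq (b + 2 * a - 2 * \<theta>) (g i))"
    by (rule dominatedI[OF \<open>0 \<le> C\<close>]) (use assms(3) in \<open>auto intro!: C deriv_chain_measurable\<close>)
  then show ?thesis by (rule dominated_trans[OF _ dominated_add[OF assms(4,5)]])
qed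

lemma powr_mult_chain_measurable:
  "deriv_chain K g \<Longrightarrow> i \<le> K \<Longrightarrow> (\<lambda>x. x powr r * g i x) \<in> borel_measurable borel"
  using deriv_chain_measurable[of K g i] by measurable

lemma dominated_wnormsq_leibniz:
  assumes "j \<le> K"
    and "\<And>i. i \<le> j \<Longrightarrow> dominated {g. deriv_chain K g} (\<lambda>g. wnormsq (a + 2 * (p - real j + real i)) (g i)) H"
  shows "dominated {g. deriv_chain K g} (\<lambda>g. wnormsq a (leibniz_sum p g j)) H"
proof (rule dominated_trans)
  show "dominated {g. deriv_chain K g} (\<lambda>g. wnormsq a (leibniz_sum p g j))
    (\<lambda>g. \<Sum>i\<le>j. ennreal (real (card {..j}) * (leibniz p j i)\<^sup>2) * wnormsq a (\<lambda>x. x powr (p - real j + real i) * g i x))"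
    unfolding leibniz_sum_def
    by (rule dominated_mono, rule wnormsq_lincomb) (use assms(1) in \<open>auto intro!: powr_mult_chain_measurable\<close>)
  show "dominated {g. deriv_chain K g}
    (\<lambda>g. \<Sum>i\<le>j. ennreal (real (card {..j}) * (leibniz p j i)\<^sup>2) * wnormsq a (\<lambda>x. x powr (p - real j + real i) * g i x)) H"
    unfolding wnormsq_powr_mult
    by (intro dominated_sum dominated_cmult assms(2)) auto
qed

lemma dominated_wsemisq_leibniz:
  assumes "0 < \<theta>" "\<theta> < 1" "j \<le> K"
    and "\<And>i. i \<le> j \<Longrightarrow> dominated {g. deriv_chain K g} (\<lambda>g. wsemisq (b + 2 * (p - real j + real i)) \<theta> (g i)) H"
    and "\<And>i. i \<le> j \<Longrightarrow> dominated {g. deriv_chain K g} (\<lambda>g. wnormsq (b + 2 * (p - real j + real i) - 2 * \<theta>) (g i)) H"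
  shows "dominated {g. deriv_chain K g} (\<lambda>g. wsemisq b \<theta> (leibniz_sum p g j)) H"
proof (rule dominated_trans)
  show "dominated {g. deriv_chain K g} (\<lambda>g. wsemisq b \<theta> (leibniz_sum p g j))
    (\<lambda>g. \<Sum>i\<le>j. ennreal (real (card {..j}) * (leibniz p j i)\<^sup>2) * wsemisq b \<theta> (\<lambda>x. x powr (p - real j + real i) * g i x))"
    unfolding leibniz_sum_def
    by (rule dominated_mono, rule wsemisq_lincomb) (use assms(3) in \<open>auto intro!: powr_mult_chain_measurable\<close>)
  show "dominated {g. deriv_chain K g}
    (\<lambda>g. \<Sum>i\<le>j. ennreal (real (card {..j}) * (leibniz p j i)\<^sup>2) * wsemisq b \<theta> (\<lambda>x. x powr (p - real j + real i) * g i x)) H"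
    using assms(3) by (intro dominated_sum dominated_cmult dominated_wsemisq_powr_mult assms) auto
qed

text \<open>The norm of the Sobolev space, computed from any chain of Borel representatives of the derivatives.\<close>

definition chain_normsq :: "real \<Rightarrow> real \<Rightarrow> (nat \<Rightarrow> real \<Rightarrow> real) \<Rightarrow> ennreal" where
  "chain_normsq s \<gamma> g = (\<Sum>j\<le>nat \<lfloor>s\<rfloor>. wnormsq (\<gamma> + real j) (g j)) +
     (if s \<in> \<nat> then 0 else wsemisq (\<gamma> + s) (s - of_int \<lfloor>s\<rfloor>) (g (nat \<lfloor>s\<rfloor>)))"

lemma frac_pos_of_not_Nats:
  fixes s :: real
  assumes "0 \<le> s" "s \<notin> \<nat>" shows "0 < s - of_int \<lfloor>s\<rfloor>" "s - of_int \<lfloor>s\<rfloor> < 1"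
proof -
  have "s \<noteq> of_int \<lfloor>s\<rfloor>"
  proof
    assume "s = of_int \<lfloor>s\<rfloor>"
    then have "s = real (nat \<lfloor>s\<rfloor>)" using assms(1) by simp
    then show False using assms(2) by (metis of_nat_in_Nats)
  qed
  then show "0 < s - of_int \<lfloor>s\<rfloor>" using of_int_floor_le[of s] by linarith
  show "s - of_int \<lfloor>s\<rfloor> < 1" by linarith
qed

text \<open>The exponents are arranged so that the Leibniz terms of order \<open>j\<close> become
\<open>a + 2i\<close> with \<open>a = \<sigma> + 2p - j\<close> in the \<open>L\<^sup>2\<close> part, and \<open>a + 2i\<close> with \<open>a = \<sigma> + 2p - t\<close>
in the semi-norm. In the latter case, with \<open>k\<close> the integer part of \<open>t\<close>, Hardy's inequality is
iterated up to order \<open>k + 1\<close> if possible. If the integer parts of \<open>s\<close> and \<open>t\<close> coincide, the iteration stops at order \<open>k\<close>, and the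
fractional Hardy inequality of order \<open>s - k\<close> leads to the semi-norm of \<open>\<psi>\<close>.\<close>

lemma dominated_chain_normsq:
  fixes s \<mu> p t \<sigma> :: real
  assumes t: "0 \<le> t" "t \<le> s" and w: "\<sigma> + 2 * p \<ge> \<mu>" and e: "\<sigma> + 2 * p - t > -1"
  shows "dominated {g. deriv_chain (nat \<lfloor>s\<rfloor>) g} (\<lambda>g. chain_normsq t \<sigma> (leibniz_sum p g)) (chain_normsq s \<mu>)"
proof -
  define K where "K = nat \<lfloor>s\<rfloor>"
  define k where "k = nat \<lfloor>t\<rfloor>"
  let ?A = "{g. deriv_chain K g}" and ?H = "chain_normsq s \<mu>"
  have kK: "k \<le> K" unfolding k_def K_def using t by (intro nat_mono floor_mono)
  have kt: "real k \<le> t" "t < real k + 1" using t by (auto simp: k_def)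
  have Ks: "real K \<le> s" "s < real K + 1" using t by (auto simp: K_def)
  have ctrl0: "dominated ?A (\<lambda>g. wnormsq (\<mu> + real j) (g j)) ?H" if "j \<le> K" for j
  proof (rule dominated_mono)
    fix g
    have "wnormsq (\<mu> + real j) (g j) \<le> (\<Sum>j\<le>K. wnormsq (\<mu> + real j) (g j))"
      by (rule member_le_sum) (use that in auto)
    also have "\<dots> \<le> ?H g" by (simp add: chain_normsq_def K_def)
    finally show "wnormsq (\<mu> + real j) (g j) \<le> ?H g" .
  qed
  have ctrl: "dominated ?A (\<lambda>g. wnormsq a (g j)) ?H" if "j \<le> K" "\<mu> + real j \<le> a" for a j
    by (rule dominated_trans[OF dominated_mono ctrl0[OF that(1)]]) (rule wnormsq_mono[OF that(2)])
  have int: "dominated ?A (\<lambda>g. wnormsq (\<sigma> + real j) (leibniz_sum p g j)) ?H" if j: "j \<le> k" for j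
  proof (rule dominated_wnormsq_leibniz)
    show "j \<le> K" using j kK by simp
    fix i assume i: "i \<le> j"
    have "dominated ?A (\<lambda>g. wnormsq ((\<sigma> + 2 * p - real j) + 2 * real i) (g i)) ?H"
    proof (rule dominated_iterated_hardy[of _ i j K _ "\<lambda>j. \<mu> + real j"])
      show "dominated ?A (\<lambda>g. wnormsq ((\<sigma> + 2 * p - real j) + 2 * real j) (g j)) ?H"
        by (rule ctrl) (use j kK w in auto)
    qed (use ctrl0 e kt i j kK in auto)
    moreover have "(\<sigma> + 2 * p - real j) + 2 * real i = \<sigma> + real j + 2 * (p - real j + real i)" by simp
    ultimately show "dominated ?A (\<lambda>g. wnormsq (\<sigma> + real j + 2 * (p - real j + real i)) (g i)) ?H"
      by (simp only:)
  qed
  have semi: "dominated ?A (\<lambda>g. wsemisq (\<sigma> + t) (t - of_int \<lfloor>t\<rfloor>) (leibniz_sum p g k)) ?H" if tn: "t \<notin> \<nat>"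
  proof -
    define \<theta> where "\<theta> = t - of_int \<lfloor>t\<rfloor>"
    have \<theta>: "0 < \<theta>" "\<theta> < 1" using frac_pos_of_not_Nats[OF t(1) tn] by (auto simp: \<theta>_def)
    have t_eq: "t = real k + \<theta>" using t by (simp add: \<theta>_def k_def)
    define a where "a = \<sigma> + 2 * p - t"
    have a: "a > -1" using e by (simp add: a_def)
    (* Here a + 2(k+1) >= mu + k + 1 because t < k + 1. *)
    have top: "dominated ?A (\<lambda>g. wnormsq (a + 2 * real (Suc k)) (g (Suc k))) ?H" if "k < K"
      by (rule ctrl) (use that w kt in \<open>auto simp: a_def\<close>)
    define \<theta>' where "\<theta>' = s - of_int \<lfloor>s\<rfloor>"
    (* With equal integer parts, t <= s forces s to be a non-integer, so the norm contains the semi-norm. *)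
    have frac: "dominated ?A (\<lambda>g. wsemisq (\<mu> + s) \<theta>' (g K)) ?H" "0 < \<theta>'" "\<theta> \<le> \<theta>'" "s = real K + \<theta>'"
      if "k = K"
    proof -
      show s_eq: "s = real K + \<theta>'" using t by (simp add: \<theta>'_def K_def)
      show th: "\<theta> \<le> \<theta>'" using s_eq t_eq t(2) that by linarith
      then show "0 < \<theta>'" using \<theta> by linarith
      then have "s \<notin> \<nat>" by (auto simp: \<theta>'_def Nats_def)
      then show "dominated ?A (\<lambda>g. wsemisq (\<mu> + s) \<theta>' (g K)) ?H"
        by (intro dominated_mono) (simp add: chain_normsq_def K_def \<theta>'_def)
    qed
    have low: "dominated ?A (\<lambda>g. wnormsq (a + 2 * real i) (g i)) ?H" if i: "i \<le> k" for i
    proof (cases "k < K")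
      case True
      show ?thesis
        by (rule dominated_iterated_hardy[OF a _ _ top[OF True] ctrl0]) (use True i in auto)
    next
      case False
      then have [simp]: "k = K" using kK by simp
      show ?thesis
      proof (rule dominated_iterated_hardy[OF a i, where c="\<lambda>j. \<mu> + real j"])
        show "dominated ?A (\<lambda>g. wnormsq (a + 2 * real k) (g k)) ?H"
        proof (rule dominated_fractional_hardy[where \<theta>=\<theta>' and c="\<mu> + real K"])
          have "\<mu> + s \<le> a + 2 * real k + 2 * \<theta>'" using frac(4) w t by (simp add: a_def)
          then show "dominated ?A (\<lambda>g. wsemisq (a + 2 * real k + 2 * \<theta>') \<theta>' (g k)) ?H"
            unfolding \<open>k = K\<close> by (intro dominated_trans[OF dominated_mono frac(1)] wsemisq_mono) simp_all
        qed (use a frac ctrl0 in auto)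
      qed (use ctrl0 in auto)
    qed
    have "dominated ?A (\<lambda>g. wsemisq (\<sigma> + t) \<theta> (leibniz_sum p g k)) ?H"
    proof (rule dominated_wsemisq_leibniz[OF \<theta> kK])
      fix i assume i: "i \<le> k"
      have eq1: "\<sigma> + t + 2 * (p - real k + real i) - 2 * \<theta> = a + 2 * real i"
        using t_eq by (simp add: a_def)
      show "dominated ?A (\<lambda>g. wnormsq (\<sigma> + t + 2 * (p - real k + real i) - 2 * \<theta>) (g i)) ?H"
        unfolding eq1 by (rule low[OF i])
      show "dominated ?A (\<lambda>g. wsemisq (\<sigma> + t + 2 * (p - real k + real i)) \<theta> (g i)) ?H"
      proof (cases "i < K")
        case True
        have eq2: "\<sigma> + t + 2 * (p - real k + real i) + 2 - 2 * \<theta> = a + 2 * real (Suc i)"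
          using t_eq by (simp add: a_def)
        show ?thesis
        proof (rule dominated_wsemisq_by_deriv[OF \<theta>(2) True])
          show "dominated ?A (\<lambda>g. wnormsq (\<sigma> + t + 2 * (p - real k + real i) + 2 - 2 * \<theta>) (g (Suc i))) ?H"
            unfolding eq2 using i True top low[of "Suc i"] by (cases "i = k") auto
        qed
      next
        case False
        then have iK: "i = K" "k = K" using i kK by auto
        let ?b = "\<sigma> + t + 2 * (p - real k + real i)"
        have "dominated ?A (\<lambda>g. wsemisq ?b \<theta> (g i)) (\<lambda>g. wsemisq (?b + 2 * (\<theta>' - \<theta>)) \<theta>' (g K))"
          unfolding iK(1)[symmetric] by (intro dominated_mono wsemisq_order_mono frac(3) iK(2)) simp
        moreover have "\<mu> + s \<le> ?b + 2 * (\<theta>' - \<theta>)"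
          using frac(4) t_eq w t iK by simp
        then have "dominated ?A (\<lambda>g. wsemisq (?b + 2 * (\<theta>' - \<theta>)) \<theta>' (g K)) (\<lambda>g. wsemisq (\<mu> + s) \<theta>' (g K))"
          by (intro dominated_mono wsemisq_mono)
        ultimately show ?thesis using frac(1)[OF iK(2)] by (blast intro: dominated_trans)
      qed
    qed
    then show ?thesis by (simp only: \<theta>_def)
  qed
  have "dominated ?A (\<lambda>g. (\<Sum>j\<le>k. wnormsq (\<sigma> + real j) (leibniz_sum p g j)) +
     (if t \<in> \<nat> then 0 else wsemisq (\<sigma> + t) (t - of_int \<lfloor>t\<rfloor>) (leibniz_sum p g k))) ?H"
  proof (intro dominated_add dominated_sum int)
    show "dominated ?A (\<lambda>g. if t \<in> \<nat> then 0 else wsemisq (\<sigma> + t) (t - of_int \<lfloor>t\<rfloor>) (leibniz_sum p g k)) ?H"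
      using semi dominated_zero by (cases "t \<in> \<nat>") simp_all
  qed auto
  then show ?thesis unfolding k_def K_def chain_normsq_def[abs_def] .
qed

section \<open>From weak derivatives to chains\<close>

lemma L2_normsq_eq:
  assumes "eqJ w g" shows "L2_normsq \<gamma> w = wnormsq \<gamma> g"
proof -
  have "L2_normsq \<gamma> w = (\<integral>\<^sup>+x\<in>J. ennreal (x powr \<gamma> * (w x)\<^sup>2) \<partial>lborel)"
    unfolding L2_normsq_def by (rule nn_integral_completion)
  also have "\<dots> = wnormsq \<gamma> g"
    unfolding wnormsq_def
    by (rule nn_integral_cong_AE, rule eventually_mono[OF assms]) (auto simp: indicator_def)
  finally show ?thesis .
qed

text \<open>Stated for the product measure, since the semi-norm is an integral over the plane: an exceptional null
set \<open>N\<close> on the line becomes two null strips.\<close>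

lemma AE_lborel_pair:
  fixes P :: "real \<Rightarrow> bool"
  assumes "AE x in lborel. P x"
  shows "AE z in lborel \<Otimes>\<^sub>M lborel. P (fst z) \<and> P (snd z)"
proof -
  obtain N where N: "{x. \<not> P x} \<subseteq> N" "N \<in> null_sets lborel"
    using assms unfolding eventually_ae_filter by auto
  have [measurable]: "N \<in> sets borel" using N(2) by auto
  have 1: "N \<times> UNIV \<in> null_sets (lborel \<Otimes>\<^sub>M lborel)" "UNIV \<times> N \<in> null_sets (lborel \<Otimes>\<^sub>M lborel)"
    using N(2) by (auto simp: null_sets_def lborel.emeasure_pair_measure_Times)
  show ?thesis
  proof (rule AE_I'[OF null_sets.Un[OF 1]])
    show "{z \<in> space (lborel \<Otimes>\<^sub>M lborel). \<not> (P (fst z) \<and> P (snd z))} \<subseteq> N \<times> UNIV \<union> UNIV \<times> N"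
      using N(1) by auto
  qed
qed

lemma H_seminormsq_eq:
  assumes eq: "eqJ (weak_deriv (nat \<lfloor>s\<rfloor>) f) g" and [measurable]: "g \<in> borel_measurable borel"
  shows "H_seminormsq s \<gamma> f = wsemisq (\<gamma> + s) (s - of_int \<lfloor>s\<rfloor>) g"
proof -
  let ?F = "\<lambda>w z. (case z of (x, y) \<Rightarrow> ennreal (x powr (\<gamma> + s) *
            (\<bar>w x - w y\<bar>\<^sup>2 / \<bar>x - y\<bar> powr (1 + 2 * (s - of_int \<lfloor>s\<rfloor>))))) * indicator near_diag z"
  have "H_seminormsq s \<gamma> f = (\<integral>\<^sup>+z. ?F (weak_deriv (nat \<lfloor>s\<rfloor>) f) z \<partial>lebesgue)"
    by (simp add: H_seminormsq_def near_diag_def)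
  also have "\<dots> = (\<integral>\<^sup>+z. ?F (weak_deriv (nat \<lfloor>s\<rfloor>) f) z \<partial>(lborel \<Otimes>\<^sub>M lborel))"
    by (simp only: nn_integral_completion lborel_prod)
  also have "\<dots> = (\<integral>\<^sup>+z. ?F g z \<partial>(lborel \<Otimes>\<^sub>M lborel))"
  proof (rule nn_integral_cong_AE, rule eventually_mono[OF AE_lborel_pair[OF eq]])
    fix z :: "real \<times> real"
    assume "(fst z \<in> J \<longrightarrow> weak_deriv (nat \<lfloor>s\<rfloor>) f (fst z) = g (fst z)) \<and>
       (snd z \<in> J \<longrightarrow> weak_deriv (nat \<lfloor>s\<rfloor>) f (snd z) = g (snd z))"
    then show "?F (weak_deriv (nat \<lfloor>s\<rfloor>) f) z = ?F g z"
      by (cases "z \<in> near_diag") (auto simp: near_diag_def split: prod.splits)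
  qed
  also have "\<dots> = (\<integral>\<^sup>+x. \<integral>\<^sup>+y. ?F g (x, y) \<partial>lborel \<partial>lborel)"
    by (rule lborel.nn_integral_fst[symmetric]) measurable
  also have "\<dots> = wsemisq (\<gamma> + s) (s - of_int \<lfloor>s\<rfloor>) g"
    by (simp add: wsemisq_def)
  finally show ?thesis .
qed

text \<open>Weak derivatives are unique up to null sets, so the arbitrary choice in \<open>weak_deriv\<close> does not
influence the norm.\<close>

lemma H_normsq_eq_chain:
  assumes "\<And>j. j \<le> nat \<lfloor>s\<rfloor> \<Longrightarrow> has_weak_deriv j f (g j)"
    and "\<And>j. j \<le> nat \<lfloor>s\<rfloor> \<Longrightarrow> locint (g j)"
  shows "H_normsq s \<gamma> f = chain_normsq s \<gamma> g"
proof -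
  have eq: "eqJ (weak_deriv j f) (g j)" if "j \<le> nat \<lfloor>s\<rfloor>" for j
    using has_weak_deriv_unique[OF _ assms(1)[OF that]] someI[of "has_weak_deriv j f", OF assms(1)[OF that]]
    by (simp add: weak_deriv_def)
  have "(\<Sum>j\<le>nat \<lfloor>s\<rfloor>. L2_normsq (\<gamma> + real j) (weak_deriv j f)) = (\<Sum>j\<le>nat \<lfloor>s\<rfloor>. wnormsq (\<gamma> + real j) (g j))"
    by (intro sum.cong refl L2_normsq_eq eq) simp
  moreover have "H_seminormsq s \<gamma> f = wsemisq (\<gamma> + s) (s - of_int \<lfloor>s\<rfloor>) (g (nat \<lfloor>s\<rfloor>))"
    by (intro H_seminormsq_eq eq locint_measurable assms(2)) simp_all
  moreover have "\<forall>j\<le>nat \<lfloor>s\<rfloor>. \<exists>g. has_weak_deriv j f g" using assms(1) by blast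
  ultimately show ?thesis unfolding H_normsq_def chain_normsq_def by simp
qed

text \<open>A finite norm contains the existence of the weak derivatives, from which Borel representatives are
chosen.\<close>

lemma H_space_chain:
  assumes "\<psi> \<in> H_space s \<mu>"
  obtains g where "deriv_chain (nat \<lfloor>s\<rfloor>) g" "eqJ \<psi> (g 0)" "H_normsq s \<mu> \<psi> = chain_normsq s \<mu> g"
proof -
  let ?K = "nat \<lfloor>s\<rfloor>"
  have "H_normsq s \<mu> \<psi> < \<infinity>" using assms by (simp add: H_space_def)
  then have ex: "\<forall>j\<le>?K. \<exists>g. has_weak_deriv j \<psi> g" unfolding H_normsq_def by (auto split: if_splits)
  have "\<exists>g. locint g \<and> has_weak_deriv j \<psi> g" if j: "j \<le> ?K" for j
  proof -
    obtain w where w: "has_weak_deriv j \<psi> w" using ex j by blast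
    obtain w0 where w0: "locint w0" "eqJ w w0" using w borel_representative by (auto simp: has_weak_deriv_def)
    obtain f0 where f0: "locint f0" "eqJ \<psi> f0" using w borel_representative by (auto simp: has_weak_deriv_def)
    have "has_weak_deriv j \<psi> w0"
      using w unfolding has_weak_deriv_iff[OF f0 w0] by (subst has_weak_deriv_iff[OF f0 w0(1)]) auto
    then show ?thesis using w0 by blast
  qed
  then obtain g where g: "\<And>j. j \<le> ?K \<Longrightarrow> locint (g j)" "\<And>j. j \<le> ?K \<Longrightarrow> has_weak_deriv j \<psi> (g j)" by metis
  have "deriv_chain ?K g"
    unfolding deriv_chain_def
  proof (intro conjI allI impI g(1))
    fix i assume i: "i < ?K"
    show "weak_D (g i) (g (Suc i))"
      by (rule weak_D_of_has_weak_deriv[OF g(2)[of i] g(2)[of "Suc i"] g(1) _ g(1)]) (use i in simp_all)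
  qed
  moreover have "eqJ \<psi> (g 0)"
  proof (rule has_weak_deriv_unique[OF _ g(2)])
    show "has_weak_deriv 0 \<psi> \<psi>" using g(2)[of 0] by (simp add: has_weak_deriv_def)
  qed simp
  moreover have "H_normsq s \<mu> \<psi> = chain_normsq s \<mu> g" by (intro H_normsq_eq_chain g)
  ultimately show ?thesis by (rule that)
qed

lemma H_normsq_powr_mult_eq_chain:
  assumes g: "deriv_chain K g" "eqJ \<psi> (g 0)" and k: "nat \<lfloor>t\<rfloor> \<le> K"
  shows "H_normsq t \<sigma> (\<lambda>x. x powr p * \<psi> x) = chain_normsq t \<sigma> (leibniz_sum p g)"
proof (rule H_normsq_eq_chain)
  have loc: "locint (leibniz_sum p g j)" if "j \<le> K" for j
    unfolding leibniz_sum_def using g that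
    by (intro locint_sum locint_cmult locint_powr_mult) (auto simp: deriv_chain_def)
  have D: "weak_D (leibniz_sum p g i) (leibniz_sum p g (Suc i))" if "i < K" for i
    by (rule weak_D_leibniz_sum) (use g that in \<open>auto simp: deriv_chain_def\<close>)
  have eq: "eqJ (\<lambda>x. x powr p * \<psi> x) (leibniz_sum p g 0)"
    by (rule eventually_mono[OF g(2)]) (auto simp: leibniz_sum_def)
  fix j assume j: "j \<le> nat \<lfloor>t\<rfloor>"
  show "has_weak_deriv j (\<lambda>x. x powr p * \<psi> x) (leibniz_sum p g j)"
    by (rule has_weak_deriv_of_weak_D) (use eq loc D j k in auto)
  show "locint (leibniz_sum p g j)" by (rule loc) (use j k in simp)
qed

theorem theorem4:
  fixes s \<mu> p t \<sigma> :: real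
  assumes "s \<ge> 0" and "\<mu> > -1"
    and "0 \<le> t" and "t \<le> s"
    and "\<sigma> + 2 * p \<ge> \<mu>"
    and "\<sigma> + 2 * p - t > -1"
    and "\<sigma> + 2 * p + t \<ge> \<mu> + s"
  shows "(\<forall>\<psi>\<in>H_space s \<mu>. (\<lambda>x. x powr p * \<psi> x) \<in> H_space t \<sigma>) \<and>
    (\<exists>C>0. \<forall>\<psi>\<in>H_space s \<mu>.
       H_norm t \<sigma> (\<lambda>x. x powr p * \<psi> x) \<le> C * H_norm s \<mu> \<psi>)"
proof -
  have kK: "nat \<lfloor>t\<rfloor> \<le> nat \<lfloor>s\<rfloor>" using assms(4) by (intro nat_mono floor_mono)
  obtain C where C: "0 \<le> C" "\<And>g. deriv_chain (nat \<lfloor>s\<rfloor>) g \<Longrightarrow>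
      chain_normsq t \<sigma> (leibniz_sum p g) \<le> ennreal C * chain_normsq s \<mu> g"
    using dominated_chain_normsq[OF assms(3-6)] unfolding dominated_def by blast
  have bound: "H_normsq t \<sigma> (\<lambda>x. x powr p * \<psi> x) \<le> ennreal C * H_normsq s \<mu> \<psi>"
    if \<psi>: "\<psi> \<in> H_space s \<mu>" for \<psi>
  proof -
    obtain g where g: "deriv_chain (nat \<lfloor>s\<rfloor>) g" "eqJ \<psi> (g 0)" "H_normsq s \<mu> \<psi> = chain_normsq s \<mu> g"
      by (rule H_space_chain[OF \<psi>])
    show ?thesis
      using C(2)[OF g(1)] H_normsq_powr_mult_eq_chain[OF g(1,2) kK, of \<sigma> p] g(3) by simp
  qed
  have fin: "H_normsq s \<mu> \<psi> < \<infinity>" if "\<psi> \<in> H_space s \<mu>" for \<psi> using that by (simp add: H_space_def)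
  have fin': "H_normsq t \<sigma> (\<lambda>x. x powr p * \<psi> x) < \<infinity>" if "\<psi> \<in> H_space s \<mu>" for \<psi>
    using bound[OF that] fin[OF that] by (auto simp: ennreal_mult_less_top intro: order_le_less_trans)
  have "(\<lambda>x. x powr p * \<psi> x) \<in> H_space t \<sigma>" if "\<psi> \<in> H_space s \<mu>" for \<psi>
  proof -
    have [measurable]: "\<psi> \<in> borel_measurable (lebesgue_on J)" using that by (simp add: H_space_def)
    have [measurable]: "(\<lambda>x. x powr p) \<in> borel_measurable (lebesgue_on J)"
      by (intro measurable_restrict_space1 measurable_completion) measurable
    have "(\<lambda>x. x powr p * \<psi> x) \<in> borel_measurable (lebesgue_on J)" by measurable
    then show ?thesis using fin'[OF that] by (simp add: H_space_def)
  qed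
  moreover have "H_norm t \<sigma> (\<lambda>x. x powr p * \<psi> x) \<le> sqrt (C + 1) * H_norm s \<mu> \<psi>" if "\<psi> \<in> H_space s \<mu>" for \<psi>
  proof -
    have "enn2real (H_normsq t \<sigma> (\<lambda>x. x powr p * \<psi> x)) \<le> enn2real (ennreal C * H_normsq s \<mu> \<psi>)"
      using bound[OF that] fin[OF that] by (intro enn2real_mono) (auto simp: ennreal_mult_less_top)
    also have "\<dots> = C * enn2real (H_normsq s \<mu> \<psi>)" using C(1) by (simp add: enn2real_mult)
    also have "\<dots> \<le> (C + 1) * enn2real (H_normsq s \<mu> \<psi>)" by (intro mult_right_mono) auto
    finally have "H_norm t \<sigma> (\<lambda>x. x powr p * \<psi> x) \<le> sqrt ((C + 1) * enn2real (H_normsq s \<mu> \<psi>))"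
      unfolding H_norm_def by (rule real_sqrt_le_mono)
    then show ?thesis by (simp add: H_norm_def real_sqrt_mult)
  qed
  moreover have "sqrt (C + 1) > 0" using C(1) by simp
  ultimately show ?thesis by blast
qed

end
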